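(* Let $G=GL(\ell+1,\mathbb{R})$, let $K=O(\ell+1)$ be its maximal compact subgroup, and let $\phi_{\mathcal{Q}_0(\lambda)}$ be the $K$-biinvariant function on $G$ given by $$\phi_{\mathcal{Q}_0(\lambda)}(g)=2^{\ell+1}\,|\det g|^{\imath\lambda+\frac{\ell}{2}}\,e^{-\pi\,\mathrm{Tr}\,g^tg}.$$ (i) The action of $\phi_{\mathcal{Q}_0(\lambda)}$ by convolution on functions $f$ on $G$ satisfying $f(kan)=\chi_{N_-}(n)f(a)$ for $k\in K$, $a\in A$, $n\in N_-$ descends to the action of the operator $\mathcal{Q}_0^{\mathfrak{gl}_{\ell+1}}(\lambda)$ on functions on $A$. That is, for $a=\mathrm{diag}(e^{x_1},\ldots,e^{x_{\ell+1}})$, $$(\phi_{\mathcal{Q}_0(\lambda)}*f)(a)=\int_{\mathbb{R}^{\ell+1}}\mathcal{Q}_0^{\mathfrak{gl}_{\ell+1}}(\underline{x},\underline{y}|\lambda)\,f\big(\mathrm{diag}(e^{y_1},\ldots,e^{y_{\ell+1}})\big)\prod_{i=1}^{\ell+1}dy_i .$$ (ii) The action of $\phi_{\mathcal{Q}_0(\lambda)}$ by convolution on the modified Whittaker function $\Phi^{\mathfrak{gl}_{\ell+1}}_{\underline\gamma}$ is given by $$\big(\phi_{\mathcal{Q}_0(\lambda)}*\Phi^{\mathfrak{gl}_{\ell+1}}_{\underline\gamma}\big)(g)=L_\infty(\lambda)\,\Phi^{\mathfrak{gl}_{\ell+1}}_{\underline\gamma}(g),$$ where $L_\infty(\lambda)$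 is the local Archimedean $L$-factor $$L_\infty(\lambda)=\prod_{j=1}^{\ell+1}\pi^{-\frac{\imath\lambda-\imath\gamma_j+\rho_j}{2}}\,\Gamma\Big(\frac{\imath\lambda-\imath\gamma_j+\rho_j}{2}\Big).$$
   Context: Here $\imath=\sqrt{-1}$, $\underline\gamma=(\gamma_1,\ldots,\gamma_{\ell+1})$, and $\rho_j=\frac{\ell}{2}+1-j$ for $j=1,\ldots,\ell+1$, with $\langle\rho,x\rangle=\sum_j\rho_jx_j$. Convolution is $(\phi*f)(g)=\int_G\phi(g\tilde g^{-1})f(\tilde g)\,d\tilde g$. In the Iwasawa decomposition $\tilde g=kan$, $A$ is the group of positive diagonal matrices and $N_-$ is the group of lower triangular unipotent matrices. The Haar measure is $d\tilde g=\delta_{B_-}(a)\,dk\,d^\times a\,dn$ with $\int_K dk=1$; $d^\times a=\prod_i dy_i$ for $a=\mathrm{diag}(e^{y_1},\ldots,e^{y_{\ell+1}})$; $dn=\prod_{i>j}dn_{ij}$; and $\delta_{B_-}(a)=\det_{\mathfrak{n}_-}\mathrm{Ad}_a=e^{\sum_{i>j}(y_i-y_j)}$, where $\mathfrak n_-$ is the Lie algebra of $N_-$. The character of $N_-$ is $\chi_{N_-}(n)=\exp\{2\pi\imath\sum_{i=1}^{\ell}n_{i+1,i}\}$. The modified Baxter operator $\mathcal{Q}_0^{\mathfrak{gl}_{\ell+1}}(\lambda)$ is the integral operator with kernel $$\mathcal{Q}_0^{\mathfrak{gl}_{\ell+1}}(\underline{x},\underline{y}|\lambda)=2^{\ell+1}\exp\Big\{\sum_{j=1}^{\ell+1}(\imath\lambda+\rho_j)(x_j-y_j)-\pi\sum_{k=1}^{\ell}\big(e^{2(x_k-y_k)}+e^{2(y_k-x_{k+1})}\big)-\pi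 e^{2(x_{\ell+1}-y_{\ell+1})}\Big\}.$$ The modified Whittaker function $\Phi^{\mathfrak{gl}_{\ell+1}}_{\underline\gamma}$ is the matrix element $\Phi_{\underline\gamma}(g)=\langle k|\pi_{\underline\gamma}(g)|\psi_R\rangle$ between the spherical vector $\langle k|$ and the Whittaker vector $\psi_R$ in the principal series representation $\pi_{\underline\gamma}$ of $G$. It satisfies $\Phi_{\underline\gamma}(kan)=\chi_{N_-}(n)\Phi_{\underline\gamma}(a)$ and, for $a=\mathrm{diag}(e^{x_1},\ldots,e^{x_{\ell+1}})$, $\Phi_{\underline\gamma}(a)=e^{\langle\rho,x\rangle}\Psi^{\mathfrak{gl}_{\ell+1}}_{\underline\gamma}(\underline{x})$. Here $\Psi^{\mathfrak{gl}_{\ell+1}}_{\underline\gamma}$ is the Weyl-group-invariant $\mathfrak{gl}_{\ell+1}$-Whittaker function in the parametrization coming from the Iwasawa decomposition, with Toda coupling constants $\pi$; up to a constant factor, with $x_{\ell+1,i}:=x_i$, $$\Psi^{\mathfrak{gl}_{\ell+1}}_{\underline\gamma}(\underline{x})=\int\prod_{k=1}^{\ell}\prod_{i=1}^k dx_{k,i}\exp\Big\{\imath\sum_{k=1}^{\ell+1}\gamma_k\Big(\sum_{i=1}^k x_{k,i}-\sum_{i=1}^{k-1}x_{k-1,i}\Big)-\pi\sum_{k=1}^{\ell}\sum_{i=1}^{k}\big(e^{2(x_{k+1,i}-x_{k,i})}+e^{2(x_{k,i}-x_{k+1,i+1})}\big)\Big\}.$$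
   Formalization: In (ii) the printed eigenvalue is false for ℓ≥1 (e.g. ℓ=1, γ=0): the ρ_j is dropped, giving ∏π^{-(iλ-iγ_j)/2}Γ((iλ-iγ_j)/2). Convergence is made explicit: absolute convergence of the convolution assumed in (i), Re(iλ-iγ_j)>0 for all j in (ii). *)

theory Defs
  imports
    "HOL-Probability.Probability"
    "Jordan_Normal_Form.Determinant"
    "Jordan_Normal_Form.Gauss_Jordan_Elimination"
begin

text \<open>
  Vectors are functions on the indices \<open>1, \<dots>, l + 1\<close>, as in the formulas of the source. Library
  matrices are indexed from \<open>0\<close>; the shift occurs only in \<open>A_elt\<close> and \<open>N_elt\<close>.
\<close>

section \<open>The group and its Iwasawa decomposition\<close>

definition GL :: "nat \<Rightarrow> real mat set" where
  "GL l = {g \<in> carrier_mat (l + 1) (l + 1). Determinant.det g \<noteq> 0}"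

definition K_grp :: "nat \<Rightarrow> real mat set" where
  "K_grp l = {k \<in> carrier_mat (l + 1) (l + 1). transpose_mat k * k = 1\<^sub>m (l + 1)}"

definition A_elt :: "nat \<Rightarrow> (nat \<Rightarrow> real) \<Rightarrow> real mat" where
  "A_elt l x = mat_diag (l + 1) (\<lambda>i. exp (x (Suc i)))"

definition lower_idx :: "nat \<Rightarrow> (nat \<times> nat) set" where
  "lower_idx l = {(i, j). 1 \<le> j \<and> j < i \<and> i \<le> l + 1}"

definition N_elt :: "nat \<Rightarrow> (nat \<times> nat \<Rightarrow> real) \<Rightarrow> real mat" where
  "N_elt l n = mat (l + 1) (l + 1)
     (\<lambda>(i, j). if i = j then 1 else if j < i then n (Suc i, Suc j) else 0)"

definition chi_N :: "nat \<Rightarrow> (nat \<times> nat \<Rightarrow> real) \<Rightarrow> complex" where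
  "chi_N l n = exp (2 * of_real pi * \<i> * of_real (\<Sum>i = 1..l. n (i + 1, i)))"

definition equivariant :: "nat \<Rightarrow> (real mat \<Rightarrow> complex) \<Rightarrow> bool" where
  "equivariant l f \<longleftrightarrow>
     (\<forall>k \<in> K_grp l. \<forall>x n. f (k * A_elt l x * N_elt l n) = chi_N l n * f (A_elt l x))"

text \<open>Library matrices carry no topology; \<open>borel_K\<close> is the trace of the Borel sets of matrix entries.\<close>

definition borel_K :: "nat \<Rightarrow> real mat measure" where
  "borel_K l = vimage_algebra (K_grp l)
     (\<lambda>k. restrict (\<lambda>p. k $$ p) ({..l} \<times> {..l})) (\<Pi>\<^sub>M p \<in> {..l} \<times> {..l}. borel)"

definition normalized_haar_K :: "nat \<Rightarrow> real mat measure \<Rightarrow> bool" where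
  "normalized_haar_K l \<mu> \<longleftrightarrow> sets \<mu> = sets (borel_K l) \<and> prob_space \<mu> \<and>
     (\<forall>k \<in> K_grp l. distr \<mu> (borel_K l) (\<lambda>h. k * h) = \<mu> \<and> distr \<mu> (borel_K l) (\<lambda>h. h * k) = \<mu>)"

definition lebesgue_A :: "nat \<Rightarrow> (nat \<Rightarrow> real) measure" where
  "lebesgue_A l = (\<Pi>\<^sub>M i \<in> {1..l + 1}. lborel)"

definition lebesgue_N :: "nat \<Rightarrow> (nat \<times> nat \<Rightarrow> real) measure" where
  "lebesgue_N l = (\<Pi>\<^sub>M p \<in> lower_idx l. lborel)"

definition delta_B :: "nat \<Rightarrow> (nat \<Rightarrow> real) \<Rightarrow> real" where
  "delta_B l y = exp (\<Sum>(i, j) \<in> lower_idx l. y i - y j)"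

text \<open>The Haar measure \<open>\<delta>(a) dk da dn\<close> of \<open>G\<close> in the coordinates \<open>(k, y, n)\<close> given by
  \<open>g = k \<cdot> A_elt l y \<cdot> N_elt l n\<close>.\<close>

definition haar_G ::
  "nat \<Rightarrow> real mat measure \<Rightarrow> (real mat \<times> (nat \<Rightarrow> real) \<times> (nat \<times> nat \<Rightarrow> real)) measure" where
  "haar_G l \<mu> = density (\<mu> \<Otimes>\<^sub>M (lebesgue_A l \<Otimes>\<^sub>M lebesgue_N l)) (\<lambda>(k, y, n). ennreal (delta_B l y))"

definition iwasawa :: "nat \<Rightarrow> real mat \<times> (nat \<Rightarrow> real) \<times> (nat \<times> nat \<Rightarrow> real) \<Rightarrow> real mat" where
  "iwasawa l = (\<lambda>(k, y, n). k * A_elt l y * N_elt l n)"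

definition conv_integrand ::
  "nat \<Rightarrow> (real mat \<Rightarrow> complex) \<Rightarrow> (real mat \<Rightarrow> complex) \<Rightarrow> real mat \<Rightarrow>
   real mat \<times> (nat \<Rightarrow> real) \<times> (nat \<times> nat \<Rightarrow> real) \<Rightarrow> complex" where
  "conv_integrand l \<phi> f g p = \<phi> (g * the (mat_inverse (iwasawa l p))) * f (iwasawa l p)"

text \<open>The integral over \<open>G\<close> is meaningful only if it converges absolutely, so existence is recorded
  separately.\<close>

definition conv_exists ::
  "nat \<Rightarrow> real mat measure \<Rightarrow> (real mat \<Rightarrow> complex) \<Rightarrow> (real mat \<Rightarrow> complex) \<Rightarrow> real mat \<Rightarrow> bool" where
  "conv_exists l \<mu> \<phi> f g \<longleftrightarrow> integrable (haar_G l \<mu>) (conv_integrand l \<phi> f g)"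

definition conv ::
  "nat \<Rightarrow> real mat measure \<Rightarrow> (real mat \<Rightarrow> complex) \<Rightarrow> (real mat \<Rightarrow> complex) \<Rightarrow> real mat \<Rightarrow> complex" where
  "conv l \<mu> \<phi> f g = (LINT p | haar_G l \<mu>. conv_integrand l \<phi> f g p)"

section \<open>The kernel functions\<close>

definition rho :: "nat \<Rightarrow> nat \<Rightarrow> real" where
  "rho l j = real l / 2 + 1 - real j"

definition mat_trace :: "real mat \<Rightarrow> real" where
  "mat_trace M = (\<Sum>i < dim_row M. M $$ (i, i))"

definition phi_Q0 :: "nat \<Rightarrow> complex \<Rightarrow> real mat \<Rightarrow> complex" where
  "phi_Q0 l lam g = 2 ^ (l + 1) * of_real \<bar>Determinant.det g\<bar> powr (\<i> * lam + of_nat l / 2)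
     * of_real (exp (- pi * mat_trace (transpose_mat g * g)))"

definition K_biinvariant :: "nat \<Rightarrow> (real mat \<Rightarrow> complex) \<Rightarrow> bool" where
  "K_biinvariant l \<phi> \<longleftrightarrow>
     (\<forall>k1 \<in> K_grp l. \<forall>k2 \<in> K_grp l. \<forall>g \<in> GL l. \<phi> (k1 * g * k2) = \<phi> g)"

definition Q0 :: "nat \<Rightarrow> (nat \<Rightarrow> real) \<Rightarrow> (nat \<Rightarrow> real) \<Rightarrow> complex \<Rightarrow> complex" where
  "Q0 l x y lam = 2 ^ (l + 1) *
     exp ((\<Sum>j = 1..l + 1. (\<i> * lam + of_real (rho l j)) * of_real (x j - y j))
        - of_real (pi * (\<Sum>k = 1..l. exp (2 * (x k - y k)) + exp (2 * (y k - x (k + 1)))))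
        - of_real (pi * exp (2 * (x (l + 1) - y (l + 1)))))"

section \<open>Whittaker functions\<close>

definition tri_idx :: "nat \<Rightarrow> (nat \<times> nat) set" where
  "tri_idx l = {(k, i). 1 \<le> i \<and> i \<le> k \<and> k \<le> l}"

text \<open>The triangular array of integration variables, completed by the row \<open>x\<^sub>l\<^sub>+\<^sub>1\<^sub>,\<^sub>i = x\<^sub>i\<close>.\<close>

definition tri_ext :: "nat \<Rightarrow> (nat \<Rightarrow> real) \<Rightarrow> (nat \<times> nat \<Rightarrow> real) \<Rightarrow> nat \<Rightarrow> nat \<Rightarrow> real" where
  "tri_ext l x X k i = (if k = l + 1 then x i else X (k, i))"

definition whittaker_integrand ::
  "nat \<Rightarrow> (nat \<Rightarrow> complex) \<Rightarrow> (nat \<Rightarrow> nat \<Rightarrow> real) \<Rightarrow> complex" where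
  "whittaker_integrand l \<gamma> t =
     exp (\<i> * (\<Sum>k = 1..l + 1. \<gamma> k * of_real ((\<Sum>i = 1..k. t k i) - (\<Sum>i = 1..k - 1. t (k - 1) i)))
        - of_real (pi * (\<Sum>k = 1..l. \<Sum>i = 1..k.
            exp (2 * (t (k + 1) i - t k i)) + exp (2 * (t k i - t (k + 1) (i + 1))))))"

definition whittaker :: "nat \<Rightarrow> (nat \<Rightarrow> complex) \<Rightarrow> (nat \<Rightarrow> real) \<Rightarrow> complex" where
  "whittaker l \<gamma> x =
     (LINT X | (\<Pi>\<^sub>M p \<in> tri_idx l. lborel). whittaker_integrand l \<gamma> (tri_ext l x X))"

text \<open>The function is normalised only up to a constant factor, since the spherical and the Whittaker
  vector are.\<close>

definition modified_whittaker :: "nat \<Rightarrow> (nat \<Rightarrow> complex) \<Rightarrow> (real mat \<Rightarrow> complex) \<Rightarrow> bool" where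
  "modified_whittaker l \<gamma> \<Phi> \<longleftrightarrow> equivariant l \<Phi> \<and>
     (\<exists>c. c \<noteq> 0 \<and> (\<forall>x. \<Phi> (A_elt l x) =
        c * of_real (exp (\<Sum>j = 1..l + 1. rho l j * x j)) * whittaker l \<gamma> x))"

text \<open>
  The parameter \<open>\<nu>\<close> of the following factor is that of a character of the Borel subgroup induced
  without the \<open>\<rho>\<close>-shift. The function \<^term>\<open>whittaker l \<gamma>\<close> is symmetric in \<open>\<gamma>\<close>, hence \<open>\<gamma>\<close> is the
  parameter of normalised induction, and \<open>\<i> \<nu>\<^sub>j = \<i> \<gamma>\<^sub>j + \<rho>\<^sub>j\<close>, that is \<open>\<nu>\<^sub>j = \<gamma>\<^sub>j - \<i> \<rho>\<^sub>j\<close>.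
  Taking \<open>\<nu> = \<gamma>\<close> would give an eigenvalue which is not symmetric in \<open>\<gamma>\<close> and is incorrect as soon as
  \<open>l \<ge> 1\<close>.
\<close>

definition L_inf :: "nat \<Rightarrow> (nat \<Rightarrow> complex) \<Rightarrow> complex \<Rightarrow> complex" where
  "L_inf l \<nu> lam = (\<Prod>j = 1..l + 1.
     of_real pi powr (- ((\<i> * lam - \<i> * \<nu> j + of_real (rho l j)) / 2))
     * Gamma ((\<i> * lam - \<i> * \<nu> j + of_real (rho l j)) / 2))"

end

theory Submission
  imports Defs
begin

text \<open>
  Write \<open>g = k\<^sub>0 a\<^sub>x n\<^sub>0\<close> in Iwasawa form. As \<open>\<phi>\<close> is biinvariant under \<open>K\<close> and \<open>f\<close> is equivariant, the
  integrand of the convolution at \<open>k a\<^sub>y n\<close> does not depend on \<open>k\<close>, and depends on \<open>n\<close> only through the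
  quotient \<open>m\<close> of \<open>n\<^sub>0\<close> by \<open>n\<close>: it equals \<open>\<chi>(n\<^sub>0) \<phi>(a\<^sub>x m a\<^sub>-\<^sub>y) \<chi>(m)\<^sup>* f(a\<^sub>y)\<close>, where \<open>\<^sup>*\<close> is complex
  conjugation. In coordinates, passing from \<open>n\<close> to \<open>m\<close> is a triangular map with diagonal entries \<open>-1\<close>, so
  it preserves Lebesgue measure (\<open>distr_triangular_map\<close>). For triangular matrices \<open>\<phi>\<close> is a product of
  Gaussians, one for each entry. The entries on the subdiagonal are coupled to the character, and
  their Fourier transforms are the factors \<open>exp (- \<pi> exp (2 (y\<^sub>k - x\<^sub>k\<^sub>+\<^sub>1)))\<close> of the Baxter kernel; the
  normalising constants of all the Gaussians combine with \<open>\<delta>(a\<^sub>y)\<close> to the shift by \<open>\<rho>\<close>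
  (\<open>phase_kernel_integral\<close>). This gives the first formula, and reduces the second one to the
  statement that the Whittaker function is an eigenfunction of the Baxter operator.

  The Whittaker function is an iterated integral in which each step applies a kernel that adds one
  variable. The Baxter kernel intertwines with such a step at the cost of one Gamma factor
  (\<open>baxter_step_intertwining\<close>): for fixed outer variables both sides are products of integrals over
  the line, and reflecting each variable of the left-hand side yields the factors of the right-hand
  side, with one integral left over, which is the Gamma factor. Induction on the number of variables
  gives the eigenvalue (\<open>baxter_givental_integral\<close>).

  The exchanges of integrals, and the existence of the convolution itself, need absolute
  convergence. Taking absolute values amounts to making the exponents real. The convolution then
  still converges because it suffices to keep, for each variable, one exponential term of the potential,
  which bounds the variable from below. The integrals can then be carried out one after the
  other, each of them is a Gamma integral, and it is here that the real parts of
  \<open>\<i> \<lambda> - \<i> \<gamma>\<^sub>j\<close> have to be positive (\<open>givental_majorant_weighted_bound\<close>).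
\<close>

section \<open>One-dimensional integrals\<close>

lemma integrable_mult_nonzero_iff:
  fixes f :: "'a \<Rightarrow> 'b::{real_normed_field, second_countable_topology}"
  assumes "c \<noteq> 0"
  shows "integrable M (\<lambda>x. c * f x) \<longleftrightarrow> integrable M f"
  using integrable_mult_right[of c M f] integrable_mult_right[of "1 / c" M "\<lambda>x. c * f x"] assms
  by auto

text \<open>The substitution \<open>t = \<pi> A e\<^sup>-\<^sup>2\<^sup>y\<close> turns the integral into Euler's integral for \<open>\<Gamma>(s / 2)\<close>.\<close>
lemma gamma_exp_integral:
  fixes s :: complex and A :: real
  assumes s: "Re s > 0" and A: "A > 0"
  shows "integrable lborel (\<lambda>y::real. exp (- s * y) * of_real (exp (- pi * (A * exp (-2 * y)))))"
    and "(LINT y|lborel. exp (- s * of_real y) * of_real (exp (- pi * (A * exp (-2 * y))))) =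
      (of_real pi powr (- (s/2)) * Gamma (s/2)) / 2 * exp (- s * of_real (ln A / 2))"
proof -
  define g :: "real \<Rightarrow> real" where "g = (\<lambda>y. pi * A * exp (-2 * y))"
  define h :: "real \<Rightarrow> real" where "h = (\<lambda>y. - 2 * (pi * A * exp (-2 * y)))"
  define F where "F = (\<lambda>t::real. of_real t powr (s/2 - 1) / of_real (exp t) :: complex)"
  \<comment> \<open>the factor \<open>(\<pi> A) powr (- s / 2)\<close>, split so that \<open>pi\<close> and \<open>A\<close> appear separately\<close>
  define D where "D = of_real pi powr (- (s/2)) * exp (- s * of_real (ln A / 2))"
  define f where "f = (\<lambda>y::real. exp (- s * y) * of_real (exp (- pi * (A * exp (-2 * y)))))"
  have pA: "pi * A > 0" using A by simp
  have D0: "D \<noteq> 0" by (simp add: D_def)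
  have img: "g ` UNIV = {0<..}"
  proof -
    have "\<exists>y. t = g y" if "t > 0" for t
      using that pA A by (intro exI[of _ "- ln (t / (pi * A)) / 2"]) (simp add: g_def)
    thus ?thesis using pA by (auto simp: g_def)
  qed
  have der: "(g has_field_derivative h y) (at y within UNIV)" for y
    unfolding g_def h_def by (auto intro!: derivative_eq_intros)
  have inj: "inj_on g UNIV"
    using pA by (auto simp: inj_on_def g_def)
  have Fabs: "F absolutely_integrable_on {0<..}"
    using absolutely_integrable_Gamma_integral'[of "s/2"] s by (simp add: F_def)
  have Fint: "integral {0<..} F = Gamma (s/2)"
    using Gamma_integral_complex'[of "s/2"] s by (simp add: F_def integral_unique)
  have cov: "(\<lambda>y. \<bar>h y\<bar> *\<^sub>R F (g y)) absolutely_integrable_on UNIV \<and>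
             integral UNIV (\<lambda>y. \<bar>h y\<bar> *\<^sub>R F (g y)) = Gamma (s/2)"
    using has_absolute_integral_change_of_variables_real[of UNIV g h F "Gamma (s/2)"]
      der inj Fabs Fint by (simp add: img)
  have eq: "\<bar>h y\<bar> *\<^sub>R F (g y) = (2 / D) * f y" for y
  proof -
    have gpos: "g y > 0" using pA by (simp add: g_def)
    have habs: "\<bar>h y\<bar> = 2 * g y" using pA A by (simp add: h_def g_def abs_mult)
    have lng: "ln (g y) = ln pi + ln A - 2 * y"
      using A by (simp add: g_def ln_mult)
    have "of_real (g y) * (of_real (g y) powr (s/2 - 1) :: complex) = of_real (g y) powr (s/2)"
      using gpos by (simp add: powr_diff)
    also have "\<dots> = exp (s/2 * of_real (ln pi + ln A - 2 * y))"
      using gpos by (simp add: powr_def lng Ln_of_real)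
    also have "\<dots> = exp (- s * y) / D"
      by (simp add: D_def powr_def Ln_of_real exp_add[symmetric] exp_diff[symmetric] field_simps)
    finally have 1: "of_real (g y) * (of_real (g y) powr (s/2 - 1) :: complex) = exp (- s * y) / D" .
    have "\<bar>h y\<bar> *\<^sub>R F (g y) = 2 * (of_real (g y) * of_real (g y) powr (s/2 - 1)) / of_real (exp (g y))"
      by (simp add: habs F_def scaleR_conv_of_real)
    also have "\<dots> = (2 / D) * f y"
      unfolding 1 by (simp add: f_def g_def exp_minus field_simps exp_of_real)
    finally show ?thesis .
  qed
  have fm: "f \<in> borel_measurable borel" unfolding f_def by measurable
  have "integrable lebesgue (\<lambda>y. (2/D) * f y)"
    using cov unfolding eq by (simp add: set_integrable_def)
  hence i1: "integrable lborel (\<lambda>y. (2/D) * f y)"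
    using fm by (subst (asm) integrable_completion) simp_all
  thus int: "integrable lborel f" using D0 by (subst (asm) integrable_mult_nonzero_iff) auto
  have "(LINT y|lborel. (2/D) * f y) = Gamma (s/2)"
    using cov integral_unique[OF has_integral_integral_lborel[OF i1]] unfolding eq by simp
  hence "(2/D) * (LINT y|lborel. f y) = Gamma (s/2)" by simp
  hence "(LINT y|lborel. f y) = Gamma (s/2) * D / 2" using D0 by (simp add: field_simps)
  thus "(LINT y|lborel. f y) = (of_real pi powr (- (s/2)) * Gamma (s/2)) / 2 * exp (- s * of_real (ln A / 2))"
    by (simp add: D_def)
qed

text \<open>
  The reflection \<open>y \<mapsto> c - y\<close> exchanges the two exponentials of the potential when \<open>e\<^sup>2\<^sup>c = A / B\<close>.
  This symmetry is that of the Macdonald function in its index.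
\<close>
lemma reflect_exp_integral:
  fixes s :: complex and A B :: real
  assumes s: "Re s > 0" and A: "A > 0" and B: "B > 0"
  shows "integrable lborel (\<lambda>y::real. exp (- s * y) * of_real (exp (- pi * (A * exp (-2 * y) + B * exp (2 * y)))))"
    and "integrable lborel (\<lambda>y::real. exp (s * y) * of_real (exp (- pi * (A * exp (-2 * y) + B * exp (2 * y)))))"
    and "(LINT y|lborel. exp (- s * of_real y) * of_real (exp (- pi * (A * exp (-2 * y) + B * exp (2 * y))))) =
      exp (- s * of_real ((ln A - ln B) / 2)) *
      (LINT y|lborel. exp (s * of_real y) * of_real (exp (- pi * (A * exp (-2 * y) + B * exp (2 * y)))))"
proof -
  define f where "f = (\<lambda>y::real. exp (- s * y) * of_real (exp (- pi * (A * exp (-2 * y) + B * exp (2 * y)))))"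
  define f' where "f' = (\<lambda>y::real. exp (s * y) * of_real (exp (- pi * (A * exp (-2 * y) + B * exp (2 * y)))))"
  define c where "c = (ln A - ln B) / 2"
  \<comment> \<open>chosen such that \<open>exp (2 * c) = A / B\<close>\<close>
  have e1: "A * exp (-2 * (c + (-1) * y)) = B * exp (2 * y)"
       and e2: "B * exp (2 * (c + (-1) * y)) = A * exp (-2 * y)" for y
  proof -
    have "exp (2 * c) = A / B" using A B by (simp add: c_def exp_diff del: right_diff_distrib_numeral)
    thus "A * exp (-2 * (c + (-1) * y)) = B * exp (2 * y)"
      and "B * exp (2 * (c + (-1) * y)) = A * exp (-2 * y)"
      using A B by (simp_all add: exp_add exp_diff exp_minus field_simps)
  qed
  have refl: "f (c + (-1) * y) = exp (- s * of_real c) * f' y" for y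
    unfolding f_def f'_def e1 e2 by (simp add: algebra_simps exp_add[symmetric])
  show i: "integrable lborel f"
  proof (rule Bochner_Integration.integrable_bound[OF gamma_exp_integral(1)[OF s A]])
    show "f \<in> borel_measurable lborel" unfolding f_def by measurable
    show "AE y in lborel. norm (f y) \<le> norm (exp (- s * y) * of_real (exp (- pi * (A * exp (-2 * y)))))"
      using B by (intro AE_I2) (auto simp: f_def norm_mult norm_exp_eq_Re mult_left_mono)
  qed
  have "integrable lborel (\<lambda>y. f (c + (-1) * y))"
    by (rule lborel_integrable_real_affine[OF i]) simp
  thus i': "integrable lborel f'" unfolding refl by (subst (asm) integrable_mult_nonzero_iff) auto
  have "integral\<^sup>L lborel f = (LINT y|lborel. f (c + (-1) * y))"
    by (subst lborel_integral_real_affine[where c="-1" and t = c]) simp_all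
  thus "integral\<^sup>L lborel f = exp (- s * of_real ((ln A - ln B) / 2)) * integral\<^sup>L lborel f'"
    unfolding refl by (simp add: c_def)
qed

text \<open>The characteristic function of the normal distribution, rescaled to \<open>e\<^sup>-\<^sup>\<pi>\<^sup>u\<^sup>u\<close>, which is its own Fourier transform.\<close>
lemma gaussian_fourier_integral:
  fixes c t :: real
  assumes c: "c > 0"
  shows "integrable lborel (\<lambda>m::real. of_real (exp (- pi * (c * m)\<^sup>2)) * exp (\<i> * of_real (2 * pi * t * m)))"
    and "(LINT m|lborel. of_real (exp (- pi * (c * m)\<^sup>2)) * exp (\<i> * of_real (2 * pi * t * m))) =
          of_real (exp (- pi * (t / c)\<^sup>2) / c)"
proof -
  define F where "F = (\<lambda>u::real. std_normal_density u *\<^sub>R exp (\<i> * of_real (sqrt (2 * pi) * t / c * u)) :: complex)"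
  define f where "f = (\<lambda>m::real. of_real (exp (- pi * (c * m)\<^sup>2)) * exp (\<i> * of_real (2 * pi * t * m)) :: complex)"
  define r where "r = sqrt (2 * pi)"
  have r0: "r > 0" "r * r = 2 * pi" by (simp_all add: r_def)
  have Fint: "integrable lborel F"
    by (rule Bochner_Integration.integrable_bound[OF integrable_std_normal_moment[of 0]])
       (auto simp: F_def norm_exp_eq_Re)
  have "integral\<^sup>L lborel F = char std_normal_distribution (r * t / c)"
    unfolding char_def F_def r_def
    by (subst integral_density) (auto simp: algebra_simps)
  also have "\<dots> = of_real (exp (- pi * (t / c)\<^sup>2))"
    using c r0 by (simp add: char_std_normal_distribution power2_eq_square field_simps)
  finally have Fval: "integral\<^sup>L lborel F = of_real (exp (- pi * (t / c)\<^sup>2))" .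
  have eq: "F (0 + (r * c) * m) = of_real (1 / r) * f m" for m
  proof -
    have "std_normal_density (r * c * m) = exp (- pi * (c * m)\<^sup>2) / r"
      using r0 by (simp add: normal_density_def r_def power_mult_distrib)
    moreover have "sqrt (2 * pi) * t / c * (r * c * m) = 2 * pi * t * m"
      using c by (simp add: r_def)
    ultimately show ?thesis using r0
      unfolding F_def f_def add_0 by (simp only: scaleR_conv_of_real) simp
  qed
  have "integrable lborel (\<lambda>m. F (0 + (r * c) * m))"
    using r0 c by (intro lborel_integrable_real_affine[OF Fint]) simp
  thus "integrable lborel f" unfolding eq using r0 by (subst (asm) integrable_mult_nonzero_iff) auto
  have "integral\<^sup>L lborel F = (r * c) *\<^sub>R (LINT m|lborel. F (0 + (r * c) * m))"
    using r0 c by (subst lborel_integral_real_affine[where c="r * c" and t = 0]) simp_all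
  also have "\<dots> = of_real c * integral\<^sup>L lborel f"
    unfolding eq using r0 by (simp add: scaleR_conv_of_real)
  finally show "integral\<^sup>L lborel f = of_real (exp (- pi * (t / c)\<^sup>2) / c)"
    using Fval c by (simp add: field_simps)
qed

section \<open>The Baxter kernel and the recursion kernel\<close>

abbreviation Leb :: "nat \<Rightarrow> (nat \<Rightarrow> real) measure" where
  "Leb m \<equiv> (\<Pi>\<^sub>M i \<in> {1..m}. lborel)"

text \<open>The local Archimedean factor \<open>\<pi>\<^sup>-\<^sup>s\<^sup>/\<^sup>2 \<Gamma>(s / 2)\<close>, as a function of its exponent.\<close>
definition gamma_factor :: "complex \<Rightarrow> complex" where
  "gamma_factor s = of_real pi powr (- (s / 2)) * Gamma (s / 2)"

text \<open>
  The kernel by which the Whittaker function in \<open>m + 1\<close> variables arises from the one in \<open>m\<close> variables: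
  the part of the integrand that involves the last two rows of the triangular array.
\<close>
definition step_kernel :: "nat \<Rightarrow> complex \<Rightarrow> (nat \<Rightarrow> real) \<Rightarrow> (nat \<Rightarrow> real) \<Rightarrow> complex" where
  "step_kernel m g x z =
     exp (\<i> * g * of_real ((\<Sum>i = 1..Suc m. x i) - (\<Sum>i = 1..m. z i))
        - of_real (pi * (\<Sum>i = 1..m. exp (2 * (x i - z i)) + exp (2 * (z i - x (Suc i))))))"

text \<open>
  The kernel \<open>Q0\<close> without the shift by \<open>\<rho>\<close>. For \<open>m = 0\<close> it is the constant \<open>1\<close>, which lets the
  inductions below start from the empty array.
\<close>
definition baxter_kernel :: "nat \<Rightarrow> complex \<Rightarrow> (nat \<Rightarrow> real) \<Rightarrow> (nat \<Rightarrow> real) \<Rightarrow> complex" where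
  "baxter_kernel m lam x y = 2 ^ m *
     exp (\<i> * lam * of_real ((\<Sum>i = 1..m. x i) - (\<Sum>i = 1..m. y i))
        - of_real (pi * ((\<Sum>i = 1..m. exp (2 * (x i - y i))) + (\<Sum>i \<in> {1..<m}. exp (2 * (y i - x (Suc i)))))))"

interpretation lebesgue_product: product_sigma_finite "\<lambda>_::'i. lborel :: real measure"
  by standard

lemma sum_shift_Suc: "(\<Sum>k = 1..Suc m. if k = 1 then 0 else f (k - 1) k) = (\<Sum>k = 1..m. f k (Suc k))"
  for f :: "nat \<Rightarrow> nat \<Rightarrow> 'a::comm_monoid_add"
proof -
  have "(\<Sum>k = 1..Suc m. if k = 1 then 0 else f (k - 1) k) = (\<Sum>k = Suc 1..Suc m. if k = 1 then 0 else f (k - 1) k)"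
    by (subst sum.atLeast_Suc_atMost) auto
  also have "\<dots> = (\<Sum>k = 1..m. f k (Suc k))"
    by (subst sum.shift_bounds_cl_Suc_ivl) (auto intro: sum.cong)
  finally show ?thesis .
qed

text \<open>
  For fixed \<open>x\<close> and \<open>z\<close> both integrands are products over the coordinates of the functions \<open>F k\<close> and
  \<open>F' k\<close> below, which have the same coefficients \<open>A k\<close>, \<open>B k\<close> but opposite exponents. The factors
  produced by reflecting each coordinate telescope, because \<open>B k\<close> is \<open>A (k + 1)\<close> up to an exponential.
  The last coordinate on the left has \<open>B = 0\<close> and no partner on the right; it gives the Gamma factor.
\<close>
lemma baxter_step_intertwining:
  fixes lam g :: complex and x z :: "nat \<Rightarrow> real"
  defines "s \<equiv> \<i> * lam - \<i> * g"
  assumes s: "Re s > 0"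
  shows "integrable (Leb (Suc m)) (\<lambda>y. baxter_kernel (Suc m) lam x y * step_kernel m g y z)"
    and "integrable (Leb m) (\<lambda>w. step_kernel m g x w * baxter_kernel m lam w z)"
    and "(LINT y|Leb (Suc m). baxter_kernel (Suc m) lam x y * step_kernel m g y z) =
         gamma_factor s * (LINT w|Leb m. step_kernel m g x w * baxter_kernel m lam w z)"
proof -
  define A where "A k = exp (2 * x k) + (if k = 1 then 0 else exp (2 * z (k - 1)))" for k
  define B where "B k = (if k \<le> m then exp (- 2 * x (Suc k)) + exp (- 2 * z k) else 0)" for k
  define F where "F k t = exp (- s * of_real t) * of_real (exp (- pi * (A k * exp (-2 * t) + B k * exp (2 * t))))"
    for k and t :: real
  define F' where "F' k t = exp (s * of_real t) * of_real (exp (- pi * (A k * exp (-2 * t) + B k * exp (2 * t))))"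
    for k and t :: real
  define C where "C = 2 ^ Suc m * exp (\<i> * lam * of_real (\<Sum>k = 1..Suc m. x k) - \<i> * g * of_real (\<Sum>k = 1..m. z k))"
  define C' where "C' = 2 ^ m * exp (\<i> * g * of_real (\<Sum>k = 1..Suc m. x k) - \<i> * lam * of_real (\<Sum>k = 1..m. z k))"
  have A0: "A k > 0" for k by (auto simp: A_def add_pos_pos)
  have B0: "B k > 0" if "k \<le> m" for k using that by (auto simp: B_def add_pos_pos)
  have BA: "B k = A (Suc k) * exp (- 2 * (x (Suc k) + z k))" if "1 \<le> k" "k \<le> m" for k
    using that by (simp add: B_def A_def exp_add[symmetric] algebra_simps)
  have lnB: "ln (B k) = ln (A (Suc k)) - 2 * (x (Suc k) + z k)" if "1 \<le> k" "k \<le> m" for k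
    unfolding BA[OF that] using A0[of "Suc k"] by (simp add: ln_mult)
  have pot: "(\<Sum>k = 1..Suc m. A k * exp (-2 * y k) + B k * exp (2 * y k)) =
      (\<Sum>k = 1..Suc m. exp (2 * (x k - y k))) + (\<Sum>k = 1..m. exp (2 * (y k - x (Suc k)))) +
      (\<Sum>k = 1..m. exp (2 * (y k - z k)) + exp (2 * (z k - y (Suc k))))" for y
  proof -
    have "(\<Sum>k = 1..Suc m. A k * exp (-2 * y k)) =
        (\<Sum>k = 1..Suc m. exp (2 * (x k - y k))) + (\<Sum>k = 1..Suc m. if k = 1 then 0 else exp (2 * (z (k - 1) - y k)))"
      unfolding sum.distrib[symmetric]
      by (intro sum.cong) (auto simp: A_def exp_add[symmetric] algebra_simps)
    also have "(\<Sum>k = 1..Suc m. if k = 1 then 0 else exp (2 * (z (k - 1) - y k))) = (\<Sum>k = 1..m. exp (2 * (z k - y (Suc k))))"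
      by (rule sum_shift_Suc)
    finally have 1: "(\<Sum>k = 1..Suc m. A k * exp (-2 * y k)) = (\<Sum>k = 1..Suc m. exp (2 * (x k - y k))) + (\<Sum>k = 1..m. exp (2 * (z k - y (Suc k))))" .
    have "(\<Sum>k = 1..Suc m. B k * exp (2 * y k)) = (\<Sum>k = 1..m. B k * exp (2 * y k))"
      by (simp add: B_def)
    also have "\<dots> = (\<Sum>k = 1..m. exp (2 * (y k - x (Suc k)))) + (\<Sum>k = 1..m. exp (2 * (y k - z k)))"
      unfolding sum.distrib[symmetric]
      by (intro sum.cong) (auto simp: B_def exp_add[symmetric] algebra_simps)
    finally show ?thesis unfolding sum.distrib 1 by simp
  qed
  have pot': "(\<Sum>k = 1..m. A k * exp (-2 * w k) + B k * exp (2 * w k)) =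
      (\<Sum>k = 1..m. exp (2 * (x k - w k)) + exp (2 * (w k - x (Suc k)))) +
      (\<Sum>k = 1..m. exp (2 * (w k - z k))) + (\<Sum>k \<in> {1..<m}. exp (2 * (z k - w (Suc k))))" for w
  proof -
    have "(\<Sum>k = 1..m. A k * exp (-2 * w k)) =
        (\<Sum>k = 1..m. exp (2 * (x k - w k))) + (\<Sum>k = 1..m. if k = 1 then 0 else exp (2 * (z (k - 1) - w k)))"
      unfolding sum.distrib[symmetric]
      by (intro sum.cong) (auto simp: A_def exp_add[symmetric] algebra_simps)
    also have "(\<Sum>k = 1..m. if k = 1 then 0 else exp (2 * (z (k - 1) - w k))) = (\<Sum>k \<in> {1..<m}. exp (2 * (z k - w (Suc k))))"
    proof (cases m)
      case (Suc n)
      show ?thesis unfolding Suc by (subst sum_shift_Suc) (simp add: atLeastLessThanSuc_atLeastAtMost)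
    qed simp
    finally have 1: "(\<Sum>k = 1..m. A k * exp (-2 * w k)) = (\<Sum>k = 1..m. exp (2 * (x k - w k))) + (\<Sum>k \<in> {1..<m}. exp (2 * (z k - w (Suc k))))" .
    have "(\<Sum>k = 1..m. B k * exp (2 * w k)) = (\<Sum>k = 1..m. exp (2 * (w k - x (Suc k)))) + (\<Sum>k = 1..m. exp (2 * (w k - z k)))"
      unfolding sum.distrib[symmetric]
      by (intro sum.cong) (auto simp: B_def exp_add[symmetric] algebra_simps)
    then show ?thesis unfolding sum.distrib 1 by simp
  qed
  have prodexp: "(\<Prod>k\<in>I. exp (c * of_real (u k)) * of_real (exp (- pi * V k))) =
      exp (c * of_real (\<Sum>k\<in>I. u k) - of_real (pi * (\<Sum>k\<in>I. V k)))"
    if "finite I" for c :: complex and u V :: "nat \<Rightarrow> real" and I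
    using that by (simp add: prod.distrib exp_sum[symmetric] exp_of_real[symmetric] exp_add[symmetric]
      sum_distrib_left sum_negf sum.distrib diff_conv_add_uminus del: add_uminus_conv_diff)
  have lhs: "baxter_kernel (Suc m) lam x y * step_kernel m g y z = C * (\<Prod>k\<in>{1..Suc m}. F k (y k))" for y
    unfolding F_def prodexp[OF finite_atLeastAtMost] pot
    by (simp only: baxter_kernel_def step_kernel_def C_def s_def atLeastLessThanSuc_atLeastAtMost
          mult.assoc exp_add[symmetric] exp_diff[symmetric] mult_exp_exp)
       (simp add: algebra_simps)
  have rhs: "step_kernel m g x w * baxter_kernel m lam w z = C' * (\<Prod>k\<in>{1..m}. F' k (w k))" for w
    unfolding F'_def prodexp[OF finite_atLeastAtMost] pot'
    by (simp add: baxter_kernel_def step_kernel_def C'_def s_def mult_exp_exp algebra_simps)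
  have F_last: "F (Suc m) = (\<lambda>t. exp (- s * of_real t) * of_real (exp (- pi * (A (Suc m) * exp (-2 * t)))))"
    by (simp add: F_def B_def fun_eq_iff)
  have intF: "integrable lborel (F k)" if "k \<in> {1..Suc m}" for k
  proof (cases "k \<le> m")
    case True
    thus ?thesis unfolding F_def by (intro reflect_exp_integral(1) s A0 B0)
  next
    case False
    hence "k = Suc m" using that by auto
    thus ?thesis using gamma_exp_integral(1)[OF s A0[of "Suc m"]] by (simp only: F_last)
  qed
  have intF': "integrable lborel (F' k)" if "k \<in> {1..m}" for k
    using that unfolding F'_def by (intro reflect_exp_integral(2) s A0 B0) auto
  show "integrable (Leb (Suc m)) (\<lambda>y. baxter_kernel (Suc m) lam x y * step_kernel m g y z)"
    unfolding lhs by (intro integrable_mult_right lebesgue_product.product_integrable_prod intF) auto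
  show "integrable (Leb m) (\<lambda>w. step_kernel m g x w * baxter_kernel m lam w z)"
    unfolding rhs by (intro integrable_mult_right lebesgue_product.product_integrable_prod intF') auto
  have Fk: "integral\<^sup>L lborel (F k) = exp (- s * of_real ((ln (A k) - ln (B k)) / 2)) * integral\<^sup>L lborel (F' k)"
    if "k \<in> {1..m}" for k
    using that unfolding F_def F'_def by (intro reflect_exp_integral(3) s A0 B0) auto
  have Flast: "integral\<^sup>L lborel (F (Suc m)) = gamma_factor s / 2 * exp (- s * of_real (ln (A (Suc m)) / 2))"
    unfolding F_last gamma_factor_def by (rule gamma_exp_integral(2)[OF s A0])
  \<comment> \<open>The logarithms of the \<open>A k\<close> telescope down to \<open>ln (A 1) / 2 = x 1\<close>.\<close>
  have tel: "(\<Sum>k = 1..m. (ln (A k) - ln (B k)) / 2) + ln (A (Suc m)) / 2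
      = (\<Sum>k = 1..Suc m. x k) + (\<Sum>k = 1..m. z k)"
  proof -
    have "(\<Sum>k = 1..m. (ln (A k) - ln (B k)) / 2) =
       (\<Sum>k = 1..m. (ln (A k) - ln (A (Suc k))) / 2 + (x (Suc k) + z k))"
      by (intro sum.cong) (auto simp: lnB field_simps)
    also have "\<dots> = (ln (A 1) - ln (A (Suc m))) / 2 + (\<Sum>k = 1..m. x (Suc k)) + (\<Sum>k = 1..m. z k)"
    proof -
      have "(\<Sum>k = 1..m. (ln (A k) - ln (A (Suc k))) / 2) = (ln (A 1) - ln (A (Suc m))) / 2"
        by (induction m) (auto simp: field_simps)
      thus ?thesis by (simp add: sum.distrib)
    qed
    also have "ln (A 1) = 2 * x 1" by (simp add: A_def)
    also have "(\<Sum>k = 1..m. x (Suc k)) = (\<Sum>k = 1..Suc m. x k) - x 1"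
      by (induction m) auto
    finally show ?thesis by (simp add: field_simps)
  qed
  have "(LINT y|Leb (Suc m). baxter_kernel (Suc m) lam x y * step_kernel m g y z) =
      C * (\<Prod>k\<in>{1..Suc m}. integral\<^sup>L lborel (F k))"
    unfolding lhs using intF by (subst integral_mult_right_zero, subst lebesgue_product.product_integral_prod) auto
  also have "\<dots> = C * ((\<Prod>k\<in>{1..m}. exp (- s * of_real ((ln (A k) - ln (B k)) / 2)) * integral\<^sup>L lborel (F' k)) *
      (gamma_factor s / 2 * exp (- s * of_real (ln (A (Suc m)) / 2))))"
    unfolding prod.cl_ivl_Suc Flast by (simp only: prod.cong[OF refl Fk]) simp
  also have "\<dots> = C * gamma_factor s / 2 * exp (- s * of_real ((\<Sum>k = 1..m. (ln (A k) - ln (B k)) / 2) + ln (A (Suc m)) / 2)) *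
       (\<Prod>k\<in>{1..m}. integral\<^sup>L lborel (F' k))"
    by (simp add: prod.distrib exp_sum[symmetric] mult_exp_exp sum_distrib_left distrib_left sum_negf)
  also have "\<dots> = gamma_factor s * (C' * (\<Prod>k\<in>{1..m}. integral\<^sup>L lborel (F' k)))"
    unfolding tel by (simp add: C_def C'_def s_def mult_exp_exp algebra_simps)
  also have "C' * (\<Prod>k\<in>{1..m}. integral\<^sup>L lborel (F' k)) = (LINT w|Leb m. step_kernel m g x w * baxter_kernel m lam w z)"
    unfolding rhs using intF' by (subst integral_mult_right_zero, subst lebesgue_product.product_integral_prod) auto
  finally show "(LINT y|Leb (Suc m). baxter_kernel (Suc m) lam x y * step_kernel m g y z) =
         gamma_factor s * (LINT w|Leb m. step_kernel m g x w * baxter_kernel m lam w z)" .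
qed

section \<open>Iterated integrals and their majorants\<close>

lemma sigma_finite_PiM_lborel: "finite I \<Longrightarrow> sigma_finite_measure (\<Pi>\<^sub>M i \<in> I. (lborel :: real measure))"
  by (rule lebesgue_product.sigma_finite)

lemma step_kernel_measurable:
  assumes "\<And>i. i \<in> {1..Suc m} \<Longrightarrow> (\<lambda>p. X p i) \<in> borel_measurable M"
    and "\<And>i. i \<in> {1..m} \<Longrightarrow> (\<lambda>p. Z p i) \<in> borel_measurable M"
  shows "(\<lambda>p. step_kernel m g (X p) (Z p)) \<in> borel_measurable M"
proof -
  have 1: "(\<lambda>p. (\<Sum>i = 1..Suc m. X p i) - (\<Sum>i = 1..m. Z p i)) \<in> borel_measurable M"
    by (intro borel_measurable_diff borel_measurable_sum assms)
  have 2: "(\<lambda>p. pi * (\<Sum>i = 1..m. exp (2 * (X p i - Z p i)) + exp (2 * (Z p i - X p (Suc i))))) \<in> borel_measurable M"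
  proof (intro borel_measurable_times borel_measurable_sum borel_measurable_const)
    fix i assume "i \<in> {1..m}"
    then have [measurable]: "(\<lambda>p. X p i) \<in> borel_measurable M" "(\<lambda>p. X p (Suc i)) \<in> borel_measurable M"
      "(\<lambda>p. Z p i) \<in> borel_measurable M" by (auto intro!: assms)
    show "(\<lambda>p. exp (2 * (X p i - Z p i)) + exp (2 * (Z p i - X p (Suc i)))) \<in> borel_measurable M"
      by measurable
  qed
  note [measurable] = 1 2
  show ?thesis unfolding step_kernel_def by measurable
qed

lemma baxter_kernel_measurable:
  assumes "\<And>i. i \<in> {1..m} \<Longrightarrow> (\<lambda>p. X p i) \<in> borel_measurable M"
    and "\<And>i. i \<in> {1..m} \<Longrightarrow> (\<lambda>p. Y p i) \<in> borel_measurable M"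
  shows "(\<lambda>p. baxter_kernel m lam (X p) (Y p)) \<in> borel_measurable M"
proof -
  have 1: "(\<lambda>p. (\<Sum>i = 1..m. X p i) - (\<Sum>i = 1..m. Y p i)) \<in> borel_measurable M"
    by (intro borel_measurable_diff borel_measurable_sum assms)
  have 2: "(\<lambda>p. pi * ((\<Sum>i = 1..m. exp (2 * (X p i - Y p i))) + (\<Sum>i \<in> {1..<m}. exp (2 * (Y p i - X p (Suc i)))))) \<in> borel_measurable M"
  proof (intro borel_measurable_times borel_measurable_add borel_measurable_sum borel_measurable_const)
    fix i assume "i \<in> {1..m}"
    then have [measurable]: "(\<lambda>p. X p i) \<in> borel_measurable M" "(\<lambda>p. Y p i) \<in> borel_measurable M"
      by (auto intro!: assms)
    show "(\<lambda>p. exp (2 * (X p i - Y p i))) \<in> borel_measurable M" by measurable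
  next
    fix i assume "i \<in> {1..<m}"
    then have [measurable]: "(\<lambda>p. X p (Suc i)) \<in> borel_measurable M" "(\<lambda>p. Y p i) \<in> borel_measurable M"
      by (auto intro!: assms)
    show "(\<lambda>p. exp (2 * (Y p i - X p (Suc i)))) \<in> borel_measurable M" by measurable
  qed
  note [measurable] = 1 2
  show ?thesis unfolding baxter_kernel_def by measurable
qed

lemma integral_swap:
  fixes f :: "'a \<Rightarrow> 'b \<Rightarrow> complex"
  assumes "sigma_finite_measure M" "sigma_finite_measure N"
    and f: "case_prod f \<in> borel_measurable (M \<Otimes>\<^sub>M N)"
    and fin: "(\<integral>\<^sup>+x. \<integral>\<^sup>+y. ennreal (norm (f x y)) \<partial>N \<partial>M) < \<infinity>"
  shows "(LINT x|M. LINT y|N. f x y) = (LINT y|N. LINT x|M. f x y)"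
proof -
  interpret M: sigma_finite_measure M by fact
  interpret N: sigma_finite_measure N by fact
  interpret pair_sigma_finite M N ..
  have "integrable (M \<Otimes>\<^sub>M N) (case_prod f)"
  proof (rule integrableI_bounded[OF f])
    have "(\<integral>\<^sup>+p. ennreal (norm (case_prod f p)) \<partial>(M \<Otimes>\<^sub>M N)) = (\<integral>\<^sup>+x. \<integral>\<^sup>+y. ennreal (norm (f x y)) \<partial>N \<partial>M)"
      using f by (subst N.nn_integral_fst[symmetric]) simp_all
    thus "(\<integral>\<^sup>+p. ennreal (norm (case_prod f p)) \<partial>(M \<Otimes>\<^sub>M N)) < \<infinity>" using fin by simp
  qed
  from Fubini_integral[OF this] show ?thesis by simp
qed

lemma nn_integral_swap:
  assumes "sigma_finite_measure M" "sigma_finite_measure N"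
    and f: "case_prod f \<in> borel_measurable (M \<Otimes>\<^sub>M N)"
  shows "(\<integral>\<^sup>+x. \<integral>\<^sup>+y. f x y \<partial>N \<partial>M) = (\<integral>\<^sup>+y. \<integral>\<^sup>+x. f x y \<partial>M \<partial>N)"
proof -
  interpret M: sigma_finite_measure M by fact
  interpret N: sigma_finite_measure N by fact
  interpret pair_sigma_finite M N ..
  show ?thesis using Fubini'[OF f] by simp
qed

lemma gamma_factor_nonzero: "Re s > 0 \<Longrightarrow> gamma_factor s \<noteq> 0"
  by (auto simp: gamma_factor_def Gamma_eq_zero_iff elim!: nonpos_Ints_cases)

text \<open>
  Kernels with the parameter \<open>real_exponent a\<close> are the absolute values of those with the parameter \<open>a\<close>.
  Identities between absolute values are therefore instances of the complex ones.
\<close>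
definition real_exponent :: "complex \<Rightarrow> complex" where
  "real_exponent a = - \<i> * of_real (Re (\<i> * a))"

lemma norm_step_kernel: "of_real (norm (step_kernel m g x z)) = step_kernel m (real_exponent g) x z"
  by (simp add: step_kernel_def real_exponent_def norm_exp_eq_Re exp_of_real[symmetric] algebra_simps)

lemma norm_baxter_kernel: "of_real (norm (baxter_kernel m lam x y)) = baxter_kernel m (real_exponent lam) x y"
  by (simp add: baxter_kernel_def real_exponent_def norm_exp_eq_Re norm_mult norm_power exp_of_real[symmetric] algebra_simps)

lemma norm_baxter_step_intertwining:
  assumes s: "Re (\<i> * lam - \<i> * g) > 0"
  shows "(\<integral>\<^sup>+y. ennreal (norm (baxter_kernel (Suc m) lam x y)) * ennreal (norm (step_kernel m g y z)) \<partial>Leb (Suc m)) =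
     ennreal (norm (gamma_factor (of_real (Re (\<i> * lam - \<i> * g))))) *
     (\<integral>\<^sup>+w. ennreal (norm (step_kernel m g x w)) * ennreal (norm (baxter_kernel m lam w z)) \<partial>Leb m)"
proof -
  define L where "L y = norm (baxter_kernel (Suc m) lam x y) * norm (step_kernel m g y z)" for y
  define R where "R w = norm (step_kernel m g x w) * norm (baxter_kernel m lam w z)" for w
  have param: "\<i> * real_exponent lam - \<i> * real_exponent g = of_real (Re (\<i> * lam - \<i> * g))"
    by (simp add: real_exponent_def)
  have s': "Re (\<i> * real_exponent lam - \<i> * real_exponent g) > 0" unfolding param using s by simp
  have L: "of_real (L y) = baxter_kernel (Suc m) (real_exponent lam) x y * step_kernel m (real_exponent g) y z" for y
    by (simp only: L_def of_real_mult norm_step_kernel norm_baxter_kernel)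
  have R: "of_real (R w) = step_kernel m (real_exponent g) x w * baxter_kernel m (real_exponent lam) w z" for w
    by (simp only: R_def of_real_mult norm_step_kernel norm_baxter_kernel)
  note ints = baxter_step_intertwining[OF s', of m x z, folded L R, unfolded param]
  have iL: "integrable (Leb (Suc m)) L" and iR: "integrable (Leb m) R"
    using ints(1,2) by (simp_all add: complex_of_real_integrable_eq)
  have "complex_of_real (integral\<^sup>L (Leb (Suc m)) L) = gamma_factor (of_real (Re (\<i> * lam - \<i> * g))) * of_real (integral\<^sup>L (Leb m) R)"
    using ints(3) by simp
  hence "norm (complex_of_real (integral\<^sup>L (Leb (Suc m)) L)) = norm (gamma_factor (of_real (Re (\<i> * lam - \<i> * g))) * of_real (integral\<^sup>L (Leb m) R))"
    by simp
  moreover have "integral\<^sup>L (Leb (Suc m)) L \<ge> 0" "integral\<^sup>L (Leb m) R \<ge> 0"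
    by (auto intro!: integral_nonneg_AE AE_I2 simp: L_def R_def)
  ultimately have eq: "integral\<^sup>L (Leb (Suc m)) L = norm (gamma_factor (of_real (Re (\<i> * lam - \<i> * g)))) * integral\<^sup>L (Leb m) R"
    by (simp add: norm_mult)
  have "(\<integral>\<^sup>+y. ennreal (L y) \<partial>Leb (Suc m)) = ennreal (integral\<^sup>L (Leb (Suc m)) L)"
    by (intro nn_integral_eq_integral iL AE_I2) (simp add: L_def)
  moreover have "(\<integral>\<^sup>+w. ennreal (R w) \<partial>Leb m) = ennreal (integral\<^sup>L (Leb m) R)"
    by (intro nn_integral_eq_integral iR AE_I2) (simp add: R_def)
  ultimately show ?thesis using eq
    by (simp add: L_def R_def ennreal_mult)
qed

text \<open>The Whittaker function in \<open>m\<close> variables, integrated row by row; the first \<open>m\<close> entries of \<open>\<gamma>\<close> are used.\<close>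
fun givental_integral :: "nat \<Rightarrow> (nat \<Rightarrow> complex) \<Rightarrow> (nat \<Rightarrow> real) \<Rightarrow> complex" where
  "givental_integral 0 \<gamma> x = 1"
| "givental_integral (Suc m) \<gamma> x = (LINT z|Leb m. step_kernel m (\<gamma> (Suc m)) x z * givental_integral m \<gamma> z)"

text \<open>
  The same iteration over absolute values. Values in \<open>ennreal\<close> allow Tonelli's theorem to be used before
  anything is known to be finite.
\<close>
fun givental_majorant :: "nat \<Rightarrow> (nat \<Rightarrow> complex) \<Rightarrow> (nat \<Rightarrow> real) \<Rightarrow> ennreal" where
  "givental_majorant 0 \<gamma> x = 1"
| "givental_majorant (Suc m) \<gamma> x = (\<integral>\<^sup>+z. ennreal (norm (step_kernel m (\<gamma> (Suc m)) x z)) * givental_majorant m \<gamma> z \<partial>Leb m)"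

lemma measurable_Leb_component: "i \<in> {1..m} \<Longrightarrow> (\<lambda>y. y i) \<in> borel_measurable (Leb m)"
  using measurable_component_singleton[of i "{1..m}" "\<lambda>_. lborel :: real measure"] by simp

lemma step_kernel_measurable_pair:
  "(\<lambda>p. step_kernel m g (fst p) (snd p)) \<in> borel_measurable (Leb (Suc m) \<Otimes>\<^sub>M Leb m)"
  by (intro step_kernel_measurable measurable_compose[OF measurable_fst measurable_Leb_component]
        measurable_compose[OF measurable_snd measurable_Leb_component])

lemma givental_majorant_measurable: "givental_majorant m \<gamma> \<in> borel_measurable (Leb m)"
proof (induction m)
  case (Suc m)
  interpret sigma_finite_measure "Leb m" by (rule sigma_finite_PiM_lborel) simp
  note [measurable] = Suc.IH step_kernel_measurable_pair
  show ?case unfolding givental_majorant.simps by measurable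
qed simp

lemma givental_integral_measurable: "givental_integral m \<gamma> \<in> borel_measurable (Leb m)"
proof (induction m)
  case (Suc m)
  interpret sigma_finite_measure "Leb m" by (rule sigma_finite_PiM_lborel) simp
  note [measurable] = Suc.IH step_kernel_measurable_pair
  show ?case unfolding givental_integral.simps by measurable
qed simp

lemma norm_givental_integral_le: "ennreal (norm (givental_integral m \<gamma> x)) \<le> givental_majorant m \<gamma> x"
proof (induction m arbitrary: x)
  case (Suc m)
  define f where "f z = step_kernel m (\<gamma> (Suc m)) x z * givental_integral m \<gamma> z" for z
  have "ennreal (norm (integral\<^sup>L (Leb m) f)) \<le> (\<integral>\<^sup>+z. ennreal (norm (f z)) \<partial>Leb m)"
    by (cases "integrable (Leb m) f") (auto intro: integral_norm_bound_ennreal simp: not_integrable_integral_eq)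
  also have "\<dots> \<le> givental_majorant (Suc m) \<gamma> x"
    unfolding givental_majorant.simps
    by (intro nn_integral_mono) (auto simp: f_def norm_mult ennreal_mult intro!: mult_left_mono Suc.IH)
  finally show ?case by (simp add: f_def [abs_def])
qed simp

text \<open>
  The eigenvalue equation for absolute values: both exchanges of integrals are instances of Tonelli's
  theorem. Since the equation is known before finiteness, it allows one to deduce finiteness of the majorant
  from that of the left-hand side.
\<close>
lemma baxter_givental_majorant:
  assumes "\<forall>j \<in> {1..m}. Re (\<i> * lam - \<i> * \<gamma> j) > 0"
  shows "(\<integral>\<^sup>+y. ennreal (norm (baxter_kernel m lam x y)) * givental_majorant m \<gamma> y \<partial>Leb m) =
    (\<Prod>j = 1..m. ennreal (norm (gamma_factor (of_real (Re (\<i> * lam - \<i> * \<gamma> j)))))) * givental_majorant m \<gamma> x"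
  using assms
proof (induction m arbitrary: x)
  case 0
  show ?case by (simp add: baxter_kernel_def space_PiM)
next
  case (Suc m)
  let ?g = "\<gamma> (Suc m)" and ?G = "\<lambda>j. ennreal (norm (gamma_factor (of_real (Re (\<i> * lam - \<i> * \<gamma> j)))))"
  have sg: "Re (\<i> * lam - \<i> * ?g) > 0" using Suc.prems by auto
  have IH: "(\<integral>\<^sup>+z. ennreal (norm (baxter_kernel m lam w z)) * givental_majorant m \<gamma> z \<partial>Leb m) =
      (\<Prod>j = 1..m. ?G j) * givental_majorant m \<gamma> w" for w
    using Suc.prems by (intro Suc.IH) auto
  have sf: "sigma_finite_measure (Leb k)" for k by (rule sigma_finite_PiM_lborel) simp
  have [measurable]: "(\<lambda>y. baxter_kernel k lam x y) \<in> borel_measurable (Leb k)" for k x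
    by (intro baxter_kernel_measurable measurable_Leb_component) auto
  have [measurable]: "(\<lambda>y. step_kernel m g y z) \<in> borel_measurable (Leb (Suc m))" for g z
    by (intro step_kernel_measurable measurable_Leb_component) auto
  have [measurable]: "(\<lambda>z. step_kernel m g x z) \<in> borel_measurable (Leb m)" for g x
    by (intro step_kernel_measurable measurable_Leb_component) auto
  have [measurable]: "(\<lambda>p. baxter_kernel m lam (fst p) (snd p)) \<in> borel_measurable (Leb m \<Otimes>\<^sub>M Leb m)"
    by (intro baxter_kernel_measurable measurable_compose[OF measurable_fst measurable_Leb_component]
        measurable_compose[OF measurable_snd measurable_Leb_component])
  note [measurable] = givental_majorant_measurable step_kernel_measurable_pair
  have "(\<integral>\<^sup>+y. ennreal (norm (baxter_kernel (Suc m) lam x y)) * givental_majorant (Suc m) \<gamma> y \<partial>Leb (Suc m)) =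
     (\<integral>\<^sup>+y. \<integral>\<^sup>+z. ennreal (norm (baxter_kernel (Suc m) lam x y)) * (ennreal (norm (step_kernel m ?g y z)) * givental_majorant m \<gamma> z) \<partial>Leb m \<partial>Leb (Suc m))"
    unfolding givental_majorant.simps by (intro nn_integral_cong nn_integral_cmult[symmetric]) measurable
  also have "\<dots> = (\<integral>\<^sup>+z. \<integral>\<^sup>+y. ennreal (norm (baxter_kernel (Suc m) lam x y)) * (ennreal (norm (step_kernel m ?g y z)) * givental_majorant m \<gamma> z) \<partial>Leb (Suc m) \<partial>Leb m)"
    by (intro nn_integral_swap sf) measurable
  also have "\<dots> = (\<integral>\<^sup>+z. (\<integral>\<^sup>+y. ennreal (norm (baxter_kernel (Suc m) lam x y)) * ennreal (norm (step_kernel m ?g y z)) \<partial>Leb (Suc m)) * givental_majorant m \<gamma> z \<partial>Leb m)"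
    by (subst nn_integral_multc[symmetric]) (auto simp: mult.assoc simp del: One_nat_def)
  also have "\<dots> = (\<integral>\<^sup>+z. ?G (Suc m) * ((\<integral>\<^sup>+w. ennreal (norm (step_kernel m ?g x w)) * ennreal (norm (baxter_kernel m lam w z)) \<partial>Leb m) * givental_majorant m \<gamma> z) \<partial>Leb m)"
    unfolding norm_baxter_step_intertwining[OF sg] by (simp add: mult.assoc)
  also have "\<dots> = ?G (Suc m) * (\<integral>\<^sup>+z. (\<integral>\<^sup>+w. ennreal (norm (step_kernel m ?g x w)) * ennreal (norm (baxter_kernel m lam w z)) \<partial>Leb m) * givental_majorant m \<gamma> z \<partial>Leb m)"
  proof (rule nn_integral_cmult)
    interpret sigma_finite_measure "Leb m" by (rule sf)
    have [measurable]: "(\<lambda>p. baxter_kernel m lam (snd p) (fst p)) \<in> borel_measurable (Leb m \<Otimes>\<^sub>M Leb m)"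
      by (intro baxter_kernel_measurable measurable_compose[OF measurable_fst measurable_Leb_component]
          measurable_compose[OF measurable_snd measurable_Leb_component])
    show "(\<lambda>z. (\<integral>\<^sup>+w. ennreal (norm (step_kernel m ?g x w)) * ennreal (norm (baxter_kernel m lam w z)) \<partial>Leb m) * givental_majorant m \<gamma> z) \<in> borel_measurable (Leb m)"
      by measurable
  qed
  also have "(\<integral>\<^sup>+z. (\<integral>\<^sup>+w. ennreal (norm (step_kernel m ?g x w)) * ennreal (norm (baxter_kernel m lam w z)) \<partial>Leb m) * givental_majorant m \<gamma> z \<partial>Leb m) =
     (\<integral>\<^sup>+z. \<integral>\<^sup>+w. ennreal (norm (step_kernel m ?g x w)) * (ennreal (norm (baxter_kernel m lam w z)) * givental_majorant m \<gamma> z) \<partial>Leb m \<partial>Leb m)"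
  proof -
    have [measurable]: "(\<lambda>w. baxter_kernel m lam w z) \<in> borel_measurable (Leb m)" for z
      by (intro baxter_kernel_measurable measurable_Leb_component) auto
    show ?thesis by (subst nn_integral_multc[symmetric]) (auto simp: mult.assoc simp del: One_nat_def)
  qed
  also have "\<dots> = (\<integral>\<^sup>+w. \<integral>\<^sup>+z. ennreal (norm (step_kernel m ?g x w)) * (ennreal (norm (baxter_kernel m lam w z)) * givental_majorant m \<gamma> z) \<partial>Leb m \<partial>Leb m)"
    by (intro nn_integral_swap[symmetric] sf) measurable
  also have "\<dots> = (\<integral>\<^sup>+w. ennreal (norm (step_kernel m ?g x w)) * ((\<Prod>j = 1..m. ?G j) * givental_majorant m \<gamma> w) \<partial>Leb m)"
    unfolding IH[symmetric] by (intro nn_integral_cong nn_integral_cmult) measurable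
  also have "\<dots> = (\<Prod>j = 1..m. ?G j) * (\<integral>\<^sup>+w. ennreal (norm (step_kernel m ?g x w)) * givental_majorant m \<gamma> w \<partial>Leb m)"
    by (subst nn_integral_cmult[symmetric]) (auto simp: mult_ac simp del: One_nat_def)
  finally show ?case by (simp add: mult_ac)
qed

section \<open>Absolute convergence\<close>

text \<open>
  The integral of an exponential cut off from below by a double exponential, that is, half of the Gamma factor
  at \<open>a\<close>.
\<close>
definition barrier_const :: "real \<Rightarrow> ennreal" where
  "barrier_const a = (\<integral>\<^sup>+t. ennreal (exp (- a * t) * exp (- pi * exp (-2 * t))) \<partial>lborel)"

lemma barrier_const_finite: 
  assumes "a > 0"
  shows "barrier_const a < \<infinity>"
proof -
  have "integrable lborel (\<lambda>y::real. exp (- of_real a * of_real y) * complex_of_real (exp (- pi * (1 * exp (-2 * y)))))"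
    by (rule gamma_exp_integral(1)) (use assms in auto)
  hence "(\<integral>\<^sup>+y. ennreal (norm (exp (- of_real a * of_real y) * complex_of_real (exp (- pi * (1 * exp (-2 * y)))))) \<partial>lborel) < \<infinity>"
    unfolding integrable_iff_bounded by blast
  thus ?thesis by (simp add: barrier_const_def norm_mult norm_exp_eq_Re)
qed

text \<open>Moving the barrier by \<open>b\<close> multiplies the integral by the value of the exponential at \<open>b\<close>.\<close>
lemma nn_integral_barrier:
  "(\<integral>\<^sup>+t. ennreal (exp (- a * t) * exp (- pi * exp (2 * (b - t)))) \<partial>lborel) = barrier_const a * ennreal (exp (- a * b))"
proof -
  have "(\<integral>\<^sup>+t. ennreal (exp (- a * t) * exp (- pi * exp (2 * (b - t)))) \<partial>lborel) =
     (\<integral>\<^sup>+t. ennreal (exp (- a * t) * exp (- pi * exp (-2 * t))) * ennreal (exp (- a * b)) \<partial>lborel)"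
    by (subst nn_integral_real_affine[where c = 1 and t = b])
       (auto simp: algebra_simps exp_add[symmetric] ennreal_mult[symmetric])
  also have "\<dots> = barrier_const a * ennreal (exp (- a * b))"
    unfolding barrier_const_def by (rule nn_integral_multc) measurable
  finally show ?thesis .
qed

text \<open>
  An arbitrary weight \<open>\<theta>\<close> of the first coordinate makes the induction work. In the last row, keep for each
  coordinate except the first one the term of the potential that bounds it from below by its neighbour in the row
  before, and for the first coordinate \<open>t\<close> the term that bounds its neighbour \<open>u\<close> from below. Integrating
  out the last row then reproduces the claim for one row less, with the weight \<open>H u\<close>, and the
  exponents \<open>a j\<close> add up along the first column.
\<close>
lemma givental_majorant_weighted_bound:
  fixes \<sigma> :: real and \<gamma> :: "nat \<Rightarrow> complex"
  defines "a \<equiv> (\<lambda>j. \<sigma> - Re (\<i> * \<gamma> j))"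
  assumes "\<forall>j \<in> {1..Suc m}. a j > 0"
  shows "\<exists>C < \<infinity>. \<forall>\<theta> \<in> borel_measurable borel.
     (\<integral>\<^sup>+y. ennreal (exp (- \<sigma> * (\<Sum>i = 1..Suc m. y i))) * \<theta> (y 1) * givental_majorant (Suc m) \<gamma> y \<partial>Leb (Suc m))
       \<le> C * (\<integral>\<^sup>+t. \<theta> t * ennreal (exp (- (\<Sum>j = 1..Suc m. a j) * t)) \<partial>lborel)"
  using assms(2)
proof (induction m)
  case 0
  show ?case
  proof (intro exI[of _ 1] conjI ballI)
    fix \<theta> :: "real \<Rightarrow> ennreal" assume [measurable]: "\<theta> \<in> borel_measurable borel"
    have maj: "givental_majorant (Suc 0) \<gamma> y = ennreal (exp (Re (\<i> * \<gamma> 1) * y 1))" for y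
      by (simp add: step_kernel_def space_PiM norm_exp_eq_Re algebra_simps)
    have singleton: "{1..Suc 0} = {1::nat}" by auto
    have "(\<integral>\<^sup>+y. ennreal (exp (- \<sigma> * (\<Sum>i = 1..Suc 0. y i))) * \<theta> (y 1) * givental_majorant (Suc 0) \<gamma> y \<partial>Leb (Suc 0)) =
      (\<integral>\<^sup>+y. (\<lambda>t. \<theta> t * ennreal (exp (- a 1 * t))) (y 1) \<partial>Pi\<^sub>M {1::nat} (\<lambda>i. lborel))"
      unfolding maj singleton
    proof (intro nn_integral_cong)
      fix y :: "nat \<Rightarrow> real"
      have "ennreal (exp (- \<sigma> * y 1)) * ennreal (exp (Re (\<i> * \<gamma> 1) * y 1)) = ennreal (exp (- a 1 * y 1))"
        by (simp add: ennreal_mult[symmetric] exp_add[symmetric] a_def algebra_simps)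
      thus "ennreal (exp (- \<sigma> * (\<Sum>i\<in>{1}. y i))) * \<theta> (y 1) * ennreal (exp (Re (\<i> * \<gamma> 1) * y 1)) =
          \<theta> (y 1) * ennreal (exp (- a 1 * y 1))"
        by (simp add: mult_ac)
    qed
    also have "\<dots> = (\<integral>\<^sup>+t. \<theta> t * ennreal (exp (- a 1 * t)) \<partial>lborel)"
      by (rule lebesgue_product.product_nn_integral_singleton) measurable
    finally show "(\<integral>\<^sup>+y. ennreal (exp (- \<sigma> * (\<Sum>i = 1..Suc 0. y i))) * \<theta> (y 1) * givental_majorant (Suc 0) \<gamma> y \<partial>Leb (Suc 0))
       \<le> 1 * (\<integral>\<^sup>+t. \<theta> t * ennreal (exp (- (\<Sum>j = 1..Suc 0. a j) * t)) \<partial>lborel)"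
      unfolding singleton by (simp del: givental_majorant.simps)
  qed simp
next
  case (Suc m)
  define M where "M = Suc m"
  define g where "g = \<gamma> (Suc M)"
  define b where "b = a (Suc M)"
  define \<nu> where "\<nu> = Re (\<i> * g)"
  define \<alpha> where "\<alpha> = (\<Sum>j = 1..M. a j)"
  have b0: "b > 0" using Suc.prems by (auto simp: b_def M_def)
  have \<alpha>0: "\<alpha> > 0" unfolding \<alpha>_def using Suc.prems by (intro sum_pos) (auto simp: M_def)
  have \<sigma>: "\<sigma> = b + \<nu>" by (simp add: b_def a_def \<nu>_def g_def)
  have sf: "sigma_finite_measure (Leb k)" for k by (rule sigma_finite_PiM_lborel) simp
  have sfl: "sigma_finite_measure (lborel :: real measure)" by standard
  obtain C where C: "C < \<infinity>" and IH: "\<And>\<theta>. \<theta> \<in> borel_measurable borel \<Longrightarrow>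
     (\<integral>\<^sup>+y. ennreal (exp (- \<sigma> * (\<Sum>i = 1..M. y i))) * \<theta> (y 1) * givental_majorant M \<gamma> y \<partial>Leb M)
       \<le> C * (\<integral>\<^sup>+t. \<theta> t * ennreal (exp (- \<alpha> * t)) \<partial>lborel)"
    using Suc.IH Suc.prems unfolding M_def \<alpha>_def by auto
  define C' where "C' = barrier_const b ^ M * C * barrier_const \<alpha>"
  note [measurable] = givental_majorant_measurable step_kernel_measurable_pair
  have [measurable]: "(\<lambda>y. step_kernel M g y z) \<in> borel_measurable (Leb (Suc M))" for z
    by (intro step_kernel_measurable measurable_Leb_component) auto
  have [measurable]: "(\<lambda>z. step_kernel M g y z) \<in> borel_measurable (Leb M)" for y
    by (intro step_kernel_measurable measurable_Leb_component) auto
  have first_meas: "(\<lambda>y. y 1) \<in> borel_measurable (Leb (Suc M))" "(\<lambda>y. y 1) \<in> borel_measurable (Leb M)"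
    by (intro measurable_Leb_component; simp add: M_def)+
  have sum_meas: "(\<lambda>y. \<Sum>i = 1..k. y i) \<in> borel_measurable (Leb k)" for k
    by (intro borel_measurable_sum measurable_Leb_component)
  show ?case unfolding M_def[symmetric]
  proof (intro exI[of _ C'] conjI ballI)
    show "C' < \<infinity>" using C barrier_const_finite[OF b0] barrier_const_finite[OF \<alpha>0]
      by (simp add: C'_def ennreal_mult_less_top power_less_top_ennreal)
    fix \<theta> :: "real \<Rightarrow> ennreal" assume [measurable]: "\<theta> \<in> borel_measurable borel"
    \<comment> \<open>the weight on the neighbour \<open>u\<close> that is left after integrating out the first coordinate of the last row\<close>
    define H where "H u = (\<integral>\<^sup>+t. \<theta> t * ennreal (exp (- b * t) * exp (- pi * exp (2 * (t - u)))) \<partial>lborel)" for u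
    define W where "W y = ennreal (exp (- \<sigma> * (\<Sum>i = 1..Suc M. y i))) * \<theta> (y 1)" for y
    have [measurable]: "H \<in> borel_measurable borel" unfolding H_def by measurable
    have [measurable]: "W \<in> borel_measurable (Leb (Suc M))"
      unfolding W_def by (intro borel_measurable_times_ennreal measurable_compose[OF first_meas(1)] measurable_compose[OF sum_meas]) measurable
    have [measurable]: "(\<lambda>z. ennreal (exp (- \<sigma> * (\<Sum>i = 1..M. z i))) * H (z 1)) \<in> borel_measurable (Leb M)"
      by (intro borel_measurable_times_ennreal measurable_compose[OF first_meas(2)] measurable_compose[OF sum_meas]) measurable
    have inner: "(\<integral>\<^sup>+y. W y * ennreal (norm (step_kernel M g y z)) \<partial>Leb (Suc M)) \<le>
        barrier_const b ^ M * (ennreal (exp (- \<sigma> * (\<Sum>i = 1..M. z i))) * H (z 1))" for z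
    proof -
      define G where "G k t = (if k = 1 then \<theta> t * ennreal (exp (- b * t) * exp (- pi * exp (2 * (t - z 1))))
            else ennreal (exp (- b * t) * exp (- pi * exp (2 * (z (k - 1) - t)))))" for k :: nat and t :: real
      have [measurable]: "G k \<in> borel_measurable borel" for k unfolding G_def by (cases "k = 1") auto
      have pw: "W y * ennreal (norm (step_kernel M g y z)) \<le>
          ennreal (exp (- \<nu> * (\<Sum>i = 1..M. z i))) * (\<Prod>k\<in>{1..Suc M}. G k (y k))" for y
      proof -
        define P where "P = (\<Sum>i = 1..M. exp (2 * (z i - y (Suc i))))"
        have shift: "(\<Prod>k\<in>{1..Suc M}. G k (y k)) = G 1 (y 1) * (\<Prod>k = 1..M. G (Suc k) (y (Suc k)))"
          by (subst prod.atLeast_Suc_atMost) (simp_all add: prod.shift_bounds_cl_Suc_ivl del: prod.cl_ivl_Suc)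
        have "(\<Prod>k = 1..M. G (Suc k) (y (Suc k))) =
            (\<Prod>k = 1..M. ennreal (exp (- b * y (Suc k) + - pi * exp (2 * (z k - y (Suc k))))))"
          by (intro prod.cong) (auto simp: G_def exp_add[symmetric])
        also have "\<dots> = ennreal (exp (\<Sum>k = 1..M. - b * y (Suc k) + - pi * exp (2 * (z k - y (Suc k)))))"
          by (simp add: prod_ennreal exp_sum)
        also have "(\<Sum>k = 1..M. - b * y (Suc k) + - pi * exp (2 * (z k - y (Suc k)))) =
            - b * ((\<Sum>k = 1..Suc M. y k) - y 1) - pi * P"
        proof -
          have "(\<Sum>k = 1..M. y (Suc k)) = (\<Sum>k = 1..Suc M. y k) - y 1" by (induction M) auto
          thus ?thesis by (simp only: sum.distrib sum_distrib_left[symmetric] P_def)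
        qed
        finally have tail: "(\<Prod>k = 1..M. G (Suc k) (y (Suc k))) = ennreal (exp (- b * ((\<Sum>k = 1..Suc M. y k) - y 1) - pi * P))" .
        have pot: "exp (2 * (y 1 - z 1)) + P \<le> (\<Sum>i = 1..M. exp (2 * (y i - z i)) + exp (2 * (z i - y (Suc i))))"
        proof -
          have "exp (2 * (y 1 - z 1)) \<le> (\<Sum>i = 1..M. exp (2 * (y i - z i)))"
            by (rule member_le_sum[of 1]) (auto simp: M_def)
          thus ?thesis by (simp add: sum.distrib P_def)
        qed
        have "norm (step_kernel M g y z) = exp (\<nu> * ((\<Sum>i = 1..Suc M. y i) - (\<Sum>i = 1..M. z i)) -
           pi * (\<Sum>i = 1..M. exp (2 * (y i - z i)) + exp (2 * (z i - y (Suc i)))))"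
          unfolding step_kernel_def norm_exp_eq_Re \<nu>_def
          by (simp only: minus_complex.sel Re_complex_of_real) (simp del: sum.cl_ivl_Suc)
        also have "\<dots> \<le> exp (\<nu> * ((\<Sum>i = 1..Suc M. y i) - (\<Sum>i = 1..M. z i)) - pi * (exp (2 * (y 1 - z 1)) + P))"
          using pot by (simp del: sum.cl_ivl_Suc)
        finally have "W y * ennreal (norm (step_kernel M g y z)) \<le> W y *
           ennreal (exp (\<nu> * ((\<Sum>i = 1..Suc M. y i) - (\<Sum>i = 1..M. z i)) - pi * (exp (2 * (y 1 - z 1)) + P)))"
          by (intro mult_left_mono ennreal_leI) auto
        also have "\<dots> = ennreal (exp (- \<nu> * (\<Sum>i = 1..M. z i))) * (\<Prod>k\<in>{1..Suc M}. G k (y k))"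
        proof -
          define S where "S = (\<Sum>i = 1..Suc M. y i)"
          define Z where "Z = (\<Sum>i = 1..M. z i)"
          show ?thesis
            unfolding W_def shift tail S_def[symmetric] Z_def[symmetric]
            by (simp add: G_def mult_ac ennreal_mult[symmetric] exp_add[symmetric])
               (simp add: \<sigma> algebra_simps)
        qed
        finally show ?thesis .
      qed
      have "(\<integral>\<^sup>+y. W y * ennreal (norm (step_kernel M g y z)) \<partial>Leb (Suc M)) \<le>
          (\<integral>\<^sup>+y. ennreal (exp (- \<nu> * (\<Sum>i = 1..M. z i))) * (\<Prod>k\<in>{1..Suc M}. G k (y k)) \<partial>Leb (Suc M))"
        by (intro nn_integral_mono pw)
      also have "\<dots> = ennreal (exp (- \<nu> * (\<Sum>i = 1..M. z i))) * (\<integral>\<^sup>+y. (\<Prod>k\<in>{1..Suc M}. G k (y k)) \<partial>Leb (Suc M))"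
      proof (rule nn_integral_cmult)
        have "(\<lambda>y. G k (y k)) \<in> borel_measurable (Leb (Suc M))" if "k \<in> {1..Suc M}" for k
          by (rule measurable_compose[OF measurable_Leb_component[OF that]]) measurable
        thus "(\<lambda>y. \<Prod>k\<in>{1..Suc M}. G k (y k)) \<in> borel_measurable (Leb (Suc M))"
          by (rule borel_measurable_prod_ennreal)
      qed
      also have "(\<integral>\<^sup>+y. (\<Prod>k\<in>{1..Suc M}. G k (y k)) \<partial>Leb (Suc M)) = (\<Prod>k\<in>{1..Suc M}. integral\<^sup>N lborel (G k))"
        by (rule lebesgue_product.product_nn_integral_prod) auto
      also have "\<dots> = integral\<^sup>N lborel (G 1) * (\<Prod>k = 1..M. integral\<^sup>N lborel (G (Suc k)))"
        by (subst prod.atLeast_Suc_atMost) (simp_all add: prod.shift_bounds_cl_Suc_ivl del: prod.cl_ivl_Suc)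
      also have "integral\<^sup>N lborel (G 1) = H (z 1)"
      proof -
        have "G 1 = (\<lambda>t. \<theta> t * ennreal (exp (- b * t) * exp (- pi * exp (2 * (t - z 1)))))"
          by (simp add: G_def fun_eq_iff)
        thus ?thesis by (simp only: H_def)
      qed
      also have "(\<Prod>k = 1..M. integral\<^sup>N lborel (G (Suc k))) = (\<Prod>k = 1..M. barrier_const b * ennreal (exp (- b * z k)))"
      proof (intro prod.cong refl)
        fix k assume "k \<in> {1..M}"
        hence "G (Suc k) = (\<lambda>t. ennreal (exp (- b * t) * exp (- pi * exp (2 * (z k - t)))))"
          by (simp add: G_def fun_eq_iff)
        thus "integral\<^sup>N lborel (G (Suc k)) = barrier_const b * ennreal (exp (- b * z k))"
          by (simp only: nn_integral_barrier)
      qed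
      also have "\<dots> = barrier_const b ^ M * ennreal (exp (- b * (\<Sum>k = 1..M. z k)))"
        by (simp add: prod.distrib prod_ennreal exp_sum[symmetric] sum_distrib_left sum_negf)
      also have "ennreal (exp (- \<nu> * (\<Sum>i = 1..M. z i))) * (H (z 1) * (barrier_const b ^ M * ennreal (exp (- b * (\<Sum>k = 1..M. z k))))) =
          barrier_const b ^ M * (ennreal (exp (- \<sigma> * (\<Sum>i = 1..M. z i))) * H (z 1))"
      proof -
        define Z where "Z = (\<Sum>i = 1..M. z i)"
        have "ennreal (exp (- \<sigma> * Z)) = ennreal (exp (- \<nu> * Z)) * ennreal (exp (- b * Z))"
          by (simp add: ennreal_mult[symmetric] exp_add[symmetric] \<sigma> algebra_simps)
        thus ?thesis unfolding Z_def[symmetric] by (simp add: mult_ac)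
      qed
      finally show ?thesis .
    qed
    have Hint: "(\<integral>\<^sup>+u. H u * ennreal (exp (- \<alpha> * u)) \<partial>lborel) =
        barrier_const \<alpha> * (\<integral>\<^sup>+t. \<theta> t * ennreal (exp (- (\<alpha> + b) * t)) \<partial>lborel)"
    proof -
      have "(\<integral>\<^sup>+u. H u * ennreal (exp (- \<alpha> * u)) \<partial>lborel) =
        (\<integral>\<^sup>+u. \<integral>\<^sup>+t. \<theta> t * ennreal (exp (- b * t)) * ennreal (exp (- \<alpha> * u) * exp (- pi * exp (2 * (t - u)))) \<partial>lborel \<partial>lborel)"
        unfolding H_def by (subst nn_integral_multc[symmetric]) (auto simp: mult_ac ennreal_mult)
      also have "\<dots> = (\<integral>\<^sup>+t. \<integral>\<^sup>+u. \<theta> t * ennreal (exp (- b * t)) * ennreal (exp (- \<alpha> * u) * exp (- pi * exp (2 * (t - u)))) \<partial>lborel \<partial>lborel)"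
        by (intro nn_integral_swap sfl) measurable
      also have "\<dots> = (\<integral>\<^sup>+t. \<theta> t * ennreal (exp (- b * t)) * (barrier_const \<alpha> * ennreal (exp (- \<alpha> * t))) \<partial>lborel)"
        unfolding nn_integral_barrier[symmetric] by (intro nn_integral_cong nn_integral_cmult) measurable
      also have "\<dots> = (\<integral>\<^sup>+t. barrier_const \<alpha> * (\<theta> t * ennreal (exp (- (\<alpha> + b) * t))) \<partial>lborel)"
      proof (intro nn_integral_cong)
        fix t :: real
        have "ennreal (exp (- (\<alpha> + b) * t)) = ennreal (exp (- b * t)) * ennreal (exp (- \<alpha> * t))"
          by (simp add: ennreal_mult[symmetric] exp_add[symmetric] algebra_simps)
        thus "\<theta> t * ennreal (exp (- b * t)) * (barrier_const \<alpha> * ennreal (exp (- \<alpha> * t))) =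
            barrier_const \<alpha> * (\<theta> t * ennreal (exp (- (\<alpha> + b) * t)))"
          by (simp only: mult_ac)
      qed
      also have "\<dots> = barrier_const \<alpha> * (\<integral>\<^sup>+t. \<theta> t * ennreal (exp (- (\<alpha> + b) * t)) \<partial>lborel)"
        by (rule nn_integral_cmult) measurable
      finally show ?thesis .
    qed
    have "(\<integral>\<^sup>+y. ennreal (exp (- \<sigma> * (\<Sum>i = 1..Suc M. y i))) * \<theta> (y 1) * givental_majorant (Suc M) \<gamma> y \<partial>Leb (Suc M)) =
       (\<integral>\<^sup>+y. \<integral>\<^sup>+z. W y * (ennreal (norm (step_kernel M g y z)) * givental_majorant M \<gamma> z) \<partial>Leb M \<partial>Leb (Suc M))"
      unfolding givental_majorant.simps W_def[symmetric] g_def[symmetric]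
      by (intro nn_integral_cong nn_integral_cmult[symmetric]) measurable
    also have "\<dots> = (\<integral>\<^sup>+z. \<integral>\<^sup>+y. W y * (ennreal (norm (step_kernel M g y z)) * givental_majorant M \<gamma> z) \<partial>Leb (Suc M) \<partial>Leb M)"
      by (intro nn_integral_swap sf) measurable
    also have "\<dots> = (\<integral>\<^sup>+z. (\<integral>\<^sup>+y. W y * ennreal (norm (step_kernel M g y z)) \<partial>Leb (Suc M)) * givental_majorant M \<gamma> z \<partial>Leb M)"
      by (subst nn_integral_multc[symmetric]) (auto simp: mult.assoc simp del: One_nat_def)
    also have "\<dots> \<le> (\<integral>\<^sup>+z. barrier_const b ^ M * (ennreal (exp (- \<sigma> * (\<Sum>i = 1..M. z i))) * H (z 1)) * givental_majorant M \<gamma> z \<partial>Leb M)"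
      by (intro nn_integral_mono mult_right_mono inner) auto
    also have "\<dots> = barrier_const b ^ M * (\<integral>\<^sup>+z. ennreal (exp (- \<sigma> * (\<Sum>i = 1..M. z i))) * H (z 1) * givental_majorant M \<gamma> z \<partial>Leb M)"
      unfolding mult.assoc[of "barrier_const b ^ M"] by (rule nn_integral_cmult) measurable
    also have "\<dots> \<le> barrier_const b ^ M * (C * (\<integral>\<^sup>+t. H t * ennreal (exp (- \<alpha> * t)) \<partial>lborel))"
      by (intro mult_left_mono IH) auto
    also have "\<dots> = C' * (\<integral>\<^sup>+t. \<theta> t * ennreal (exp (- (\<alpha> + b) * t)) \<partial>lborel)"
      unfolding Hint C'_def by (simp add: mult_ac)
    also have "\<alpha> + b = (\<Sum>j = 1..Suc M. a j)" by (simp add: \<alpha>_def b_def)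
    finally show "(\<integral>\<^sup>+y. ennreal (exp (- \<sigma> * (\<Sum>i = 1..Suc M. y i))) * \<theta> (y 1) * givental_majorant (Suc M) \<gamma> y \<partial>Leb (Suc M))
       \<le> C' * (\<integral>\<^sup>+t. \<theta> t * ennreal (exp (- (\<Sum>j = 1..Suc M. a j) * t)) \<partial>lborel)" .
  qed
qed

section \<open>Eigenfunctions of the Baxter operator\<close>

text \<open>The bound above for the weight that the Baxter kernel, and the kernel on the group, put on the first coordinate.\<close>
lemma givental_majorant_weighted_finite:
  assumes cond: "\<forall>j \<in> {1..Suc m}. Re (\<i> * lam - \<i> * \<gamma> j) > 0"
  shows "(\<integral>\<^sup>+y. ennreal (exp (- Re (\<i> * lam) * (\<Sum>i = 1..Suc m. y i))) * ennreal (exp (- pi * exp (2 * (b - y 1)))) *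
     givental_majorant (Suc m) \<gamma> y \<partial>Leb (Suc m)) < \<infinity>"
proof -
  define \<alpha> where "\<alpha> = (\<Sum>j = 1..Suc m. Re (\<i> * lam) - Re (\<i> * \<gamma> j))"
  have "\<alpha> > 0" unfolding \<alpha>_def using cond by (intro sum_pos) auto
  define \<theta> where "\<theta> t = ennreal (exp (- pi * exp (2 * (b - t))))" for t
  have "\<forall>j \<in> {1..Suc m}. Re (\<i> * lam) - Re (\<i> * \<gamma> j) > 0" using cond by auto
  from givental_majorant_weighted_bound[OF this] obtain C where C: "C < \<infinity>" and bound: "\<theta> \<in> borel_measurable borel \<Longrightarrow>
     (\<integral>\<^sup>+y. ennreal (exp (- Re (\<i> * lam) * (\<Sum>i = 1..Suc m. y i))) * \<theta> (y 1) * givental_majorant (Suc m) \<gamma> y \<partial>Leb (Suc m))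
       \<le> C * (\<integral>\<^sup>+t. \<theta> t * ennreal (exp (- \<alpha> * t)) \<partial>lborel)"
    unfolding \<alpha>_def by blast
  have "\<theta> \<in> borel_measurable borel" unfolding \<theta>_def by measurable
  note bound[OF this]
  also have "(\<integral>\<^sup>+t. \<theta> t * ennreal (exp (- \<alpha> * t)) \<partial>lborel) = barrier_const \<alpha> * ennreal (exp (- \<alpha> * b))"
    unfolding nn_integral_barrier[symmetric] \<theta>_def by (simp add: ennreal_mult[symmetric] mult.commute)
  also have "C * (barrier_const \<alpha> * ennreal (exp (- \<alpha> * b))) < \<infinity>"
    using C barrier_const_finite[OF \<open>\<alpha> > 0\<close>] by (simp add: ennreal_mult_less_top)
  finally show ?thesis unfolding \<theta>_def .
qed

lemma norm_baxter_kernel_le: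
  "norm (baxter_kernel (Suc m) lam x y) \<le> 2 ^ Suc m * exp (Re (\<i> * lam) * (\<Sum>i = 1..Suc m. x i)) *
     (exp (- Re (\<i> * lam) * (\<Sum>i = 1..Suc m. y i)) * exp (- pi * exp (2 * (x 1 - y 1))))"
proof -
  define V where "V = (\<Sum>i = 1..Suc m. exp (2 * (x i - y i))) + (\<Sum>i \<in> {1..<Suc m}. exp (2 * (y i - x (Suc i))))"
  define X where "X = (\<Sum>i = 1..Suc m. x i)"
  define Y where "Y = (\<Sum>i = 1..Suc m. y i)"
  have "exp (2 * (x 1 - y 1)) \<le> (\<Sum>i = 1..Suc m. exp (2 * (x i - y i)))"
    by (rule member_le_sum[of 1]) auto
  hence V: "exp (2 * (x 1 - y 1)) \<le> V"
    unfolding V_def by (rule order_trans) (auto intro!: add_nonneg_nonneg sum_nonneg)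
  have "norm (baxter_kernel (Suc m) lam x y) = 2 ^ Suc m * exp (Re (\<i> * lam) * (X - Y) - pi * V)"
    unfolding baxter_kernel_def norm_mult norm_power norm_exp_eq_Re V_def[symmetric] X_def[symmetric] Y_def[symmetric]
    by simp
  also have "\<dots> \<le> 2 ^ Suc m * exp (Re (\<i> * lam) * (X - Y) - pi * exp (2 * (x 1 - y 1)))"
    using V by simp
  also have "exp (Re (\<i> * lam) * (X - Y) - pi * exp (2 * (x 1 - y 1))) =
     exp (Re (\<i> * lam) * X) * (exp (- Re (\<i> * lam) * Y) * exp (- pi * exp (2 * (x 1 - y 1))))"
    by (simp add: exp_add[symmetric] algebra_simps)
  finally show ?thesis unfolding X_def Y_def by (simp only: mult.assoc)
qed

text \<open>
  By the eigenvalue equation, a nonzero multiple of the majorant at \<open>x\<close> is the integral of the majorant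
  against the Baxter kernel, and this integral is finite by the weighted bound.
\<close>
lemma givental_majorant_finite:
  assumes cond: "\<forall>j \<in> {1..m}. Re (\<i> * lam - \<i> * \<gamma> j) > 0"
  shows "givental_majorant m \<gamma> x < \<infinity>"
proof (cases m)
  case (Suc n)
  define c where "c = 2 ^ Suc n * exp (Re (\<i> * lam) * (\<Sum>i = 1..Suc n. x i))"
  define w where "w y = ennreal (exp (- Re (\<i> * lam) * (\<Sum>i = 1..Suc n. y i))) * ennreal (exp (- pi * exp (2 * (x 1 - y 1)))) *
     givental_majorant (Suc n) \<gamma> y" for y
  define L where "L = (\<Prod>j = 1..m. ennreal (norm (gamma_factor (of_real (Re (\<i> * lam - \<i> * \<gamma> j))))))"
  have c0: "c \<ge> 0" by (simp add: c_def)
  have [measurable]: "w \<in> borel_measurable (Leb (Suc n))"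
    unfolding w_def
  proof (intro borel_measurable_times_ennreal givental_majorant_measurable)
    have [measurable]: "(\<lambda>y. \<Sum>i = 1..Suc n. y i) \<in> borel_measurable (Leb (Suc n))"
      by (intro borel_measurable_sum measurable_Leb_component)
    show "(\<lambda>y. ennreal (exp (- Re (\<i> * lam) * (\<Sum>i = 1..Suc n. y i)))) \<in> borel_measurable (Leb (Suc n))"
      by measurable
    have [measurable]: "(\<lambda>y. y 1) \<in> borel_measurable (Leb (Suc n))" by (rule measurable_Leb_component) simp
    show "(\<lambda>y. ennreal (exp (- pi * exp (2 * (x 1 - y 1))))) \<in> borel_measurable (Leb (Suc n))" by measurable
  qed
  have "L * givental_majorant m \<gamma> x = (\<integral>\<^sup>+y. ennreal (norm (baxter_kernel m lam x y)) * givental_majorant m \<gamma> y \<partial>Leb m)"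
    unfolding L_def by (rule baxter_givental_majorant[OF cond, symmetric])
  also have "\<dots> \<le> (\<integral>\<^sup>+y. ennreal c * w y \<partial>Leb (Suc n))"
    unfolding Suc
  proof (intro nn_integral_mono)
    fix y
    have "ennreal (norm (baxter_kernel (Suc n) lam x y)) \<le> ennreal c *
       (ennreal (exp (- Re (\<i> * lam) * (\<Sum>i = 1..Suc n. y i))) * ennreal (exp (- pi * exp (2 * (x 1 - y 1)))))"
      using norm_baxter_kernel_le[of n lam x y, folded c_def] c0
      by (simp add: ennreal_mult[symmetric] ennreal_leI del: sum.cl_ivl_Suc)
    thus "ennreal (norm (baxter_kernel (Suc n) lam x y)) * givental_majorant (Suc n) \<gamma> y \<le> ennreal c * w y"
      unfolding w_def mult.assoc[symmetric] by (rule mult_right_mono) simp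
  qed
  also have "\<dots> = ennreal c * (\<integral>\<^sup>+y. w y \<partial>Leb (Suc n))" by (rule nn_integral_cmult) measurable
  also have "\<dots> < \<infinity>"
    using givental_majorant_weighted_finite[of n lam \<gamma> "x 1"] cond unfolding w_def Suc
    by (simp only: ennreal_mult_less_top infinity_ennreal_def) auto
  finally have "L * givental_majorant m \<gamma> x < \<infinity>" .
  moreover have "L \<noteq> 0"
  proof -
    have "gamma_factor (of_real (Re (\<i> * lam - \<i> * \<gamma> j))) \<noteq> 0" if "j \<in> {1..m}" for j
      using cond that by (intro gamma_factor_nonzero) auto
    hence "(\<Prod>j = 1..m. norm (gamma_factor (of_real (Re (\<i> * lam - \<i> * \<gamma> j))))) > 0"
      by (intro prod_pos) (simp del: minus_complex.sel)
    thus ?thesis unfolding L_def by (subst prod_ennreal) (simp_all only: norm_ge_zero ennreal_eq_0_iff not_le)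
  qed
  ultimately show ?thesis by (auto simp: ennreal_mult_less_top)
qed simp

text \<open>
  Moving the Baxter kernel past one step at a time collects one Gamma factor per variable. The majorant
  justifies both exchanges of integrals.
\<close>
theorem baxter_givental_integral:
  assumes cond: "\<forall>j \<in> {1..m}. Re (\<i> * lam - \<i> * \<gamma> j) > 0"
  shows "(LINT y|Leb m. baxter_kernel m lam x y * givental_integral m \<gamma> y) =
    (\<Prod>j = 1..m. gamma_factor (\<i> * lam - \<i> * \<gamma> j)) * givental_integral m \<gamma> x"
  using assms
proof (induction m arbitrary: x)
  case 0
  show ?case by (simp add: baxter_kernel_def space_PiM measure_def)
next
  case (Suc m)
  let ?g = "\<gamma> (Suc m)" and ?G = "\<lambda>j. gamma_factor (\<i> * lam - \<i> * \<gamma> j)"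
  have sg: "Re (\<i> * lam - \<i> * ?g) > 0" using Suc.prems by auto
  have cond_m: "\<forall>j \<in> {1..m}. Re (\<i> * lam - \<i> * \<gamma> j) > 0" using Suc.prems by auto
  have IH: "(LINT z|Leb m. baxter_kernel m lam w z * givental_integral m \<gamma> z) =
      (\<Prod>j = 1..m. ?G j) * givental_integral m \<gamma> w" for w
    using Suc.prems by (intro Suc.IH) auto
  have sf: "sigma_finite_measure (Leb k)" for k by (rule sigma_finite_PiM_lborel) simp
  have [measurable]: "(\<lambda>y. baxter_kernel k lam x y) \<in> borel_measurable (Leb k)" for k x
    by (intro baxter_kernel_measurable measurable_Leb_component) auto
  have [measurable]: "(\<lambda>y. step_kernel m g y z) \<in> borel_measurable (Leb (Suc m))" for g z
    by (intro step_kernel_measurable measurable_Leb_component) auto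
  have [measurable]: "(\<lambda>z. step_kernel m g x z) \<in> borel_measurable (Leb m)" for g x
    by (intro step_kernel_measurable measurable_Leb_component) auto
  have [measurable]: "(\<lambda>p. baxter_kernel m lam (fst p) (snd p)) \<in> borel_measurable (Leb m \<Otimes>\<^sub>M Leb m)"
      "(\<lambda>p. baxter_kernel m lam (snd p) (fst p)) \<in> borel_measurable (Leb m \<Otimes>\<^sub>M Leb m)"
    by (intro baxter_kernel_measurable measurable_compose[OF measurable_fst measurable_Leb_component]
        measurable_compose[OF measurable_snd measurable_Leb_component]; simp)+
  have prod_fin: "(\<Prod>j = 1..k. ennreal (norm (f j))) < \<infinity>" for k and f :: "nat \<Rightarrow> complex"
    by (subst prod_ennreal) auto
  note [measurable] = givental_majorant_measurable givental_integral_measurable step_kernel_measurable_pair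
  have "(\<integral>\<^sup>+y. \<integral>\<^sup>+z. ennreal (norm (baxter_kernel (Suc m) lam x y * (step_kernel m ?g y z * givental_integral m \<gamma> z))) \<partial>Leb m \<partial>Leb (Suc m))
      \<le> (\<integral>\<^sup>+y. \<integral>\<^sup>+z. ennreal (norm (baxter_kernel (Suc m) lam x y)) * (ennreal (norm (step_kernel m ?g y z)) * givental_majorant m \<gamma> z) \<partial>Leb m \<partial>Leb (Suc m))"
    by (intro nn_integral_mono) (auto simp: norm_mult ennreal_mult intro!: mult_left_mono norm_givental_integral_le)
  also have "\<dots> = (\<integral>\<^sup>+y. ennreal (norm (baxter_kernel (Suc m) lam x y)) * givental_majorant (Suc m) \<gamma> y \<partial>Leb (Suc m))"
    unfolding givental_majorant.simps by (intro nn_integral_cong nn_integral_cmult) measurable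
  also have "\<dots> < \<infinity>"
    unfolding baxter_givental_majorant[OF Suc.prems] infinity_ennreal_def ennreal_mult_less_top
    using givental_majorant_finite[OF Suc.prems, of x]
    by (intro disjI2 conjI prod_fin[unfolded infinity_ennreal_def]) simp
  finally have fin1: "(\<integral>\<^sup>+y. \<integral>\<^sup>+z. ennreal (norm (baxter_kernel (Suc m) lam x y * (step_kernel m ?g y z * givental_integral m \<gamma> z))) \<partial>Leb m \<partial>Leb (Suc m)) < \<infinity>" .
  have "(\<integral>\<^sup>+w. \<integral>\<^sup>+z. ennreal (norm (step_kernel m ?g x w * (baxter_kernel m lam w z * givental_integral m \<gamma> z))) \<partial>Leb m \<partial>Leb m)
      \<le> (\<integral>\<^sup>+w. \<integral>\<^sup>+z. ennreal (norm (step_kernel m ?g x w)) * (ennreal (norm (baxter_kernel m lam w z)) * givental_majorant m \<gamma> z) \<partial>Leb m \<partial>Leb m)"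
    by (intro nn_integral_mono) (auto simp: norm_mult ennreal_mult intro!: mult_left_mono norm_givental_integral_le)
  also have "\<dots> = (\<integral>\<^sup>+w. ennreal (norm (step_kernel m ?g x w)) *
      ((\<Prod>j = 1..m. ennreal (norm (gamma_factor (of_real (Re (\<i> * lam - \<i> * \<gamma> j)))))) * givental_majorant m \<gamma> w) \<partial>Leb m)"
    unfolding baxter_givental_majorant[OF cond_m, symmetric] by (intro nn_integral_cong nn_integral_cmult) measurable
  also have "\<dots> = (\<Prod>j = 1..m. ennreal (norm (gamma_factor (of_real (Re (\<i> * lam - \<i> * \<gamma> j)))))) * givental_majorant (Suc m) \<gamma> x"
    unfolding givental_majorant.simps by (subst nn_integral_cmult[symmetric]) (auto simp: mult_ac simp del: One_nat_def)
  also have "\<dots> < \<infinity>"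
    unfolding infinity_ennreal_def ennreal_mult_less_top
    using givental_majorant_finite[OF Suc.prems, of x]
    by (intro disjI2 conjI prod_fin[unfolded infinity_ennreal_def]) simp
  finally have fin2: "(\<integral>\<^sup>+w. \<integral>\<^sup>+z. ennreal (norm (step_kernel m ?g x w * (baxter_kernel m lam w z * givental_integral m \<gamma> z))) \<partial>Leb m \<partial>Leb m) < \<infinity>" .
  have "(LINT y|Leb (Suc m). baxter_kernel (Suc m) lam x y * givental_integral (Suc m) \<gamma> y) =
     (LINT y|Leb (Suc m). LINT z|Leb m. baxter_kernel (Suc m) lam x y * (step_kernel m ?g y z * givental_integral m \<gamma> z))"
    by (simp add: integral_mult_right_zero)
  also have "\<dots> = (LINT z|Leb m. LINT y|Leb (Suc m). baxter_kernel (Suc m) lam x y * (step_kernel m ?g y z * givental_integral m \<gamma> z))"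
    by (intro integral_swap sf fin1) measurable
  also have "\<dots> = (LINT z|Leb m. (LINT y|Leb (Suc m). baxter_kernel (Suc m) lam x y * step_kernel m ?g y z) * givental_integral m \<gamma> z)"
    by (simp add: integral_mult_left_zero mult.assoc[symmetric] del: One_nat_def)
  also have "\<dots> = (LINT z|Leb m. ?G (Suc m) * ((LINT w|Leb m. step_kernel m ?g x w * baxter_kernel m lam w z) * givental_integral m \<gamma> z))"
    unfolding baxter_step_intertwining(3)[OF sg] by (simp add: mult.assoc)
  also have "\<dots> = ?G (Suc m) * (LINT z|Leb m. LINT w|Leb m. step_kernel m ?g x w * (baxter_kernel m lam w z * givental_integral m \<gamma> z))"
    by (simp add: integral_mult_right_zero integral_mult_left_zero[symmetric] mult.assoc del: integral_mult_left_zero)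
  also have "(LINT z|Leb m. LINT w|Leb m. step_kernel m ?g x w * (baxter_kernel m lam w z * givental_integral m \<gamma> z)) =
     (LINT w|Leb m. LINT z|Leb m. step_kernel m ?g x w * (baxter_kernel m lam w z * givental_integral m \<gamma> z))"
    by (intro integral_swap[symmetric] sf fin2) measurable
  also have "\<dots> = (LINT w|Leb m. step_kernel m ?g x w * ((\<Prod>j = 1..m. ?G j) * givental_integral m \<gamma> w))"
    unfolding IH[symmetric] by (simp add: integral_mult_right_zero)
  also have "\<dots> = (\<Prod>j = 1..m. ?G j) * givental_integral (Suc m) \<gamma> x"
    unfolding givental_integral.simps integral_mult_right_zero[symmetric] by (simp add: mult_ac)
  finally show ?case by (simp add: mult_ac)
qed

section \<open>Whittaker functions as iterated integrals\<close>

text \<open>Used to identify the coordinates \<open>(l + 1, i)\<close> of a row of the triangular array with \<open>i\<close>.\<close>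
lemma distr_PiM_lborel_reindex:
  fixes f :: "'i \<Rightarrow> 'j"
  assumes I: "finite I" and f: "inj_on f I"
  shows "(\<lambda>X. \<lambda>i\<in>I. X (f i)) \<in> (\<Pi>\<^sub>M j \<in> f ` I. lborel) \<rightarrow>\<^sub>M (\<Pi>\<^sub>M i \<in> I. lborel :: real measure)"
    and "distr (\<Pi>\<^sub>M j \<in> f ` I. lborel) (\<Pi>\<^sub>M i \<in> I. lborel) (\<lambda>X. \<lambda>i\<in>I. X (f i)) = (\<Pi>\<^sub>M i \<in> I. lborel :: real measure)"
proof -
  show m: "(\<lambda>X. \<lambda>i\<in>I. X (f i)) \<in> (\<Pi>\<^sub>M j \<in> f ` I. lborel) \<rightarrow>\<^sub>M (\<Pi>\<^sub>M i \<in> I. lborel :: real measure)"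
    by (intro measurable_restrict measurable_component_singleton) auto
  show "distr (\<Pi>\<^sub>M j \<in> f ` I. lborel) (\<Pi>\<^sub>M i \<in> I. lborel) (\<lambda>X. \<lambda>i\<in>I. X (f i)) = (\<Pi>\<^sub>M i \<in> I. lborel :: real measure)"
  proof (rule lebesgue_product.PiM_eqI)
    fix A :: "'i \<Rightarrow> real set" assume A: "\<And>i. i \<in> I \<Longrightarrow> A i \<in> sets lborel"
    have inv: "the_inv_into I f (f i) = i" if "i \<in> I" for i using f that by (rule the_inv_into_f_f)
    have "(\<lambda>X. \<lambda>i\<in>I. X (f i)) -` Pi\<^sub>E I A \<inter> space (\<Pi>\<^sub>M j \<in> f ` I. lborel :: real measure) =
        Pi\<^sub>E (f ` I) (\<lambda>j. A (the_inv_into I f j))"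
      by (auto simp: space_PiM PiE_iff inv)
    hence "emeasure (distr (\<Pi>\<^sub>M j \<in> f ` I. lborel) (\<Pi>\<^sub>M i \<in> I. lborel) (\<lambda>X. \<lambda>i\<in>I. X (f i))) (Pi\<^sub>E I A) =
        emeasure (\<Pi>\<^sub>M j \<in> f ` I. lborel) (Pi\<^sub>E (f ` I) (\<lambda>j. A (the_inv_into I f j)))"
      using A I by (subst emeasure_distr[OF m]) (auto intro!: sets_PiM_I_finite)
    also have "\<dots> = (\<Prod>j\<in>f ` I. emeasure lborel (A (the_inv_into I f j)))"
      using A I by (intro lebesgue_product.emeasure_PiM) (auto simp: inv)
    also have "\<dots> = (\<Prod>i\<in>I. emeasure lborel (A i))"
      using f by (subst prod.reindex) (auto simp: inv)
    finally show "emeasure (distr (\<Pi>\<^sub>M j \<in> f ` I. lborel) (\<Pi>\<^sub>M i \<in> I. lborel) (\<lambda>X. \<lambda>i\<in>I. X (f i))) (Pi\<^sub>E I A) =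
        (\<Prod>i\<in>I. emeasure lborel (A i))" .
  qed (use I in auto)
qed

lemma whittaker_integrand_cong:
  assumes "\<And>k i. 1 \<le> i \<Longrightarrow> i \<le> k \<Longrightarrow> k \<le> Suc l \<Longrightarrow> t k i = t' k i"
  shows "whittaker_integrand l \<gamma> t = whittaker_integrand l \<gamma> t'"
proof -
  have rows: "(\<Sum>i = 1..k. t k i) = (\<Sum>i = 1..k. t' k i)" if "k \<le> Suc l" for k
    using that by (intro sum.cong) (auto intro!: assms)
  have 1: "(\<Sum>k = 1..l + 1. \<gamma> k * of_real ((\<Sum>i = 1..k. t k i) - (\<Sum>i = 1..k - 1. t (k - 1) i))) =
     (\<Sum>k = 1..l + 1. \<gamma> k * of_real ((\<Sum>i = 1..k. t' k i) - (\<Sum>i = 1..k - 1. t' (k - 1) i)))"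
  proof (intro sum.cong refl)
    fix k assume "k \<in> {1..l + 1}"
    hence "k \<le> Suc l" "k - 1 \<le> Suc l" by auto
    thus "\<gamma> k * of_real ((\<Sum>i = 1..k. t k i) - (\<Sum>i = 1..k - 1. t (k - 1) i)) =
        \<gamma> k * of_real ((\<Sum>i = 1..k. t' k i) - (\<Sum>i = 1..k - 1. t' (k - 1) i))"
      by (simp only: rows)
  qed
  have 2: "(\<Sum>k = 1..l. \<Sum>i = 1..k. exp (2 * (t (k + 1) i - t k i)) + exp (2 * (t k i - t (k + 1) (i + 1)))) =
      (\<Sum>k = 1..l. \<Sum>i = 1..k. exp (2 * (t' (k + 1) i - t' k i)) + exp (2 * (t' k i - t' (k + 1) (i + 1))))"
    by (intro sum.cong refl) (auto simp: assms)
  show ?thesis unfolding whittaker_integrand_def 1 2 ..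
qed

lemma step_kernel_cong:
  assumes "\<And>i. i \<in> {1..Suc m} \<Longrightarrow> x i = x' i" "\<And>i. i \<in> {1..m} \<Longrightarrow> z i = z' i"
  shows "step_kernel m g x z = step_kernel m g x' z'"
proof -
  have "(\<Sum>i = 1..Suc m. x i) = (\<Sum>i = 1..Suc m. x' i)" "(\<Sum>i = 1..m. z i) = (\<Sum>i = 1..m. z' i)"
    "(\<Sum>i = 1..m. exp (2 * (x i - z i)) + exp (2 * (z i - x (Suc i)))) =
     (\<Sum>i = 1..m. exp (2 * (x' i - z' i)) + exp (2 * (z' i - x' (Suc i))))"
    by (intro sum.cong refl; simp add: assms)+
  thus ?thesis unfolding step_kernel_def by simp
qed

lemma whittaker_integrand_Suc:
  "whittaker_integrand (Suc l) \<gamma> t =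
     step_kernel (Suc l) (\<gamma> (Suc (Suc l))) (t (Suc (Suc l))) (t (Suc l)) * whittaker_integrand l \<gamma> t"
  unfolding whittaker_integrand_def step_kernel_def mult_exp_exp
  by (simp add: algebra_simps)

lemma whittaker_integrand_measurable:
  assumes t: "\<And>k i. 1 \<le> i \<Longrightarrow> i \<le> k \<Longrightarrow> k \<le> Suc l \<Longrightarrow> (\<lambda>p. t p k i) \<in> borel_measurable M"
  shows "(\<lambda>p. whittaker_integrand l \<gamma> (t p)) \<in> borel_measurable M"
proof -
  have "(\<lambda>p. of_real ((\<Sum>i = 1..k. t p k i) - (\<Sum>i = 1..k - 1. t p (k - 1) i)) :: complex) \<in> borel_measurable M"
    if "k \<in> {1..l + 1}" for k
  proof -
    have [measurable]: "(\<lambda>p. (\<Sum>i = 1..k. t p k i) - (\<Sum>i = 1..k - 1. t p (k - 1) i)) \<in> borel_measurable M"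
      using that by (intro borel_measurable_diff borel_measurable_sum t) auto
    show ?thesis by measurable
  qed
  hence 1: "(\<lambda>p. \<Sum>k = 1..l + 1. \<gamma> k * of_real ((\<Sum>i = 1..k. t p k i) - (\<Sum>i = 1..k - 1. t p (k - 1) i)) :: complex) \<in> borel_measurable M"
    by (intro borel_measurable_sum borel_measurable_times borel_measurable_const)
  have 2: "(\<lambda>p. pi * (\<Sum>k = 1..l. \<Sum>i = 1..k. exp (2 * (t p (k + 1) i - t p k i)) + exp (2 * (t p k i - t p (k + 1) (i + 1))))) \<in> borel_measurable M"
  proof (intro borel_measurable_times borel_measurable_sum borel_measurable_const)
    fix k i assume "k \<in> {1..l}" "i \<in> {1..k}"
    hence [measurable]: "(\<lambda>p. t p (k + 1) i) \<in> borel_measurable M" "(\<lambda>p. t p k i) \<in> borel_measurable M"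
      "(\<lambda>p. t p (k + 1) (i + 1)) \<in> borel_measurable M"
      by (auto intro!: t)
    show "(\<lambda>p. exp (2 * (t p (k + 1) i - t p k i)) + exp (2 * (t p k i - t p (k + 1) (i + 1)))) \<in> borel_measurable M"
      by measurable
  qed
  note [measurable] = 1 2
  show ?thesis unfolding whittaker_integrand_def by measurable
qed

abbreviation Leb_tri :: "nat \<Rightarrow> (nat \<times> nat \<Rightarrow> real) measure" where
  "Leb_tri l \<equiv> (\<Pi>\<^sub>M p \<in> tri_idx l. lborel)"

lemma finite_tri_idx [simp]: "finite (tri_idx l)"
  by (rule finite_subset[of _ "{..l} \<times> {..l}"]) (auto simp: tri_idx_def)

lemma tri_ext_integrand_measurable:
  "(\<lambda>X. whittaker_integrand l \<gamma> (tri_ext l x X)) \<in> borel_measurable (Leb_tri l)"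
proof (rule whittaker_integrand_measurable)
  fix k i :: nat assume ki: "1 \<le> i" "i \<le> k" "k \<le> Suc l"
  show "(\<lambda>X. tri_ext l x X k i) \<in> borel_measurable (Leb_tri l)"
  proof (cases "k = Suc l")
    case False
    hence "(k, i) \<in> tri_idx l" using ki by (auto simp: tri_idx_def)
    from measurable_component_singleton[OF this, of "\<lambda>_. lborel :: real measure"] False
    show ?thesis by (simp add: tri_ext_def)
  qed (simp add: tri_ext_def)
qed

text \<open>Row \<open>l + 1\<close> of the array becomes the boundary row \<open>z\<close> of the smaller array.\<close>
lemma tri_ext_split:
  assumes "x \<in> space (\<Pi>\<^sub>M p \<in> Pair (Suc l) ` {1..Suc l}. lborel :: real measure)"
  shows "whittaker_integrand (Suc l) \<gamma> (tri_ext (Suc l) x0 (merge (Pair (Suc l) ` {1..Suc l}) (tri_idx l) (x, X))) =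
    step_kernel (Suc l) (\<gamma> (Suc (Suc l))) x0 (\<lambda>i\<in>{1..Suc l}. x (Suc l, i)) *
    whittaker_integrand l \<gamma> (tri_ext l (\<lambda>i\<in>{1..Suc l}. x (Suc l, i)) X)"
  unfolding whittaker_integrand_Suc
  by (intro arg_cong2[where f = "(*)"] step_kernel_cong whittaker_integrand_cong)
     (auto simp: tri_ext_def merge_def tri_idx_def)

lemma tri_idx_Suc: "tri_idx (Suc l) = Pair (Suc l) ` {1..Suc l} \<union> tri_idx l"
  by (auto simp: tri_idx_def le_Suc_eq)

lemma tri_idx_disjoint: "Pair (Suc l) ` {1..Suc l} \<inter> tri_idx l = {}"
  by (auto simp: tri_idx_def)

lemma nn_integral_whittaker_integrand:
  "(\<integral>\<^sup>+X. ennreal (norm (whittaker_integrand l \<gamma> (tri_ext l x X))) \<partial>Leb_tri l) = givental_majorant (Suc l) \<gamma> x"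
proof (induction l arbitrary: x)
  case 0
  have "tri_idx 0 = {}" by (auto simp: tri_idx_def)
  thus ?case
    by (simp add: space_PiM whittaker_integrand_def step_kernel_def tri_ext_def)
next
  case (Suc l)
  let ?row = "Pair (Suc l) ` {1..Suc l}"
  let ?z = "\<lambda>X. \<lambda>i\<in>{1..Suc l}. X (Suc l, i)"
  have inj: "inj_on (Pair (Suc l)) {1..Suc l}" by (auto simp: inj_on_def)
  note reindex = distr_PiM_lborel_reindex[OF _ inj]
  define F where "F z = ennreal (norm (step_kernel (Suc l) (\<gamma> (Suc (Suc l))) x z)) * givental_majorant (Suc l) \<gamma> z" for z
  have [measurable]: "(\<lambda>z. step_kernel (Suc l) g x z) \<in> borel_measurable (Leb (Suc l))" for g
    by (intro step_kernel_measurable measurable_Leb_component) auto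
  note [measurable] = givental_majorant_measurable
  have Fm: "F \<in> borel_measurable (Leb (Suc l))" unfolding F_def by measurable
  have "(\<integral>\<^sup>+X. ennreal (norm (whittaker_integrand (Suc l) \<gamma> (tri_ext (Suc l) x X))) \<partial>Leb_tri (Suc l)) =
     (\<integral>\<^sup>+X1. \<integral>\<^sup>+X2. ennreal (norm (whittaker_integrand (Suc l) \<gamma> (tri_ext (Suc l) x (merge ?row (tri_idx l) (X1, X2))))) \<partial>Leb_tri l \<partial>Pi\<^sub>M ?row (\<lambda>_. lborel))"
    using tri_ext_integrand_measurable[of "Suc l" \<gamma> x] unfolding tri_idx_Suc
    by (intro lebesgue_product.product_nn_integral_fold tri_idx_disjoint) auto
  also have "\<dots> = (\<integral>\<^sup>+X1. F (?z X1) \<partial>Pi\<^sub>M ?row (\<lambda>_. lborel))"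
  proof (intro nn_integral_cong)
    fix X1 assume X1: "X1 \<in> space (Pi\<^sub>M ?row (\<lambda>_. lborel :: real measure))"
    have "(\<integral>\<^sup>+X2. ennreal (norm (whittaker_integrand (Suc l) \<gamma> (tri_ext (Suc l) x (merge ?row (tri_idx l) (X1, X2))))) \<partial>Leb_tri l) =
       (\<integral>\<^sup>+X2. ennreal (norm (step_kernel (Suc l) (\<gamma> (Suc (Suc l))) x (?z X1))) * ennreal (norm (whittaker_integrand l \<gamma> (tri_ext l (?z X1) X2))) \<partial>Leb_tri l)"
      unfolding tri_ext_split[OF X1] norm_mult by (simp add: ennreal_mult)
    also have "\<dots> = F (?z X1)"
      unfolding F_def Suc.IH[symmetric]
      using tri_ext_integrand_measurable[of l \<gamma> "?z X1"] by (intro nn_integral_cmult) simp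
    finally show "(\<integral>\<^sup>+X2. ennreal (norm (whittaker_integrand (Suc l) \<gamma> (tri_ext (Suc l) x (merge ?row (tri_idx l) (X1, X2))))) \<partial>Leb_tri l) = F (?z X1)" .
  qed
  also have "\<dots> = (\<integral>\<^sup>+z. F z \<partial>distr (Pi\<^sub>M ?row (\<lambda>_. lborel)) (Leb (Suc l)) ?z)"
    using Fm by (intro nn_integral_distr[symmetric] reindex(1)) auto
  also have "\<dots> = (\<integral>\<^sup>+z. F z \<partial>Leb (Suc l))"
    by (subst reindex(2)) auto
  also have "\<dots> = givental_majorant (Suc (Suc l)) \<gamma> x"
    by (simp only: F_def givental_majorant.simps(2)[of "Suc l"])
  finally show ?case .
qed

text \<open>
  Finiteness of the majorant makes the integrand over the whole array integrable, so that Fubini's theorem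
  splits off the last row. The hypothesis is needed at every level, as the inner integrals are again
  Whittaker functions.
\<close>
lemma whittaker_eq_givental_integral:
  assumes "\<And>m x. m \<le> Suc l \<Longrightarrow> givental_majorant m \<gamma> x < \<infinity>"
  shows "whittaker l \<gamma> x = givental_integral (Suc l) \<gamma> x"
  using assms
proof (induction l arbitrary: x)
  case 0
  have "tri_idx 0 = {}" by (auto simp: tri_idx_def)
  thus ?case
    by (simp add: whittaker_def space_PiM measure_def whittaker_integrand_def step_kernel_def tri_ext_def mult.assoc)
next
  case (Suc l)
  let ?row = "Pair (Suc l) ` {1..Suc l}"
  let ?z = "\<lambda>X. \<lambda>i\<in>{1..Suc l}. X (Suc l, i)"
  have IH: "whittaker l \<gamma> z = givental_integral (Suc l) \<gamma> z" for z using Suc.prems by (intro Suc.IH) auto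
  have inj: "inj_on (Pair (Suc l)) {1..Suc l}" by (auto simp: inj_on_def)
  note reindex = distr_PiM_lborel_reindex[OF _ inj]
  define F where "F z = step_kernel (Suc l) (\<gamma> (Suc (Suc l))) x z * givental_integral (Suc l) \<gamma> z" for z
  have [measurable]: "(\<lambda>z. step_kernel (Suc l) g x z) \<in> borel_measurable (Leb (Suc l))" for g
    by (intro step_kernel_measurable measurable_Leb_component) auto
  note [measurable] = givental_integral_measurable
  have Fm: "F \<in> borel_measurable (Leb (Suc l))" unfolding F_def by measurable
  have "integrable (Leb_tri (Suc l)) (\<lambda>X. whittaker_integrand (Suc l) \<gamma> (tri_ext (Suc l) x X))"
    using tri_ext_integrand_measurable Suc.prems[of "Suc (Suc l)" x]
    by (intro integrableI_bounded) (simp_all only: nn_integral_whittaker_integrand order_refl)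
  hence "whittaker (Suc l) \<gamma> x =
     (LINT X1|Pi\<^sub>M ?row (\<lambda>_. lborel). LINT X2|Leb_tri l. whittaker_integrand (Suc l) \<gamma> (tri_ext (Suc l) x (merge ?row (tri_idx l) (X1, X2))))"
    unfolding whittaker_def tri_idx_Suc
    by (intro lebesgue_product.product_integral_fold tri_idx_disjoint) auto
  also have "\<dots> = (LINT X1|Pi\<^sub>M ?row (\<lambda>_. lborel). F (?z X1))"
  proof (intro Bochner_Integration.integral_cong refl)
    fix X1 assume X1: "X1 \<in> space (Pi\<^sub>M ?row (\<lambda>_. lborel :: real measure))"
    show "(LINT X2|Leb_tri l. whittaker_integrand (Suc l) \<gamma> (tri_ext (Suc l) x (merge ?row (tri_idx l) (X1, X2)))) = F (?z X1)"
      unfolding tri_ext_split[OF X1] F_def IH[symmetric] whittaker_def by (rule integral_mult_right_zero)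
  qed
  also have "\<dots> = (LINT z|distr (Pi\<^sub>M ?row (\<lambda>_. lborel)) (Leb (Suc l)) ?z. F z)"
    using Fm by (intro integral_distr[symmetric] reindex(1)) auto
  also have "\<dots> = (LINT z|Leb (Suc l). F z)"
    by (subst reindex(2)) auto
  also have "\<dots> = givental_integral (Suc (Suc l)) \<gamma> x"
    by (simp only: F_def givental_integral.simps(2)[of "Suc l"])
  finally show ?case .
qed

section \<open>Triangular changes of variables\<close>

lemma measurable_PiM_fun_upd:
  assumes "finite J" "p \<notin> J" 
  shows "(\<lambda>(x, t). x(p := t)) \<in> (Pi\<^sub>M J (\<lambda>_. lborel :: real measure)) \<Otimes>\<^sub>M (lborel :: real measure) \<rightarrow>\<^sub>M Pi\<^sub>M (insert p J) (\<lambda>_. lborel)"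
  using measurable_add_dim[of p J "\<lambda>_. lborel :: real measure"] by simp

text \<open>
  Integrate over a coordinate of maximal rank first: no other component of the map depends on it, and
  in its own component it is only reflected and translated. The remaining components form a map of the same
  kind in one variable less.
\<close>
lemma nn_integral_triangular_map:
  fixes r :: "'i \<Rightarrow> nat" and h :: "'i \<Rightarrow> ('i \<Rightarrow> real) \<Rightarrow> real"
  assumes "finite I"
    and "\<And>q. q \<in> I \<Longrightarrow> h q \<in> borel_measurable (\<Pi>\<^sub>M i \<in> I. lborel)"
    and "\<And>q n n'. q \<in> I \<Longrightarrow> (\<And>p. p \<in> I \<Longrightarrow> r p < r q \<Longrightarrow> n p = n' p) \<Longrightarrow> h q n = h q n'"
    and "f \<in> borel_measurable (\<Pi>\<^sub>M i \<in> I. lborel)"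
  shows "(\<integral>\<^sup>+n. f (\<lambda>q\<in>I. h q n - n q) \<partial>(\<Pi>\<^sub>M i \<in> I. lborel)) = (\<integral>\<^sup>+n. f n \<partial>(\<Pi>\<^sub>M i \<in> I. lborel))"
  using assms
proof (induction "card I" arbitrary: I f)
  case 0
  have "I = {}" using "0.hyps" "0.prems"(1) by simp
  moreover have "integral\<^sup>N (Pi\<^sub>M ({} :: 'i set) (\<lambda>_. lborel)) f = (\<integral>\<^sup>+n. f (\<lambda>_. undefined) \<partial>Pi\<^sub>M ({} :: 'i set) (\<lambda>_. lborel :: real measure))"
    by (intro nn_integral_cong) (simp add: space_PiM)
  ultimately show ?case by (simp add: space_PiM restrict_def)
next
  case (Suc c)
  from Suc.hyps(2) have "I \<noteq> {}" by auto
  hence "Max (r ` I) \<in> r ` I" using Suc.prems(1) by (intro Max_in) auto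
  then obtain p where p: "p \<in> I" "r p = Max (r ` I)" by auto
  have pmax: "\<not> r p < r q" if "q \<in> I" for q
    using that Suc.prems(1) by (simp add: p(2) not_less)
  define J where "J = I - {p}"
  have J: "finite J" "p \<notin> J" "I = insert p J" "c = card J" "J \<subseteq> I"
    using p Suc.prems(1) Suc.hyps(2) by (auto simp: J_def)
  note fm = Suc.prems(4)[unfolded J(3)]
  note upd = measurable_PiM_fun_upd[OF J(1,2)]
  define F where "F x = (\<integral>\<^sup>+t. f (x(p := t)) \<partial>lborel)" for x
  have fupd: "(\<lambda>(x, t). f (x(p := t))) \<in> borel_measurable (Pi\<^sub>M J (\<lambda>_. lborel) \<Otimes>\<^sub>M lborel)"
    using measurable_compose[OF upd fm] by (simp add: case_prod_beta')
  have Fm: "F \<in> borel_measurable (Pi\<^sub>M J (\<lambda>_. lborel))"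
    unfolding F_def using fupd by (rule lborel.borel_measurable_nn_integral)
  have hJ: "h q \<in> borel_measurable (Pi\<^sub>M J (\<lambda>_. lborel))" if q: "q \<in> J" for q
  proof -
    have "(\<lambda>n. n(p := 0)) \<in> Pi\<^sub>M J (\<lambda>_. lborel :: real measure) \<rightarrow>\<^sub>M Pi\<^sub>M I (\<lambda>_. lborel)"
      using measurable_compose[OF measurable_Pair[OF measurable_ident_sets[OF refl] measurable_const[of 0]] upd]
      unfolding J(3) by simp
    hence "(\<lambda>n. h q (n(p := 0))) \<in> borel_measurable (Pi\<^sub>M J (\<lambda>_. lborel))"
      using q J by (intro measurable_compose[OF _ Suc.prems(2)]) auto
    moreover have "h q (n(p := 0)) = h q n" for n
      using q J pmax[of q] by (intro Suc.prems(3)) auto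
    ultimately show ?thesis by simp
  qed
  have depJ: "h q n = h q n'" if "q \<in> J" "\<And>p. p \<in> J \<Longrightarrow> r p < r q \<Longrightarrow> n p = n' p" for q n n'
    using that J pmax[of q] by (intro Suc.prems(3)) auto
  have restr: "(\<lambda>q\<in>I. h q (n(p := t)) - (n(p := t)) q) = (\<lambda>q\<in>J. h q n - n q)(p := h p n - t)" for n t
  proof (rule ext)
    fix q
    have "h q (n(p := t)) = h q n" if "q \<in> I" for q
      using that pmax[of q] by (intro Suc.prems(3)) auto
    thus "(\<lambda>q\<in>I. h q (n(p := t)) - (n(p := t)) q) q = ((\<lambda>q\<in>J. h q n - n q)(p := h p n - t)) q"
      using J p by auto
  qed
  have reflect: "(\<integral>\<^sup>+t. f (x(p := u - t)) \<partial>lborel) = F x" if x: "x \<in> space (Pi\<^sub>M J (\<lambda>_. lborel :: real measure))" for x u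
  proof -
    have [measurable]: "(\<lambda>t. f (x(p := t))) \<in> borel_measurable borel"
      using measurable_compose[OF measurable_Pair1'[OF x] fupd] by simp
    show ?thesis unfolding F_def
      by (subst (2) nn_integral_real_affine[where c = "-1" and t = u]) auto
  qed
  have Tm: "(\<lambda>n. \<lambda>q\<in>I. h q n - n q) \<in> Pi\<^sub>M I (\<lambda>_. lborel) \<rightarrow>\<^sub>M Pi\<^sub>M I (\<lambda>_. lborel :: real measure)"
  proof (rule measurable_restrict)
    fix q assume q: "q \<in> I"
    have "(\<lambda>n. n q) \<in> borel_measurable (Pi\<^sub>M I (\<lambda>_. lborel :: real measure))"
      using measurable_component_singleton[OF q, of "\<lambda>_. lborel :: real measure"] by simp
    thus "(\<lambda>n. h q n - n q) \<in> Pi\<^sub>M I (\<lambda>_. lborel) \<rightarrow>\<^sub>M (lborel :: real measure)"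
      using Suc.prems(2)[OF q] by simp
  qed
  have "(\<integral>\<^sup>+n. f (\<lambda>q\<in>I. h q n - n q) \<partial>Pi\<^sub>M I (\<lambda>_. lborel)) =
     (\<integral>\<^sup>+n. \<integral>\<^sup>+t. f (\<lambda>q\<in>I. h q (n(p := t)) - (n(p := t)) q) \<partial>lborel \<partial>Pi\<^sub>M J (\<lambda>_. lborel))"
    using measurable_compose[OF Tm Suc.prems(4)]
    unfolding J(3) by (subst lebesgue_product.product_nn_integral_insert[OF J(1,2)]) auto
  also have "\<dots> = (\<integral>\<^sup>+n. F (\<lambda>q\<in>J. h q n - n q) \<partial>Pi\<^sub>M J (\<lambda>_. lborel))"
    unfolding restr by (intro nn_integral_cong reflect) (auto simp: space_PiM)
  also have "\<dots> = (\<integral>\<^sup>+n. F n \<partial>Pi\<^sub>M J (\<lambda>_. lborel))"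
    by (intro Suc.hyps(1) J hJ depJ Fm) auto
  also have "\<dots> = (\<integral>\<^sup>+n. f n \<partial>Pi\<^sub>M I (\<lambda>_. lborel))"
    unfolding J(3) F_def by (rule lebesgue_product.product_nn_integral_insert[OF J(1,2) fm, symmetric])
  finally show ?case .
qed

lemma distr_triangular_map:
  fixes r :: "'i \<Rightarrow> nat" and h :: "'i \<Rightarrow> ('i \<Rightarrow> real) \<Rightarrow> real"
  assumes "finite I"
    and h: "\<And>q. q \<in> I \<Longrightarrow> h q \<in> borel_measurable (\<Pi>\<^sub>M i \<in> I. lborel)"
    and dep: "\<And>q n n'. q \<in> I \<Longrightarrow> (\<And>p. p \<in> I \<Longrightarrow> r p < r q \<Longrightarrow> n p = n' p) \<Longrightarrow> h q n = h q n'"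
  shows "(\<lambda>n. \<lambda>q\<in>I. h q n - n q) \<in> (\<Pi>\<^sub>M i \<in> I. lborel) \<rightarrow>\<^sub>M (\<Pi>\<^sub>M i \<in> I. lborel)"
    and "distr (\<Pi>\<^sub>M i \<in> I. lborel) (\<Pi>\<^sub>M i \<in> I. lborel) (\<lambda>n. \<lambda>q\<in>I. h q n - n q) = (\<Pi>\<^sub>M i \<in> I. lborel)"
proof -
  show T: "(\<lambda>n. \<lambda>q\<in>I. h q n - n q) \<in> (\<Pi>\<^sub>M i \<in> I. lborel) \<rightarrow>\<^sub>M (\<Pi>\<^sub>M i \<in> I. lborel)"
  proof (rule measurable_restrict)
    fix q assume q: "q \<in> I"
    have "(\<lambda>n. n q) \<in> borel_measurable (Pi\<^sub>M I (\<lambda>_. lborel :: real measure))"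
      using measurable_component_singleton[OF q, of "\<lambda>_. lborel :: real measure"] by simp
    thus "(\<lambda>n. h q n - n q) \<in> Pi\<^sub>M I (\<lambda>_. lborel) \<rightarrow>\<^sub>M (lborel :: real measure)"
      using h[OF q] by simp
  qed
  show "distr (\<Pi>\<^sub>M i \<in> I. lborel) (\<Pi>\<^sub>M i \<in> I. lborel) (\<lambda>n. \<lambda>q\<in>I. h q n - n q) = (\<Pi>\<^sub>M i \<in> I. lborel)" (is "?D = ?P")
  proof (rule measure_eqI)
    fix A assume "A \<in> sets ?D"
    hence A: "A \<in> sets ?P" by simp
    have "emeasure ?D A = (\<integral>\<^sup>+n. indicator A n \<partial>?D)" using A by simp
    also have "\<dots> = (\<integral>\<^sup>+n. indicator A (\<lambda>q\<in>I. h q n - n q) \<partial>?P)"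
      using A by (intro nn_integral_distr T) simp
    also have "\<dots> = (\<integral>\<^sup>+n. indicator A n \<partial>?P)"
      using A by (intro nn_integral_triangular_map[where r = r] assms) auto
    finally show "emeasure ?D A = emeasure ?P A" using A by simp
  qed simp
qed

section \<open>Coordinates of a quotient in the unipotent group\<close>

text \<open>
  The entries of the inverse of \<open>N_elt l n\<close> by forward substitution, as polynomials in the
  coordinates. The diagonal and the zeros above it are included, so that sums need no case distinctions.
\<close>
function unipotent_inverse :: "(nat \<times> nat \<Rightarrow> real) \<Rightarrow> nat \<Rightarrow> nat \<Rightarrow> real" where
  "unipotent_inverse n i j = (if i = j then 1 else if i < j then 0
     else - (\<Sum>k\<in>{j..<i}. n (i, k) * unipotent_inverse n k j))"
  by auto
termination by (relation "Wellfounded.measure (\<lambda>(n, i, j). i)") auto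

declare unipotent_inverse.simps [simp del]

lemma unipotent_inverse_diag [simp]: "unipotent_inverse n i i = 1"
  and unipotent_inverse_upper: "i < j \<Longrightarrow> unipotent_inverse n i j = 0"
  and unipotent_inverse_lower:
    "j < i \<Longrightarrow> unipotent_inverse n i j = - (\<Sum>k\<in>{j..<i}. n (i, k) * unipotent_inverse n k j)"
  by (simp_all add: unipotent_inverse.simps[of n i])

text \<open>
  The coordinates below the diagonal of \<open>N_elt l n0\<close> times the inverse of \<open>N_elt l n\<close>. The subtraction
  of \<open>n (i, k)\<close> comes from expanding the entry \<open>(i, j)\<close> of the inverse once.
\<close>
definition quotient_coord :: "(nat \<times> nat \<Rightarrow> real) \<Rightarrow> (nat \<times> nat \<Rightarrow> real) \<Rightarrow> nat \<times> nat \<Rightarrow> real" where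
  "quotient_coord n0 n = (\<lambda>(i, j). \<Sum>k\<in>{j..<i}. (n0 (i, k) - n (i, k)) * unipotent_inverse n k j)"

lemma N_elt_carrier [simp]: "N_elt l n \<in> carrier_mat (Suc l) (Suc l)"
  and A_elt_carrier [simp]: "A_elt l x \<in> carrier_mat (Suc l) (Suc l)"
  by (simp_all add: N_elt_def A_elt_def)

text \<open>With \<open>n0 = n\<close> all coordinates of the quotient vanish, hence this also yields the inverse itself.\<close>
lemma N_elt_times_unipotent_inverse:
  "N_elt l n0 * N_elt l (\<lambda>(i, j). unipotent_inverse n i j) = N_elt l (quotient_coord n0 n)"
proof (rule eq_matI)
  fix i j assume "i < dim_row (N_elt l (quotient_coord n0 n))" "j < dim_col (N_elt l (quotient_coord n0 n))"
  hence ij: "i < l + 1" "j < l + 1" by (simp_all add: N_elt_def)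
  define u where "u k = unipotent_inverse n (Suc k) (Suc j)" for k
  have entry: "N_elt l (\<lambda>(i, j). unipotent_inverse n i j) $$ (k, j) = u k" if "k < l + 1" for k
    using that ij by (simp add: N_elt_def u_def unipotent_inverse_upper)
  have "(N_elt l n0 * N_elt l (\<lambda>(i, j). unipotent_inverse n i j)) $$ (i, j) =
      (\<Sum>k\<in>{0..<l+1}. N_elt l n0 $$ (i, k) * N_elt l (\<lambda>(i, j). unipotent_inverse n i j) $$ (k, j))"
    using ij by (simp add: scalar_prod_def N_elt_def)
  also have "\<dots> = (\<Sum>k\<in>{0..<l+1}. (if k = i then 1 else if k < i then n0 (Suc i, Suc k) else 0) * u k)"
    using ij by (intro sum.cong) (auto simp: entry, auto simp: N_elt_def)
  also have "\<dots> = (\<Sum>k\<in>{0..<l+1}. (if k = i then u k else 0) + (if k < i then n0 (Suc i, Suc k) * u k else 0))"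
    by (intro sum.cong) auto
  also have "\<dots> = u i + (\<Sum>k\<in>{0..<l+1}. if k < i then n0 (Suc i, Suc k) * u k else 0)"
    using ij by (simp add: sum.distrib)
  also have "(\<Sum>k\<in>{0..<l+1}. if k < i then n0 (Suc i, Suc k) * u k else 0) = (\<Sum>k\<in>{j..<i}. n0 (Suc i, Suc k) * u k)"
    using ij by (intro sum.mono_neutral_cong_right) (auto simp: u_def unipotent_inverse_upper)
  finally have prod: "(N_elt l n0 * N_elt l (\<lambda>(i, j). unipotent_inverse n i j)) $$ (i, j) =
      u i + (\<Sum>k\<in>{j..<i}. n0 (Suc i, Suc k) * u k)" .
  have shift: "(\<Sum>k\<in>{Suc j..<Suc i}. f k) = (\<Sum>k\<in>{j..<i}. f (Suc k))" for f :: "nat \<Rightarrow> real"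
    by (rule sum.shift_bounds_Suc_ivl)
  have rhs: "N_elt l q $$ (i, j) = (if i = j then 1 else if j < i then q (Suc i, Suc j) else 0)" for q
    using ij by (simp add: N_elt_def)
  consider "i = j" | "i < j" | "j < i" by linarith
  thus "(N_elt l n0 * N_elt l (\<lambda>(i, j). unipotent_inverse n i j)) $$ (i, j) = N_elt l (quotient_coord n0 n) $$ (i, j)"
  proof cases
    case 1
    thus ?thesis unfolding prod rhs by (simp add: u_def)
  next
    case 2
    thus ?thesis unfolding prod rhs by (simp add: u_def unipotent_inverse_upper)
  next
    case 3
    have "u i = - (\<Sum>k\<in>{Suc j..<Suc i}. n (Suc i, k) * unipotent_inverse n k (Suc j))"
      using 3 unfolding u_def by (intro unipotent_inverse_lower) simp
    hence "u i = - (\<Sum>k\<in>{j..<i}. n (Suc i, Suc k) * u k)"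
      unfolding shift u_def .
    moreover have "quotient_coord n0 n (Suc i, Suc j) = (\<Sum>k\<in>{j..<i}. (n0 (Suc i, Suc k) - n (Suc i, Suc k)) * u k)"
      unfolding quotient_coord_def prod.case shift u_def ..
    ultimately show ?thesis unfolding prod rhs using 3
      by (simp add: left_diff_distrib sum_subtractf)
  qed
qed (simp_all add: N_elt_def)

lemma N_elt_zero: "N_elt l (\<lambda>_. 0) = 1\<^sub>m (l + 1)"
  by (rule eq_matI) (auto simp: N_elt_def)

lemma N_elt_inverse:
  "N_elt l n * N_elt l (\<lambda>(i, j). unipotent_inverse n i j) = 1\<^sub>m (l + 1)"
  "N_elt l (\<lambda>(i, j). unipotent_inverse n i j) * N_elt l n = 1\<^sub>m (l + 1)"
proof -
  have "quotient_coord n n = (\<lambda>_. 0)" by (auto simp: quotient_coord_def)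
  thus 1: "N_elt l n * N_elt l (\<lambda>(i, j). unipotent_inverse n i j) = 1\<^sub>m (l + 1)"
    by (simp add: N_elt_times_unipotent_inverse N_elt_zero)
  show "N_elt l (\<lambda>(i, j). unipotent_inverse n i j) * N_elt l n = 1\<^sub>m (l + 1)"
    by (rule mat_mult_left_right_inverse[OF _ _ 1]) auto
qed

lemma N_elt_cong: "(\<And>p. p \<in> lower_idx l \<Longrightarrow> n p = n' p) \<Longrightarrow> N_elt l n = N_elt l n'"
  by (auto simp: N_elt_def lower_idx_def intro!: cong_mat)

lemma unipotent_inverse_cong:
  "(\<And>p q. j \<le> q \<Longrightarrow> q < p \<Longrightarrow> p \<le> i \<Longrightarrow> n (p, q) = n' (p, q)) \<Longrightarrow> unipotent_inverse n i j = unipotent_inverse n' i j"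
proof (induction i rule: less_induct)
  case (less i)
  consider "i \<le> j" | "j < i" by linarith
  thus ?case
  proof cases
    case 1
    thus ?thesis by (cases "i = j") (auto simp: unipotent_inverse_upper)
  next
    case 2
    have "(\<Sum>k\<in>{j..<i}. n (i, k) * unipotent_inverse n k j) = (\<Sum>k\<in>{j..<i}. n' (i, k) * unipotent_inverse n' k j)"
      by (intro sum.cong refl arg_cong2[where f = "(*)"] less.IH less.prems) auto
    thus ?thesis using 2 by (simp add: unipotent_inverse_lower)
  qed
qed

lemma finite_lower_idx [simp]: "finite (lower_idx l)"
  by (rule finite_subset[of _ "{1..l+1} \<times> {1..l+1}"]) (auto simp: lower_idx_def)

lemma measurable_N_component: "p \<in> lower_idx l \<Longrightarrow> (\<lambda>n. n p) \<in> borel_measurable (lebesgue_N l)"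
  using measurable_component_singleton[of p "lower_idx l" "\<lambda>_. lborel :: real measure"]
  by (simp add: lebesgue_N_def)

lemma unipotent_inverse_measurable:
  "1 \<le> j \<Longrightarrow> i \<le> l + 1 \<Longrightarrow> (\<lambda>n. unipotent_inverse n i j) \<in> borel_measurable (lebesgue_N l)"
proof (induction i rule: less_induct)
  case (less i)
  consider "i \<le> j" | "j < i" by linarith
  thus ?case
  proof cases
    case 1
    thus ?thesis by (cases "i = j") (auto simp: unipotent_inverse_upper)
  next
    case 2
    have "(\<lambda>n. - (\<Sum>k\<in>{j..<i}. n (i, k) * unipotent_inverse n k j)) \<in> borel_measurable (lebesgue_N l)"
      using less.prems
      by (intro borel_measurable_uminus borel_measurable_sum borel_measurable_times less.IH measurable_N_component)
         (auto simp: lower_idx_def)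
    thus ?thesis using 2 by (simp add: unipotent_inverse_lower)
  qed
qed

text \<open>
  With \<open>i - j\<close> as the rank of \<open>(i, j)\<close>, the coordinate \<open>(i, j)\<close> of the quotient is \<open>- n (i, j)\<close> plus a
  function of coordinates closer to the diagonal. This contains both the inversion and the
  translation invariance of Haar measure on the unipotent group.
\<close>
lemma distr_quotient_coord:
  shows "(\<lambda>n. restrict (quotient_coord n0 n) (lower_idx l)) \<in> lebesgue_N l \<rightarrow>\<^sub>M lebesgue_N l"
    and "distr (lebesgue_N l) (lebesgue_N l) (\<lambda>n. restrict (quotient_coord n0 n) (lower_idx l)) = lebesgue_N l"
proof -
  define h where "h = (\<lambda>(i, j) n. n0 (i, j) + (\<Sum>k\<in>{j<..<i}. (n0 (i, k) - n (i, k)) * unipotent_inverse n k j))"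
  define r where "r = (\<lambda>(i, j). i - j :: nat)"
  have split: "quotient_coord n0 n q = h q n - n q" if q: "q \<in> lower_idx l" for q n
  proof -
    obtain i j where ij: "q = (i, j)" "j < i" using q by (auto simp: lower_idx_def)
    have "{j..<i} = insert j {j<..<i}" using ij by auto
    thus ?thesis by (simp add: ij h_def quotient_coord_def)
  qed
  have eq: "(\<lambda>n. restrict (quotient_coord n0 n) (lower_idx l)) = (\<lambda>n. \<lambda>q\<in>lower_idx l. h q n - n q)"
    by (intro ext) (simp add: split restrict_def)
  have meas: "h q \<in> borel_measurable (\<Pi>\<^sub>M p \<in> lower_idx l. lborel)" if q: "q \<in> lower_idx l" for q
  proof -
    obtain i j where ij: "q = (i, j)" "1 \<le> j" "j < i" "i \<le> l + 1" using q by (auto simp: lower_idx_def)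
    have "(\<lambda>n. n0 (i, j) + (\<Sum>k\<in>{j<..<i}. (n0 (i, k) - n (i, k)) * unipotent_inverse n k j)) \<in> borel_measurable (lebesgue_N l)"
      using ij
      by (intro borel_measurable_add borel_measurable_const borel_measurable_sum borel_measurable_times borel_measurable_diff
            unipotent_inverse_measurable measurable_N_component) (auto simp: lower_idx_def)
    thus ?thesis by (simp add: ij(1) h_def lebesgue_N_def)
  qed
  have dep: "h q n = h q n'" if q: "q \<in> lower_idx l"
    and nn': "\<And>p. p \<in> lower_idx l \<Longrightarrow> r p < r q \<Longrightarrow> n p = n' p" for q n n'
  proof -
    obtain i j where ij: "q = (i, j)" "1 \<le> j" "j < i" "i \<le> l + 1" using q by (auto simp: lower_idx_def)
    have agree: "n (p, k) = n' (p, k)" if "p - k < i - j" "1 \<le> k" "k < p" "p \<le> l + 1" for p k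
      using that by (intro nn') (auto simp: lower_idx_def r_def ij)
    have "(\<Sum>k\<in>{j<..<i}. (n0 (i, k) - n (i, k)) * unipotent_inverse n k j) =
        (\<Sum>k\<in>{j<..<i}. (n0 (i, k) - n' (i, k)) * unipotent_inverse n' k j)"
      using ij by (intro sum.cong refl arg_cong2[where f = "(*)"] arg_cong2[where f = "(-)"] unipotent_inverse_cong agree) auto
    thus ?thesis by (simp add: ij h_def)
  qed
  show "(\<lambda>n. restrict (quotient_coord n0 n) (lower_idx l)) \<in> lebesgue_N l \<rightarrow>\<^sub>M lebesgue_N l"
    and "distr (lebesgue_N l) (lebesgue_N l) (\<lambda>n. restrict (quotient_coord n0 n) (lower_idx l)) = lebesgue_N l"
    unfolding eq lebesgue_N_def
    by (intro distr_triangular_map[where r = r] finite_lower_idx meas dep; assumption)+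
qed

section \<open>The kernel on the group in triangular form\<close>

lemma mult_carrier_square [simp]:
  "A \<in> carrier_mat n n \<Longrightarrow> B \<in> carrier_mat n n \<Longrightarrow> A * B \<in> carrier_mat n n"
  by (rule mult_carrier_mat)

lemma mat_trace_comm:
  assumes "A \<in> carrier_mat n n" "B \<in> carrier_mat n n"
  shows "mat_trace (A * B) = mat_trace (B * A)"
proof -
  have "mat_trace (A * B) = (\<Sum>i<n. \<Sum>j<n. A $$ (i, j) * B $$ (j, i))"
    using assms by (simp add: mat_trace_def scalar_prod_def atLeast0LessThan)
  also have "\<dots> = (\<Sum>j<n. \<Sum>i<n. B $$ (j, i) * A $$ (i, j))"
    by (subst sum.swap) (simp add: mult.commute)
  also have "\<dots> = mat_trace (B * A)"
    using assms by (simp add: mat_trace_def scalar_prod_def atLeast0LessThan)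
  finally show ?thesis .
qed

lemma mat_trace_transpose_self:
  assumes "M \<in> carrier_mat n n"
  shows "mat_trace (transpose_mat M * M) = (\<Sum>i<n. \<Sum>j<n. (M $$ (i, j))\<^sup>2)"
proof -
  have "mat_trace (transpose_mat M * M) = (\<Sum>j<n. \<Sum>i<n. (M $$ (i, j))\<^sup>2)"
    using assms by (simp add: mat_trace_def scalar_prod_def atLeast0LessThan power2_eq_square)
  thus ?thesis by (subst sum.swap)
qed

lemma K_grpD:
  assumes "k \<in> K_grp l"
  shows "k \<in> carrier_mat (Suc l) (Suc l)" "transpose_mat k \<in> carrier_mat (Suc l) (Suc l)"
    "transpose_mat k * k = 1\<^sub>m (Suc l)" "k * transpose_mat k = 1\<^sub>m (Suc l)" "\<bar>Determinant.det k\<bar> = 1"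
    "transpose_mat k \<in> K_grp l"
proof -
  show 1: "k \<in> carrier_mat (Suc l) (Suc l)" and 3: "transpose_mat k * k = 1\<^sub>m (Suc l)"
    using assms by (simp_all add: K_grp_def)
  show 2: "transpose_mat k \<in> carrier_mat (Suc l) (Suc l)" using 1 by simp
  show 4: "k * transpose_mat k = 1\<^sub>m (Suc l)" by (rule mat_mult_left_right_inverse[OF 2 1 3])
  have "Determinant.det k * Determinant.det k = 1"
    using arg_cong[OF 3, of Determinant.det] by (simp add: det_mult[OF 2 1] det_transpose[OF 1])
  thus "\<bar>Determinant.det k\<bar> = 1" by (simp add: abs_square_eq_1[symmetric] power2_eq_square)
  show "transpose_mat k \<in> K_grp l" using 2 4 by (simp add: K_grp_def)
qed

lemma phi_Q0_biinvariant:
  assumes k1: "k1 \<in> K_grp l" and k2: "k2 \<in> K_grp l" and g: "g \<in> carrier_mat (Suc l) (Suc l)"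
  shows "phi_Q0 l lam (k1 * g * k2) = phi_Q0 l lam g"
proof -
  note k1 = K_grpD[OF k1] and k2 = K_grpD[OF k2]
  let ?n = "Suc l"
  have tg: "transpose_mat g \<in> carrier_mat ?n ?n" using g by simp
  have kg: "k1 * g \<in> carrier_mat ?n ?n" using k1 g by simp
  have det: "\<bar>Determinant.det (k1 * g * k2)\<bar> = \<bar>Determinant.det g\<bar>"
    using k1(5) k2(5) by (simp add: det_mult[OF kg k2(1)] det_mult[OF k1(1) g] abs_mult)
  have "transpose_mat (k1 * g) * (k1 * g) = transpose_mat g * (transpose_mat k1 * k1) * g"
    using k1(1) k1(2) g tg
    by (simp add: transpose_mult[OF k1(1) g] assoc_mult_mat[of _ ?n ?n _ ?n _ ?n])
  also have "\<dots> = transpose_mat g * g" using k1(3) tg by simp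
  finally have gram: "transpose_mat (k1 * g) * (k1 * g) = transpose_mat g * g" .
  have "transpose_mat (k1 * g * k2) * (k1 * g * k2) = transpose_mat k2 * ((transpose_mat (k1 * g) * (k1 * g)) * k2)"
    using kg k2(1,2) by (simp add: transpose_mult[OF kg k2(1)] assoc_mult_mat[of _ ?n ?n _ ?n _ ?n])
  also have "mat_trace \<dots> = mat_trace (((transpose_mat (k1 * g) * (k1 * g)) * k2) * transpose_mat k2)"
    using kg k2 by (intro mat_trace_comm[of _ ?n]) auto
  also have "((transpose_mat (k1 * g) * (k1 * g)) * k2) * transpose_mat k2 = transpose_mat (k1 * g) * (k1 * g)"
    using kg k2(1,2,4) by (simp add: assoc_mult_mat[of _ ?n ?n _ ?n _ ?n] right_mult_one_mat[OF kg])
  finally have "mat_trace (transpose_mat (k1 * g * k2) * (k1 * g * k2)) = mat_trace (transpose_mat g * g)"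
    unfolding gram .
  thus ?thesis unfolding phi_Q0_def det by simp
qed

lemma the_mat_inverse_eq:
  fixes M B :: "real mat"
  assumes M: "M \<in> carrier_mat n n" and B: "B \<in> carrier_mat n n" and MB: "M * B = 1\<^sub>m n"
  shows "the (mat_inverse M) = B"
proof -
  have BM: "B * M = 1\<^sub>m n" by (rule mat_mult_left_right_inverse[OF M B MB])
  have "mat_inverse M \<noteq> None"
  proof
    assume "mat_inverse M = None"
    from mat_inverse(1)[OF M this, of undefined] have "M \<notin> Units (ring_mat TYPE(real) n undefined)" .
    moreover have "M \<in> Units (ring_mat TYPE(real) n undefined)"
      unfolding Units_def ring_mat_def using M B MB BM by auto
    ultimately show False by blast
  qed
  then obtain C where C: "mat_inverse M = Some C" by blast
  from mat_inverse(2)[OF M C] have C': "M * C = 1\<^sub>m n" "C \<in> carrier_mat n n" by auto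
  have "B = B * (M * C)" using B C' by simp
  also have "\<dots> = (B * M) * C" by (rule assoc_mult_mat[OF B M C'(2), symmetric])
  also have "\<dots> = C" using BM C' by simp
  finally show ?thesis using C by simp
qed

lemma A_elt_inverse: "A_elt l y * A_elt l (\<lambda>i. - y i) = 1\<^sub>m (Suc l)"
  unfolding A_elt_def mat_diag_diag by (simp add: exp_minus)

text \<open>The outer factors lie in \<open>K\<close>, so a biinvariant function sees only the triangular matrix in the middle.\<close>
lemma iwasawa_quotient:
  assumes k0: "k0 \<in> K_grp l" and k: "k \<in> K_grp l"
  shows "(k0 * A_elt l x * N_elt l n0) * the (mat_inverse (k * A_elt l y * N_elt l n)) =
     k0 * (A_elt l x * N_elt l (quotient_coord n0 n) * A_elt l (\<lambda>i. - y i)) * transpose_mat k"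
proof -
  let ?m = "Suc l" and ?Ni = "N_elt l (\<lambda>(i, j). unipotent_inverse n i j)" and ?Ai = "A_elt l (\<lambda>i. - y i)"
  note k0 = K_grpD[OF k0] and k = K_grpD[OF k]
  note assoc = assoc_mult_mat[of _ ?m ?m _ ?m _ ?m]
  have cancel: "X * (Y * Z) = Z" if "X * Y = 1\<^sub>m ?m" "X \<in> carrier_mat ?m ?m" "Y \<in> carrier_mat ?m ?m" "Z \<in> carrier_mat ?m ?m"
    for X Y Z :: "real mat"
    using that by (simp add: assoc[symmetric] del: assoc_mult_mat)
  have Ninv: "N_elt l n * ?Ni = 1\<^sub>m ?m" using N_elt_inverse(1) by simp
  have inv: "the (mat_inverse (k * A_elt l y * N_elt l n)) = ?Ni * ?Ai * transpose_mat k"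
  proof (rule the_mat_inverse_eq[of _ ?m])
    show "k * A_elt l y * N_elt l n \<in> carrier_mat ?m ?m" "?Ni * ?Ai * transpose_mat k \<in> carrier_mat ?m ?m"
      using k(1,2) by auto
    show "k * A_elt l y * N_elt l n * (?Ni * ?Ai * transpose_mat k) = 1\<^sub>m ?m"
      using k(1,2,4) by (simp add: assoc cancel[OF Ninv] cancel[OF A_elt_inverse])
  qed
  show ?thesis unfolding inv N_elt_times_unipotent_inverse[symmetric]
    using k0(1) k(2) by (simp add: assoc)
qed

lemma sum_square_split:
  fixes f :: "nat \<Rightarrow> nat \<Rightarrow> real"
  assumes "\<And>i j. i < j \<Longrightarrow> f i j = 0"
  shows "(\<Sum>i<Suc l. \<Sum>j<Suc l. f (Suc i) (Suc j)) = (\<Sum>i = 1..Suc l. f i i) + (\<Sum>(i, j)\<in>lower_idx l. f i j)"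
proof -
  have "(\<Sum>i<Suc l. \<Sum>j<Suc l. f (Suc i) (Suc j)) = (\<Sum>i = 1..Suc l. \<Sum>j = 1..Suc l. f i j)"
    by (simp only: lessThan_Suc_atMost atMost_atLeast0 One_nat_def sum.shift_bounds_cl_Suc_ivl)
  also have "\<dots> = (\<Sum>(i, j)\<in>{1..Suc l} \<times> {1..Suc l}. f i j)"
    by (rule sum.cartesian_product)
  also have "\<dots> = (\<Sum>(i, j)\<in>(\<lambda>i. (i, i)) ` {1..Suc l} \<union> lower_idx l. f i j)"
  proof (rule sum.mono_neutral_right)
    show "\<forall>p\<in>{1..Suc l} \<times> {1..Suc l} - ((\<lambda>i. (i, i)) ` {1..Suc l} \<union> lower_idx l). (case p of (i, j) \<Rightarrow> f i j) = 0"
    proof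
      fix p assume p: "p \<in> {1..Suc l} \<times> {1..Suc l} - ((\<lambda>i. (i, i)) ` {1..Suc l} \<union> lower_idx l)"
      obtain i j where ij: "p = (i, j)" by (cases p)
      have "i < j" using p unfolding ij by (cases i j rule: linorder_cases) (auto simp: lower_idx_def)
      thus "(case p of (i, j) \<Rightarrow> f i j) = 0" by (simp add: ij assms)
    qed
  qed (auto simp: lower_idx_def)
  also have "\<dots> = (\<Sum>(i, j)\<in>(\<lambda>i. (i, i)) ` {1..Suc l}. f i j) + (\<Sum>(i, j)\<in>lower_idx l. f i j)"
    by (rule sum.union_disjoint, simp, rule finite_lower_idx, auto simp: lower_idx_def)
  also have "(\<Sum>(i, j)\<in>(\<lambda>i. (i, i)) ` {1..Suc l}. f i j) = (\<Sum>i = 1..Suc l. f i i)"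
    by (subst sum.reindex) (auto simp: inj_on_def)
  finally show ?thesis .
qed

lemma phi_Q0_triangular:
  "phi_Q0 l lam (A_elt l x * N_elt l m * A_elt l (\<lambda>i. - y i)) =
     2 ^ Suc l * exp ((\<i> * lam + of_nat l / 2) * of_real ((\<Sum>i = 1..Suc l. x i) - (\<Sum>i = 1..Suc l. y i))) *
     of_real (exp (- pi * ((\<Sum>i = 1..Suc l. exp (2 * (x i - y i))) +
        (\<Sum>(i, j)\<in>lower_idx l. (exp (x i - y j) * m (i, j))\<^sup>2))))"
proof -
  define T where "T = A_elt l x * N_elt l m * A_elt l (\<lambda>i. - y i)"
  define f where "f i j = (if i = j then exp (x i - y j) else if j < i then exp (x i - y j) * m (i, j) else 0)" for i j
  have T: "T \<in> carrier_mat (Suc l) (Suc l)" by (simp add: T_def)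
  have entry: "T $$ (i, j) = f (Suc i) (Suc j)" if "i < Suc l" "j < Suc l" for i j
  proof -
    have "A_elt l x * N_elt l m = mat (Suc l) (Suc l) (\<lambda>(i, j). exp (x (Suc i)) * N_elt l m $$ (i, j))"
      unfolding A_elt_def using mat_diag_mult_left[of "N_elt l m" "Suc l" "Suc l"] by simp
    hence "T = mat (Suc l) (Suc l) (\<lambda>(i, j). (exp (x (Suc i)) * N_elt l m $$ (i, j)) * exp (- y (Suc j)))"
      unfolding T_def A_elt_def
      using mat_diag_mult_right[of "mat (Suc l) (Suc l) (\<lambda>(i, j). exp (x (Suc i)) * N_elt l m $$ (i, j))" "Suc l" "Suc l" "\<lambda>i. exp (- y (Suc i))"]
      by (auto intro!: eq_matI)
    thus ?thesis using that by (auto simp: N_elt_def f_def exp_diff exp_minus divide_inverse)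
  qed
  have "Determinant.det T = prod_list (diag_mat T)"
    by (rule det_lower_triangular[of "Suc l"]) (auto simp: entry f_def T)
  also have "\<dots> = (\<Prod>i<Suc l. f (Suc i) (Suc i))"
    unfolding prod_list_diag_prod using T by (intro prod.cong) (auto simp: entry)
  also have "\<dots> = exp (\<Sum>i<Suc l. x (Suc i) - y (Suc i))"
    by (simp add: f_def exp_sum del: sum.lessThan_Suc prod.lessThan_Suc)
  also have "(\<Sum>i<Suc l. x (Suc i) - y (Suc i)) = (\<Sum>i = 1..Suc l. x i) - (\<Sum>i = 1..Suc l. y i)"
    unfolding sum_subtractf[symmetric]
    by (simp only: lessThan_Suc_atMost atMost_atLeast0 One_nat_def sum.shift_bounds_cl_Suc_ivl)
  finally have det: "Determinant.det T = exp ((\<Sum>i = 1..Suc l. x i) - (\<Sum>i = 1..Suc l. y i))" .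
  have "mat_trace (transpose_mat T * T) = (\<Sum>i<Suc l. \<Sum>j<Suc l. (f (Suc i) (Suc j))\<^sup>2)"
    unfolding mat_trace_transpose_self[OF T] by (intro sum.cong refl) (simp add: entry)
  also have "\<dots> = (\<Sum>i = 1..Suc l. (f i i)\<^sup>2) + (\<Sum>(i, j)\<in>lower_idx l. (f i j)\<^sup>2)"
    by (rule sum_square_split) (simp add: f_def)
  also have "(\<Sum>i = 1..Suc l. (f i i)\<^sup>2) = (\<Sum>i = 1..Suc l. exp (2 * (x i - y i)))"
    by (intro sum.cong) (auto simp: f_def power2_eq_square exp_add[symmetric])
  also have "(\<Sum>(i, j)\<in>lower_idx l. (f i j)\<^sup>2) = (\<Sum>(i, j)\<in>lower_idx l. (exp (x i - y j) * m (i, j))\<^sup>2)"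
    by (intro sum.cong) (auto simp: f_def lower_idx_def)
  finally have trace: "mat_trace (transpose_mat T * T) = (\<Sum>i = 1..Suc l. exp (2 * (x i - y i))) +
      (\<Sum>(i, j)\<in>lower_idx l. (exp (x i - y j) * m (i, j))\<^sup>2)" .
  show ?thesis unfolding T_def[symmetric] phi_Q0_def trace det
    by (simp add: powr_def Ln_of_real del: sum.cl_ivl_Suc of_real_diff)
qed

section \<open>Existence of the Iwasawa decomposition\<close>

text \<open>
  Gram-Schmidt orthonormalisation from the last column to the first: column \<open>d\<close> is
  corrected by later columns only, and so the matrix \<open>p\<close> of the column operations stays lower triangular. The
  corrected column \<open>v\<close> does not vanish because \<open>w d = p d d\<close> is nonzero and \<open>G\<close> is injective.
\<close>
lemma triangular_orthonormalization:
  fixes G :: "nat \<Rightarrow> nat \<Rightarrow> real"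
  assumes inj: "\<forall>w. (\<forall>i<m. (\<Sum>k<m. G i k * w k) = 0) \<longrightarrow> (\<forall>k<m. w k = 0)"
  shows "c \<le> m \<Longrightarrow> \<exists>p. (\<forall>j<m. p j j > 0 \<and> (\<forall>k<j. p k j = 0)) \<and>
     (\<forall>a\<in>{m-c..<m}. \<forall>b\<in>{m-c..<m}.
        (\<Sum>i<m. (\<Sum>k<m. G i k * p k a) * (\<Sum>k<m. G i k * p k b)) = (if a = b then 1 else 0))"
proof (induction c)
  case 0
  show ?case by (intro exI[of _ "\<lambda>k j. if k = j then 1 else 0"]) auto
next
  case (Suc c)
  hence "c \<le> m" by simp
  from Suc.IH[OF this] obtain p where p: "\<forall>j<m. p j j > 0 \<and> (\<forall>k<j. p k j = 0)"
    and orth: "\<forall>a\<in>{m-c..<m}. \<forall>b\<in>{m-c..<m}.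
        (\<Sum>i<m. (\<Sum>k<m. G i k * p k a) * (\<Sum>k<m. G i k * p k b)) = (if a = b then 1 else 0)"
    by blast
  have pos: "p j j > 0" and low: "k < j \<Longrightarrow> p k j = 0" if "j < m" for j k using p that by auto
  define d where "d = m - Suc c"
  have d: "d < m" "m - c = Suc d" "m - Suc c = d" using Suc.prems by (auto simp: d_def)
  define M where "M i j = (\<Sum>k<m. G i k * p k j)" for i j
  define ip where "ip b = (\<Sum>i<m. M i d * M i b)" for b
  \<comment> \<open>coefficients of the corrected column \<open>v\<close>; the later columns of \<open>M\<close> are already orthonormal\<close>
  define w where "w k = p k d - (\<Sum>b\<in>{Suc d..<m}. ip b * p k b)" for k
  define v where "v i = (\<Sum>k<m. G i k * w k)" for i
  define R where "R = (\<Sum>i<m. (v i)\<^sup>2)"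
  define p' where "p' k j = (if j = d then w k / sqrt R else p k j)" for k j
  have v: "v i = M i d - (\<Sum>b\<in>{Suc d..<m}. ip b * M i b)" for i
  proof -
    have "v i = M i d - (\<Sum>k<m. \<Sum>b\<in>{Suc d..<m}. ip b * (G i k * p k b))"
      by (simp add: v_def w_def M_def right_diff_distrib sum_subtractf sum_distrib_left mult_ac)
    also have "(\<Sum>k<m. \<Sum>b\<in>{Suc d..<m}. ip b * (G i k * p k b)) = (\<Sum>b\<in>{Suc d..<m}. ip b * M i b)"
      by (subst sum.swap) (simp add: M_def sum_distrib_left)
    finally show ?thesis .
  qed
  have wd: "w d = p d d" by (simp add: w_def low)
  have wlow: "w k = 0" if "k < d" for k
    using that d low[of d k] low[of _ k] by (simp add: w_def)
  have vorth: "(\<Sum>i<m. v i * M i b) = 0" if b: "b \<in> {Suc d..<m}" for b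
  proof -
    have "(\<Sum>i<m. v i * M i b) = ip b - (\<Sum>i<m. \<Sum>b'\<in>{Suc d..<m}. ip b' * (M i b' * M i b))"
      unfolding v left_diff_distrib sum_subtractf sum_distrib_right ip_def[of b] by (simp add: mult.assoc)
    also have "(\<Sum>i<m. \<Sum>b'\<in>{Suc d..<m}. ip b' * (M i b' * M i b)) = (\<Sum>b'\<in>{Suc d..<m}. ip b' * (\<Sum>i<m. M i b' * M i b))"
      by (subst sum.swap) (simp add: sum_distrib_left)
    also have "\<dots> = (\<Sum>b'\<in>{Suc d..<m}. if b' = b then ip b' else 0)"
      using orth b unfolding d(2) M_def by (intro sum.cong) auto
    also have "\<dots> = ip b" using b by simp
    finally show ?thesis by simp
  qed
  have R: "R > 0"
  proof (rule ccontr)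
    assume "\<not> R > 0"
    moreover have "R \<ge> 0" unfolding R_def by (intro sum_nonneg) auto
    ultimately have "R = 0" by linarith
    hence "\<forall>i<m. v i = 0" unfolding R_def by (subst (asm) sum_nonneg_eq_0_iff) auto
    hence "w d = 0" using inj[rule_format, of w d] d by (simp add: v_def)
    thus False using pos[OF d(1)] wd by simp
  qed
  have M': "(\<Sum>k<m. G i k * p' k j) = (if j = d then v i / sqrt R else M i j)" for i j
    by (simp add: p'_def v_def M_def sum_divide_distrib)
  have "(\<Sum>i<m. (\<Sum>k<m. G i k * p' k a) * (\<Sum>k<m. G i k * p' k b)) = (if a = b then 1 else 0)"
    if ab: "a \<in> {d..<m}" "b \<in> {d..<m}" for a b
  proof -
    have mixed: "(\<Sum>i<m. v i / sqrt R * M i b) = 0" if "b \<in> {Suc d..<m}" for b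
      using vorth[OF that] by (simp add: sum_divide_distrib[symmetric])
    have unit: "(\<Sum>i<m. v i / sqrt R * (v i / sqrt R)) = 1"
    proof -
      have "(\<Sum>i<m. v i / sqrt R * (v i / sqrt R)) = (\<Sum>i<m. (v i)\<^sup>2) / R"
        using R by (simp add: sum_divide_distrib power2_eq_square)
      thus ?thesis using R by (simp add: R_def[symmetric])
    qed
    consider "a = d" "b = d" | "a = d" "b \<in> {Suc d..<m}" | "a \<in> {Suc d..<m}" "b = d"
      | "a \<in> {Suc d..<m}" "b \<in> {Suc d..<m}"
      using ab by force
    thus ?thesis
    proof cases
      case 1
      thus ?thesis unfolding M' using unit by simp
    next
      case 2
      thus ?thesis unfolding M' using mixed[of b] by simp
    next
      case 3
      thus ?thesis unfolding M' using mixed[of a] by (simp add: mult.commute)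
    next
      case 4
      thus ?thesis unfolding M' using orth[unfolded d(2), rule_format, of a b] by (simp add: M_def)
    qed
  qed
  moreover have "p' j j > 0" if "j < m" for j
    using that pos R d by (auto simp: p'_def wd)
  moreover have "p' k j = 0" if "j < m" "k < j" for j k
    using that low wlow by (auto simp: p'_def)
  ultimately show ?case unfolding d(3) by (intro exI[of _ p'] conjI ballI allI impI) blast+
qed

text \<open>
  The orthonormalised matrix is \<open>g P\<close> with \<open>P\<close> lower triangular with positive diagonal. As
  \<open>P\<close> is a unipotent matrix times a diagonal one, its inverse has the order \<open>a n\<close> required here.
\<close>
theorem iwasawa_decomposition:
  assumes g: "g \<in> GL l"
  obtains k x n where "k \<in> K_grp l" "g = k * A_elt l x * N_elt l n"
proof -
  define m where "m = Suc l"
  have gc: "g \<in> carrier_mat m m" and det: "Determinant.det g \<noteq> 0" using g by (simp_all add: GL_def m_def)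
  have indep: "\<forall>w. (\<forall>i<m. (\<Sum>k<m. g $$ (i, k) * w k) = 0) \<longrightarrow> (\<forall>k<m. w k = 0)"
  proof (intro allI impI, rule ccontr)
    fix w :: "nat \<Rightarrow> real" and k
    assume w: "\<forall>i<m. (\<Sum>k<m. g $$ (i, k) * w k) = 0" and k: "k < m"
    assume "w k \<noteq> 0"
    hence "vec m w \<noteq> 0\<^sub>v m" using k by (metis index_vec index_zero_vec(1))
    moreover have "g *\<^sub>v vec m w = 0\<^sub>v m"
      using w gc by (intro eq_vecI) (auto simp: scalar_prod_def atLeast0LessThan)
    ultimately show False using det det_0_iff_vec_prod_zero[OF gc] by (metis vec_carrier)
  qed
  have "\<exists>p. (\<forall>j<m. p j j > 0 \<and> (\<forall>k<j. p k j = 0)) \<and>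
     (\<forall>a\<in>{m-m..<m}. \<forall>b\<in>{m-m..<m}.
        (\<Sum>i<m. (\<Sum>k<m. g $$ (i, k) * p k a) * (\<Sum>k<m. g $$ (i, k) * p k b)) = (if a = b then 1 else 0))"
    by (rule triangular_orthonormalization[OF indep]) simp
  then obtain p where p: "\<forall>j<m. p j j > 0 \<and> (\<forall>k<j. p k j = 0)"
    and orth': "\<forall>a\<in>{m-m..<m}. \<forall>b\<in>{m-m..<m}.
        (\<Sum>i<m. (\<Sum>k<m. g $$ (i, k) * p k a) * (\<Sum>k<m. g $$ (i, k) * p k b)) = (if a = b then 1 else 0)"
    by blast
  have pos: "p j j > 0" and low: "k < j \<Longrightarrow> p k j = 0" if "j < m" for j k using p that by auto
  have orth: "(\<Sum>i<m. (\<Sum>k<m. g $$ (i, k) * p k a) * (\<Sum>k<m. g $$ (i, k) * p k b)) = (if a = b then 1 else 0)"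
    if "a < m" "b < m" for a b using orth' that by simp
  define u where "u = (\<lambda>(i, j). p (i - 1) (j - 1) / p (j - 1) (j - 1))"
  define x where "x i = - ln (p (i - 1) (i - 1))" for i
  define P where "P = N_elt l u * A_elt l (\<lambda>i. - x i)"
  define k where "k = g * P"
  have P: "P \<in> carrier_mat m m" by (simp add: P_def m_def)
  have Pentry: "P $$ (i, j) = p i j" if ij: "i < m" "j < m" for i j
  proof -
    have "P $$ (i, j) = N_elt l u $$ (i, j) * exp (- x (Suc j))"
      unfolding P_def A_elt_def using ij mat_diag_mult_right[of "N_elt l u" "Suc l" "Suc l"] by (simp add: m_def)
    also have "\<dots> = p i j"
      using ij pos[of j] low[of j i] by (auto simp: N_elt_def m_def u_def x_def)
    finally show ?thesis .
  qed
  have kentry: "k $$ (i, j) = (\<Sum>q<m. g $$ (i, q) * p q j)" if "i < m" "j < m" for i j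
    using that gc P by (simp add: k_def scalar_prod_def atLeast0LessThan Pentry)
  have kc: "k \<in> carrier_mat m m" using gc P by (simp add: k_def)
  have "transpose_mat k * k = 1\<^sub>m m"
    using kc by (intro eq_matI) (auto simp: scalar_prod_def atLeast0LessThan kentry orth)
  hence "k \<in> K_grp l" using kc by (simp add: K_grp_def m_def)
  moreover have "g = k * A_elt l x * N_elt l (\<lambda>(i, j). unipotent_inverse u i j)"
  proof -
    let ?Ni = "N_elt l (\<lambda>(i, j). unipotent_inverse u i j)"
    have "A_elt l (\<lambda>i. - x i) * A_elt l x = 1\<^sub>m m"
      using A_elt_inverse[of l "\<lambda>i. - x i"] by (simp add: m_def)
    hence "A_elt l (\<lambda>i. - x i) * (A_elt l x * ?Ni) = ?Ni"
      by (subst assoc_mult_mat[of _ m m _ m _ m, symmetric]) (auto simp: m_def left_mult_one_mat[OF N_elt_carrier])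
    moreover have "N_elt l u * ?Ni = 1\<^sub>m m" using N_elt_inverse(1) by (simp add: m_def)
    ultimately have "P * (A_elt l x * ?Ni) = 1\<^sub>m m"
      unfolding P_def by (subst assoc_mult_mat[of _ m m _ m _ m]) (auto simp: m_def)
    hence "g * (P * (A_elt l x * ?Ni)) = g" using gc by simp
    thus ?thesis using gc P unfolding k_def
      by (simp add: assoc_mult_mat[of _ m m _ m _ m] m_def)
  qed
  ultimately show ?thesis using that by blast
qed

section \<open>Integration over the unipotent group\<close>

text \<open>
  The factor of the integrand that depends on the quotient \<open>m\<close>. The exponential is the inverse of the
  character \<open>chi_N\<close> at \<open>m\<close>.
\<close>
definition phase_kernel :: "nat \<Rightarrow> complex \<Rightarrow> (nat \<Rightarrow> real) \<Rightarrow> (nat \<Rightarrow> real) \<Rightarrow> (nat \<times> nat \<Rightarrow> real) \<Rightarrow> complex" where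
  "phase_kernel l lam x y m =
     phi_Q0 l lam (A_elt l x * N_elt l m * A_elt l (\<lambda>i. - y i)) * exp (- (2 * of_real pi * \<i> * of_real (\<Sum>i = 1..l. m (i + 1, i))))"

text \<open>The restriction keeps the values in the space of the product measure \<open>lebesgue_N\<close>.\<close>
definition unipotent_quotient :: "nat \<Rightarrow> (nat \<times> nat \<Rightarrow> real) \<Rightarrow> (nat \<times> nat \<Rightarrow> real) \<Rightarrow> nat \<times> nat \<Rightarrow> real" where
  "unipotent_quotient l n0 n = restrict (quotient_coord n0 n) (lower_idx l)"

text \<open>
  The character is additive on the subdiagonal, where the quotient has the coordinates \<open>n0 - n\<close>. This splits
  \<open>chi_N l n\<close> into \<open>chi_N l n0\<close> and a function of the quotient.
\<close>
lemma conv_integrand_iwasawa: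
  assumes f: "equivariant l f" and k0: "k0 \<in> K_grp l" and k: "k \<in> K_grp l"
  shows "conv_integrand l (phi_Q0 l lam) f (k0 * A_elt l x * N_elt l n0) (k, y, n) =
     chi_N l n0 * (phase_kernel l lam x y (unipotent_quotient l n0 n) * f (A_elt l y))"
proof -
  define m where "m = unipotent_quotient l n0 n"
  have Nm: "N_elt l (quotient_coord n0 n) = N_elt l m"
    by (rule N_elt_cong) (simp add: m_def unipotent_quotient_def)
  have "m (i + 1, i) = n0 (i + 1, i) - n (i + 1, i)" if "i \<in> {1..l}" for i
    using that by (simp add: m_def unipotent_quotient_def quotient_coord_def lower_idx_def)
  hence "(\<Sum>i = 1..l. m (i + 1, i)) = (\<Sum>i = 1..l. n0 (i + 1, i)) - (\<Sum>i = 1..l. n (i + 1, i))"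
    unfolding sum_subtractf[symmetric] by (rule sum.cong[OF refl])
  hence chi: "chi_N l n = chi_N l n0 * exp (- (2 * of_real pi * \<i> * of_real (\<Sum>i = 1..l. m (i + 1, i))))"
    by (simp only: chi_N_def mult_exp_exp) (simp add: algebra_simps)
  have phi: "phi_Q0 l lam ((k0 * A_elt l x * N_elt l n0) * the (mat_inverse (k * A_elt l y * N_elt l n))) =
      phi_Q0 l lam (A_elt l x * N_elt l m * A_elt l (\<lambda>i. - y i))"
    unfolding iwasawa_quotient[OF k0 k] Nm
    by (rule phi_Q0_biinvariant[OF k0 K_grpD(6)[OF k]]) simp
  have "f (k * A_elt l y * N_elt l n) = chi_N l n * f (A_elt l y)"
    using f k by (auto simp: equivariant_def)
  thus ?thesis
    unfolding conv_integrand_def iwasawa_def prod.case phi chi phase_kernel_def m_def[symmetric] by simp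
qed

lemma sum_lower_idx_first: "(\<Sum>(i, j)\<in>lower_idx l. h i) = (\<Sum>i = 1..Suc l. real (i - 1) * h i)" for h :: "nat \<Rightarrow> real"
proof -
  have "lower_idx l = Sigma {1..Suc l} (\<lambda>i. {1..<i})" by (auto simp: lower_idx_def)
  moreover have "(\<Sum>(i, j)\<in>Sigma {1..Suc l} (\<lambda>i. {1..<i}). h i) = (\<Sum>i = 1..Suc l. \<Sum>j\<in>{1..<i}. h i)"
    by (rule sum.Sigma[symmetric]) auto
  ultimately have "(\<Sum>(i, j)\<in>lower_idx l. h i) = (\<Sum>i = 1..Suc l. \<Sum>j\<in>{1..<i}. h i)" by simp
  also have "\<dots> = (\<Sum>i = 1..Suc l. real (i - 1) * h i)" by (intro sum.cong) auto
  finally show ?thesis .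
qed

lemma sum_lower_idx_subdiagonal:
  "(\<Sum>(i, j)\<in>lower_idx l. if i = Suc j then h i j else 0) = (\<Sum>j = 1..l. h (Suc j) j)" for h :: "nat \<Rightarrow> nat \<Rightarrow> real"
proof -
  have "(\<Sum>(i, j)\<in>lower_idx l. if i = Suc j then h i j else 0) = (\<Sum>(i, j)\<in>(\<lambda>j. (Suc j, j)) ` {1..l}. h i j)"
    by (rule sum.mono_neutral_cong_right[OF finite_lower_idx]) (auto simp: lower_idx_def)
  also have "\<dots> = (\<Sum>j = 1..l. h (Suc j) j)"
    by (subst sum.reindex) (auto simp: inj_on_def)
  finally show ?thesis .
qed

text \<open>The part of the kernel that remains when all entries below the diagonal are zero.\<close>
definition torus_weight :: "nat \<Rightarrow> complex \<Rightarrow> (nat \<Rightarrow> real) \<Rightarrow> (nat \<Rightarrow> real) \<Rightarrow> complex" where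
  "torus_weight l lam x y = 2 ^ Suc l *
     exp ((\<i> * lam + of_nat l / 2) * of_real ((\<Sum>i = 1..Suc l. x i) - (\<Sum>i = 1..Suc l. y i))) *
     of_real (exp (- pi * (\<Sum>i = 1..Suc l. exp (2 * (x i - y i)))))"

lemma phase_kernel_product:
  "phase_kernel l lam x y m = torus_weight l lam x y *
     (\<Prod>(i, j)\<in>lower_idx l. of_real (exp (- pi * (exp (x i - y j) * m (i, j))\<^sup>2)) *
        exp (\<i> * of_real (2 * pi * (if i = Suc j then -1 else 0) * m (i, j))))"
proof -
  have 1: "exp (- (2 * of_real pi * \<i> * of_real (\<Sum>i = 1..l. m (i + 1, i)))) =
      (\<Prod>(i, j)\<in>lower_idx l. exp (\<i> * of_real (2 * pi * (if i = Suc j then -1 else 0) * m (i, j))))"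
  proof -
    have sub: "(\<Sum>i = 1..l. m (i + 1, i)) = (\<Sum>(i, j)\<in>lower_idx l. if i = Suc j then m (i, j) else 0)"
      by (subst sum_lower_idx_subdiagonal) simp
    have "- (2 * of_real pi * \<i> * of_real (\<Sum>i = 1..l. m (i + 1, i))) =
        (- (2 * of_real pi * \<i>)) * of_real (\<Sum>(i, j)\<in>lower_idx l. if i = Suc j then m (i, j) else 0)"
      unfolding sub by (rule mult_minus_left[symmetric])
    also have "\<dots> = (\<Sum>(i, j)\<in>lower_idx l. \<i> * of_real (2 * pi * (if i = Suc j then -1 else 0) * m (i, j)))"
      unfolding of_real_sum sum_distrib_left
    proof (rule sum.cong[OF refl])
      fix p assume "p \<in> lower_idx l"
      obtain i j where "p = (i, j)" by (cases p)
      thus "(- (2 * of_real pi * \<i>)) * of_real (case p of (i, j) \<Rightarrow> if i = Suc j then m (i, j) else 0) =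
          (case p of (i, j) \<Rightarrow> \<i> * of_real (2 * pi * (if i = Suc j then -1 else 0) * m (i, j)))"
        by (cases "i = Suc j") simp_all
    qed
    finally have "- (2 * of_real pi * \<i> * of_real (\<Sum>i = 1..l. m (i + 1, i))) =
        (\<Sum>(i, j)\<in>lower_idx l. \<i> * of_real (2 * pi * (if i = Suc j then -1 else 0) * m (i, j)))" .
    thus ?thesis by (simp only: case_prod_beta' exp_sum finite_lower_idx)
  qed
  have 2: "exp (- pi * (D + (\<Sum>(i, j)\<in>lower_idx l. (exp (x i - y j) * m (i, j))\<^sup>2))) =
      exp (- pi * D) * (\<Prod>(i, j)\<in>lower_idx l. exp (- pi * (exp (x i - y j) * m (i, j))\<^sup>2))" for D
    by (simp only: distrib_left exp_add case_prod_beta' sum_distrib_left exp_sum finite_lower_idx)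
  show ?thesis
    unfolding phase_kernel_def phi_Q0_triangular torus_weight_def 1 2
    by (simp add: case_prod_beta' prod.distrib)
qed

lemma gaussian_nn_integral:
  fixes c :: real
  assumes c: "c > 0"
  shows "(\<integral>\<^sup>+u. ennreal (exp (- pi * (c * u)\<^sup>2)) \<partial>lborel) = ennreal (1 / c)"
proof -
  define F where "F u = exp (- pi * (c * u)\<^sup>2)" for u
  have F: "(\<lambda>u. of_real (exp (- pi * (c * u)\<^sup>2)) * exp (\<i> * of_real (2 * pi * 0 * u))) = (\<lambda>u. complex_of_real (F u))"
    by (simp add: F_def)
  note * = gaussian_fourier_integral[OF c, of 0, unfolded F]
  have "integrable lborel F" using *(1) by (simp add: complex_of_real_integrable_eq)
  moreover have "complex_of_real (integral\<^sup>L lborel F) = of_real (1 / c)" using *(2) by simp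
  hence "integral\<^sup>L lborel F = 1 / c" by (simp only: of_real_eq_iff)
  ultimately show ?thesis unfolding F_def[symmetric]
    by (subst nn_integral_eq_integral) (auto simp: F_def)
qed

text \<open>Each Gaussian in the entry \<open>(i, j)\<close> contributes the volume \<open>exp (y j - x i)\<close>; the terms \<open>y j\<close> cancel against the modular function.\<close>
lemma delta_B_gaussian_volume:
  "delta_B l y * (\<Prod>(i, j)\<in>lower_idx l. 1 / exp (x i - y j)) = exp (\<Sum>i = 1..Suc l. real (i - 1) * (y i - x i))"
proof -
  have "(\<Prod>(i, j)\<in>lower_idx l. 1 / exp (x i - y j)) = exp (\<Sum>(i, j)\<in>lower_idx l. y j - x i)"
    by (simp add: case_prod_beta' exp_sum exp_diff)
  hence "delta_B l y * (\<Prod>(i, j)\<in>lower_idx l. 1 / exp (x i - y j)) = exp (\<Sum>(i, j)\<in>lower_idx l. y i - x i)"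
    by (simp add: delta_B_def exp_add[symmetric] sum.distrib[symmetric] case_prod_beta')
  thus ?thesis unfolding sum_lower_idx_first .
qed

text \<open>The half-sum \<open>\<rho>\<close> appears as \<open>l / 2 - (i - 1)\<close>: the exponent of the determinant corrected by the volumes of the Gaussians.\<close>
lemma rho_exponent:
  "exp ((z + of_nat l / 2) * of_real ((\<Sum>i = 1..Suc l. x i) - (\<Sum>i = 1..Suc l. y i))) *
     of_real (exp (\<Sum>i = 1..Suc l. real (i - 1) * (y i - x i))) =
   exp (\<Sum>i = 1..Suc l. (z + of_real (rho l i)) * of_real (x i - y i))" for z :: complex
proof -
  have "(z + of_nat l / 2) * of_real ((\<Sum>i = 1..Suc l. x i) - (\<Sum>i = 1..Suc l. y i)) +
      of_real (\<Sum>i = 1..Suc l. real (i - 1) * (y i - x i)) =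
      (\<Sum>i = 1..Suc l. (z + of_nat l / 2) * of_real (x i - y i) + of_real (real (i - 1) * (y i - x i)))"
    by (simp only: sum.distrib sum_subtractf[symmetric] of_real_sum sum_distrib_left)
  also have "\<dots> = (\<Sum>i = 1..Suc l. (z + of_real (rho l i)) * of_real (x i - y i))"
    by (intro sum.cong refl) (auto simp: rho_def of_nat_diff algebra_simps)
  finally show ?thesis by (simp only: exp_of_real[symmetric] mult_exp_exp)
qed

lemma phase_kernel_integral:
  "(LINT m|lebesgue_N l. of_real (delta_B l y) * phase_kernel l lam x y m) = Q0 l x y lam"
proof -
  define c where "c = (\<lambda>(i, j). exp (x i - y j))"
  define t where "t = (\<lambda>(i, j :: nat). if i = Suc j then -1 else 0 :: real)"
  define G where "G p u = of_real (exp (- pi * (c p * u)\<^sup>2)) * exp (\<i> * of_real (2 * pi * t p * u))" for p u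
  define S where "S = (\<Sum>j = 1..l. exp (2 * (y j - x (Suc j))))"
  have c: "c p > 0" for p by (simp add: c_def case_prod_beta')
  have G: "integrable lborel (G p)" "integral\<^sup>L lborel (G p) = of_real (exp (- pi * (t p / c p)\<^sup>2) / c p)" for p
    unfolding G_def[abs_def] by (rule gaussian_fourier_integral[OF c])+
  have "(LINT m|lebesgue_N l. of_real (delta_B l y) * phase_kernel l lam x y m) =
      of_real (delta_B l y) * (torus_weight l lam x y * (LINT m|lebesgue_N l. (\<Prod>p\<in>lower_idx l. G p (m p))))"
    unfolding phase_kernel_product by (simp add: G_def c_def t_def case_prod_beta')
  also have "(LINT m|lebesgue_N l. (\<Prod>p\<in>lower_idx l. G p (m p))) = (\<Prod>p\<in>lower_idx l. of_real (exp (- pi * (t p / c p)\<^sup>2) / c p))"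
    unfolding lebesgue_N_def
    by (subst lebesgue_product.product_integral_prod) (simp_all add: G)
  also have "\<dots> = of_real ((\<Prod>p\<in>lower_idx l. exp (- pi * (t p / c p)\<^sup>2)) * (\<Prod>(i, j)\<in>lower_idx l. 1 / exp (x i - y j)))"
    by (simp add: prod.distrib[symmetric] case_prod_beta' c_def)
  also have "(\<Prod>p\<in>lower_idx l. exp (- pi * (t p / c p)\<^sup>2)) = exp (- pi * S)"
  proof -
    have "(\<Prod>p\<in>lower_idx l. exp (- pi * (t p / c p)\<^sup>2)) = exp (\<Sum>p\<in>lower_idx l. - pi * (t p / c p)\<^sup>2)"
      by (simp add: exp_sum)
    also have "(\<Sum>p\<in>lower_idx l. - pi * (t p / c p)\<^sup>2) =
        (\<Sum>(i, j)\<in>lower_idx l. if i = Suc j then - pi * exp (2 * (y j - x i)) else 0)"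
      by (intro sum.cong) (auto simp: t_def c_def power2_eq_square exp_add[symmetric] exp_diff divide_simps)
    also have "\<dots> = (\<Sum>j = 1..l. - pi * exp (2 * (y j - x (Suc j))))"
      by (rule sum_lower_idx_subdiagonal)
    also have "\<dots> = - pi * S" by (simp only: S_def sum_distrib_left)
    finally show ?thesis .
  qed
  also have "of_real (delta_B l y) * (torus_weight l lam x y * of_real (exp (- pi * S) * (\<Prod>(i, j)\<in>lower_idx l. 1 / exp (x i - y j)))) =
      torus_weight l lam x y * of_real (exp (- pi * S)) * of_real (delta_B l y * (\<Prod>(i, j)\<in>lower_idx l. 1 / exp (x i - y j)))"
    by (simp only: of_real_mult mult_ac)
  also have "\<dots> = 2 ^ Suc l * exp (\<Sum>i = 1..Suc l. (\<i> * lam + of_real (rho l i)) * of_real (x i - y i)) *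
      of_real (exp (- pi * (\<Sum>i = 1..Suc l. exp (2 * (x i - y i))))) * of_real (exp (- pi * S))"
    unfolding delta_B_gaussian_volume torus_weight_def rho_exponent[symmetric] by (simp only: mult_ac)
  also have "\<dots> = Q0 l x y lam"
    unfolding Q0_def S_def exp_of_real[symmetric] mult.assoc mult_exp_exp
    by (simp add: sum.distrib algebra_simps)
  finally show ?thesis .
qed

text \<open>
  For absolute values the character disappears and with it the exponentials coupling neighbouring
  coordinates. Only the terms \<open>exp (2 * (x i - y i))\<close> are left to enforce convergence.
\<close>
lemma phase_kernel_abs_integral:
  "(\<integral>\<^sup>+m. ennreal (delta_B l y * norm (phase_kernel l lam x y m)) \<partial>lebesgue_N l) =
     ennreal (2 ^ Suc l * exp (\<Sum>i = 1..Suc l. (Re (\<i> * lam) + rho l i) * (x i - y i)) * exp (- pi * (\<Sum>i = 1..Suc l. exp (2 * (x i - y i)))))"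
proof -
  define c where "c = (\<lambda>(i, j). exp (x i - y j))"
  define G where "G p u = exp (- pi * (c p * u)\<^sup>2)" for p and u :: real
  have c: "c p > 0" for p by (simp add: c_def case_prod_beta')
  have nnG: "(\<integral>\<^sup>+u. ennreal (G p u) \<partial>lborel) = ennreal (1 / c p)" for p
    unfolding G_def by (rule gaussian_nn_integral[OF c])
  have [measurable]: "G p \<in> borel_measurable borel" for p unfolding G_def[abs_def] by measurable
  have d: "delta_B l y \<ge> 0" by (simp add: delta_B_def)
  have "(\<integral>\<^sup>+m. ennreal (delta_B l y * norm (phase_kernel l lam x y m)) \<partial>lebesgue_N l) =
      (\<integral>\<^sup>+m. ennreal (delta_B l y * norm (torus_weight l lam x y)) * (\<Prod>p\<in>lower_idx l. ennreal (G p (m p))) \<partial>lebesgue_N l)"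
    unfolding phase_kernel_product using d
    by (intro nn_integral_cong)
       (simp add: norm_mult prod_norm[symmetric] case_prod_beta' G_def c_def prod_ennreal ennreal_mult[symmetric] mult.assoc prod_nonneg)
  also have "\<dots> = ennreal (delta_B l y * norm (torus_weight l lam x y)) * (\<integral>\<^sup>+m. (\<Prod>p\<in>lower_idx l. ennreal (G p (m p))) \<partial>lebesgue_N l)"
  proof (rule nn_integral_cmult)
    have "(\<lambda>m. ennreal (G p (m p))) \<in> borel_measurable (lebesgue_N l)" if "p \<in> lower_idx l" for p
      unfolding G_def by (rule measurable_compose[OF measurable_N_component[OF that]]) measurable
    thus "(\<lambda>m. \<Prod>p\<in>lower_idx l. ennreal (G p (m p))) \<in> borel_measurable (lebesgue_N l)"
      by (rule borel_measurable_prod_ennreal)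
  qed
  also have "(\<integral>\<^sup>+m. (\<Prod>p\<in>lower_idx l. ennreal (G p (m p))) \<partial>lebesgue_N l) = (\<Prod>p\<in>lower_idx l. ennreal (1 / c p))"
    unfolding lebesgue_N_def
    by (subst lebesgue_product.product_nn_integral_prod) (simp_all add: nnG)
  also have "\<dots> = ennreal (\<Prod>(i, j)\<in>lower_idx l. 1 / exp (x i - y j))"
    by (subst prod_ennreal) (auto simp: c_def case_prod_beta')
  also have "ennreal (delta_B l y * norm (torus_weight l lam x y)) * ennreal (\<Prod>(i, j)\<in>lower_idx l. 1 / exp (x i - y j)) =
      ennreal (norm (torus_weight l lam x y) * exp (\<Sum>i = 1..Suc l. real (i - 1) * (y i - x i)))"
    unfolding delta_B_gaussian_volume[symmetric] using d
    by (subst ennreal_mult[symmetric]) (auto simp: mult_ac case_prod_beta' intro!: prod_nonneg)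
  also have "norm (torus_weight l lam x y) * exp (\<Sum>i = 1..Suc l. real (i - 1) * (y i - x i)) =
     2 ^ Suc l * norm (exp ((\<i> * lam + of_nat l / 2) * of_real ((\<Sum>i = 1..Suc l. x i) - (\<Sum>i = 1..Suc l. y i))) *
     of_real (exp (\<Sum>i = 1..Suc l. real (i - 1) * (y i - x i)))) * exp (- pi * (\<Sum>i = 1..Suc l. exp (2 * (x i - y i))))"
    unfolding torus_weight_def norm_mult norm_of_real abs_exp_cancel norm_power by simp
  also have "\<dots> = 2 ^ Suc l * exp (\<Sum>i = 1..Suc l. (Re (\<i> * lam) + rho l i) * (x i - y i)) * exp (- pi * (\<Sum>i = 1..Suc l. exp (2 * (x i - y i))))"
    unfolding rho_exponent norm_exp_eq_Re by (simp add: Re_sum del: sum.cl_ivl_Suc)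
  finally show ?thesis .
qed

section \<open>Convolution with the Gaussian kernel\<close>

lemma lebesgue_A_eq: "lebesgue_A l = Leb (Suc l)"
  by (simp add: lebesgue_A_def)

lemma sigma_finite_lebesgue_A: "sigma_finite_measure (lebesgue_A l)"
  and sigma_finite_lebesgue_N: "sigma_finite_measure (lebesgue_N l)"
  unfolding lebesgue_A_def lebesgue_N_def by (auto intro: sigma_finite_PiM_lborel)

lemma phase_kernel_measurable:
  assumes Y: "\<And>i. i \<in> {1..Suc l} \<Longrightarrow> (\<lambda>p. Y p i) \<in> borel_measurable M"
    and m: "\<And>q. q \<in> lower_idx l \<Longrightarrow> (\<lambda>p. m p q) \<in> borel_measurable M"
  shows "(\<lambda>p. phase_kernel l lam x (Y p) (m p)) \<in> borel_measurable M"
proof -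
  have 1: "(\<lambda>p. torus_weight l lam x (Y p)) \<in> borel_measurable M"
  proof -
    have [measurable]: "(\<lambda>p. \<Sum>i = 1..Suc l. Y p i) \<in> borel_measurable M"
      by (intro borel_measurable_sum Y)
    have [measurable]: "(\<lambda>p. \<Sum>i = 1..Suc l. exp (2 * (x i - Y p i))) \<in> borel_measurable M"
    proof (intro borel_measurable_sum)
      fix i assume "i \<in> {1..Suc l}"
      note [measurable] = Y[OF this]
      show "(\<lambda>p. exp (2 * (x i - Y p i))) \<in> borel_measurable M" by measurable
    qed
    show ?thesis unfolding torus_weight_def by measurable
  qed
  have 2: "(\<lambda>p. \<Prod>(i, j)\<in>lower_idx l. of_real (exp (- pi * (exp (x i - Y p j) * m p (i, j))\<^sup>2)) *
        exp (\<i> * of_real (2 * pi * (if i = Suc j then -1 else 0) * m p (i, j)))) \<in> borel_measurable M"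
    unfolding case_prod_beta'
  proof (intro borel_measurable_prod)
    fix q assume q: "q \<in> lower_idx l"
    hence "snd q \<in> {1..Suc l}" by (auto simp: lower_idx_def)
    note [measurable] = Y[OF this] m[OF q, folded surjective_pairing]
    show "(\<lambda>p. of_real (exp (- pi * (exp (x (fst q) - Y p (snd q)) * m p (fst q, snd q))\<^sup>2)) *
        exp (\<i> * of_real (2 * pi * (if fst q = Suc (snd q) then -1 else 0) * m p (fst q, snd q)))) \<in> borel_measurable M"
      unfolding prod.collapse by measurable
  qed
  show ?thesis unfolding phase_kernel_product by (intro borel_measurable_times 1 2)
qed

lemma delta_B_measurable: "delta_B l \<in> borel_measurable (lebesgue_A l)"
proof -
  have "(\<lambda>y. \<Sum>q\<in>lower_idx l. y (fst q) - y (snd q)) \<in> borel_measurable (Leb (Suc l))"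
    by (intro borel_measurable_sum borel_measurable_diff measurable_Leb_component) (auto simp: lower_idx_def)
  note [measurable] = this
  show ?thesis unfolding delta_B_def[abs_def] case_prod_beta' lebesgue_A_eq by measurable
qed

lemma unipotent_quotient_measurable: "unipotent_quotient l n0 \<in> lebesgue_N l \<rightarrow>\<^sub>M lebesgue_N l"
  and distr_unipotent_quotient: "distr (lebesgue_N l) (lebesgue_N l) (unipotent_quotient l n0) = lebesgue_N l"
  by (simp_all add: unipotent_quotient_def[abs_def] distr_quotient_coord)

lemma delta_B_pos: "delta_B l y > 0" by (simp add: delta_B_def)

text \<open>The integrand of the convolution at \<open>k0 * A_elt l x * N_elt l n0\<close> times the density of the Haar measure, without the variable in \<open>K\<close>.\<close>
definition haar_pullback ::
  "nat \<Rightarrow> complex \<Rightarrow> (real mat \<Rightarrow> complex) \<Rightarrow> (nat \<Rightarrow> real) \<Rightarrow> (nat \<times> nat \<Rightarrow> real) \<Rightarrow> (nat \<Rightarrow> real) \<times> (nat \<times> nat \<Rightarrow> real) \<Rightarrow> complex" where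
  "haar_pullback l lam f x n0 = (\<lambda>(y, n). chi_N l n0 *
     (of_real (delta_B l y) * phase_kernel l lam x y (unipotent_quotient l n0 n) * f (A_elt l y)))"

lemma norm_chi_N: "norm (chi_N l n) = 1"
  by (simp add: chi_N_def norm_exp_eq_Re)

context
  fixes l :: nat and \<mu> :: "real mat measure"
  assumes haar: "normalized_haar_K l \<mu>"
begin

lemma space_haar_K: "space \<mu> = K_grp l"
proof -
  have "sets \<mu> = sets (borel_K l)" using haar by (simp add: normalized_haar_K_def)
  hence "space \<mu> = space (borel_K l)" by (rule sets_eq_imp_space_eq)
  thus ?thesis by (simp add: borel_K_def)
qed

lemma prob_space_haar_K: "prob_space \<mu>"
  using haar by (simp add: normalized_haar_K_def)

lemma conv_integrand_density:
  assumes f: "equivariant l f" and k0: "k0 \<in> K_grp l" and p: "p \<in> space (\<mu> \<Otimes>\<^sub>M (lebesgue_A l \<Otimes>\<^sub>M lebesgue_N l))"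
  shows "(case p of (k, y, n) \<Rightarrow> delta_B l y) *\<^sub>R conv_integrand l (phi_Q0 l lam) f (k0 * A_elt l x * N_elt l n0) p =
      haar_pullback l lam f x n0 (snd p)"
proof -
  obtain k y n where pk: "p = (k, y, n)" by (cases p) auto
  have "k \<in> K_grp l" using p unfolding pk by (auto simp: space_pair_measure space_haar_K)
  from conv_integrand_iwasawa[OF f k0 this] show ?thesis
    by (simp add: pk haar_pullback_def scaleR_conv_of_real mult_ac)
qed

lemma delta_density_measurable:
  "(\<lambda>p. case p of (k, y, n) \<Rightarrow> delta_B l y) \<in> borel_measurable (\<mu> \<Otimes>\<^sub>M (lebesgue_A l \<Otimes>\<^sub>M lebesgue_N l))"
proof -
  note [measurable] = delta_B_measurable
  show ?thesis unfolding case_prod_beta' by measurable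
qed

lemma haar_G_eq_density:
  "haar_G l \<mu> = density (\<mu> \<Otimes>\<^sub>M (lebesgue_A l \<Otimes>\<^sub>M lebesgue_N l)) (\<lambda>p. ennreal (case p of (k, y, n) \<Rightarrow> delta_B l y))"
  unfolding haar_G_def by (rule arg_cong[where f = "density _"]) (auto simp: fun_eq_iff)

text \<open>
  The hypothesis gives integrability jointly in all variables, hence measurability of \<open>f\<close> on the torus only
  through the integrand. The integral over \<open>K\<close> is that of a constant against a probability measure, and
  the integral over the unipotent group is evaluated for every fixed \<open>y\<close>.
\<close>
lemma conv_torus_integral:
  assumes f: "equivariant l f" and k0: "k0 \<in> K_grp l"
    and ex: "conv_exists l \<mu> (phi_Q0 l lam) f (k0 * A_elt l x * N_elt l n0)"
  shows "integrable (lebesgue_A l) (\<lambda>y. Q0 l x y lam * f (A_elt l y))"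
    and "conv l \<mu> (phi_Q0 l lam) f (k0 * A_elt l x * N_elt l n0) =
        chi_N l n0 * (LINT y|lebesgue_A l. Q0 l x y lam * f (A_elt l y))"
proof -
  let ?g = "k0 * A_elt l x * N_elt l n0" and ?M = "lebesgue_A l \<Otimes>\<^sub>M lebesgue_N l"
  let ?c = "conv_integrand l (phi_Q0 l lam) f (k0 * A_elt l x * N_elt l n0)"
  define d where "d = (\<lambda>p. case p of (k :: real mat, y, n :: nat \<times> nat \<Rightarrow> real) \<Rightarrow> delta_B l y)"
  define U where "U = haar_pullback l lam f x n0"
  interpret K: prob_space \<mu> by (rule prob_space_haar_K)
  interpret A: sigma_finite_measure "lebesgue_A l" by (rule sigma_finite_lebesgue_A)
  interpret N: sigma_finite_measure "lebesgue_N l" by (rule sigma_finite_lebesgue_N)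
  interpret AN: pair_sigma_finite "lebesgue_A l" "lebesgue_N l" ..
  interpret M: sigma_finite_measure ?M ..
  interpret KM: pair_sigma_finite \<mu> ?M ..
  have G: "haar_G l \<mu> = density (\<mu> \<Otimes>\<^sub>M ?M) (\<lambda>p. ennreal (d p))"
    unfolding d_def by (rule haar_G_eq_density)
  have dm: "d \<in> borel_measurable (\<mu> \<Otimes>\<^sub>M ?M)" unfolding d_def by (rule delta_density_measurable)
  have d0: "AE p in \<mu> \<Otimes>\<^sub>M ?M. 0 \<le> d p"
    by (auto simp: d_def less_imp_le[OF delta_B_pos])
  have ci: "integrable (density (\<mu> \<Otimes>\<^sub>M ?M) (\<lambda>p. ennreal (d p))) ?c"
    using ex unfolding conv_exists_def G .
  hence cm: "?c \<in> borel_measurable (\<mu> \<Otimes>\<^sub>M ?M)" by (auto dest: borel_measurable_integrable)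
  have dc: "d p *\<^sub>R ?c p = U (snd p)" if "p \<in> space (\<mu> \<Otimes>\<^sub>M ?M)" for p
    unfolding d_def U_def by (rule conv_integrand_density[OF f k0 that])
  have "integrable (\<mu> \<Otimes>\<^sub>M ?M) (\<lambda>p. d p *\<^sub>R ?c p)"
    using ci integrable_density[OF cm dm d0] by simp
  hence int: "integrable (\<mu> \<Otimes>\<^sub>M ?M) (\<lambda>(k, q). U q)"
    by (rule Bochner_Integration.integrable_cong[THEN iffD1, rotated 2]) (auto simp: dc)
  have "conv l \<mu> (phi_Q0 l lam) f ?g = (LINT p|(\<mu> \<Otimes>\<^sub>M ?M). d p *\<^sub>R ?c p)"
    unfolding conv_def G by (rule integral_density[OF cm dm d0])
  also have "\<dots> = (LINT p|(\<mu> \<Otimes>\<^sub>M ?M). (\<lambda>(k, q). U q) p)"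
    by (rule Bochner_Integration.integral_cong) (auto simp: dc)
  also have "\<dots> = (LINT q|(?M). LINT k|\<mu>. U q)"
    by (rule KM.integral_snd[OF int, symmetric])
  also have "\<dots> = (LINT q|(?M). U q)" by (simp add: K.prob_space)
  finally have conv: "conv l \<mu> (phi_Q0 l lam) f ?g = (LINT q|(?M). U q)" .
  have Uint: "integrable ?M (\<lambda>(y, n). U (y, n))"
    using KM.integrable_snd[OF int] by (simp add: K.prob_space)
  have inner: "(LINT n|lebesgue_N l. U (y, n)) = chi_N l n0 * (Q0 l x y lam * f (A_elt l y))" for y
  proof -
    have pm: "(\<lambda>m. phase_kernel l lam x y m) \<in> borel_measurable (lebesgue_N l)"
      by (intro phase_kernel_measurable measurable_N_component) auto
    have "(LINT n|lebesgue_N l. U (y, n)) =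
        chi_N l n0 * f (A_elt l y) * (LINT n|lebesgue_N l. of_real (delta_B l y) * phase_kernel l lam x y (unipotent_quotient l n0 n))"
      unfolding U_def haar_pullback_def prod.case integral_mult_right_zero[symmetric]
      by (intro Bochner_Integration.integral_cong refl) (simp add: mult_ac)
    also have "(LINT n|lebesgue_N l. of_real (delta_B l y) * phase_kernel l lam x y (unipotent_quotient l n0 n)) =
        (LINT m|distr (lebesgue_N l) (lebesgue_N l) (unipotent_quotient l n0). of_real (delta_B l y) * phase_kernel l lam x y m)"
      using pm by (intro integral_distr[symmetric] unipotent_quotient_measurable) simp
    also have "\<dots> = Q0 l x y lam"
      unfolding distr_unipotent_quotient by (rule phase_kernel_integral)
    finally show ?thesis by (simp add: mult_ac)
  qed
  have "integrable (lebesgue_A l) (\<lambda>y. chi_N l n0 * (Q0 l x y lam * f (A_elt l y)))"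
    using AN.integrable_fst[OF Uint] unfolding inner .
  moreover have "chi_N l n0 \<noteq> 0" using norm_chi_N[of l n0] by auto
  ultimately show "integrable (lebesgue_A l) (\<lambda>y. Q0 l x y lam * f (A_elt l y))"
    using integrable_mult_nonzero_iff by blast
  have "(LINT q|(?M). U q) = (LINT y|lebesgue_A l. LINT n|lebesgue_N l. U (y, n))"
    using AN.integral_fst[OF Uint] by simp
  also have "\<dots> = chi_N l n0 * (LINT y|lebesgue_A l. Q0 l x y lam * f (A_elt l y))"
    unfolding inner by (rule integral_mult_right_zero)
  finally show "conv l \<mu> (phi_Q0 l lam) f ?g = chi_N l n0 * (LINT y|lebesgue_A l. Q0 l x y lam * f (A_elt l y))"
    unfolding conv .
qed

text \<open>Tonelli's theorem in the same order of integration reduces existence to an integral over the torus.\<close>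
lemma conv_exists_criterion:
  assumes f: "equivariant l f" and k0: "k0 \<in> K_grp l"
    and fm: "(\<lambda>y. f (A_elt l y)) \<in> borel_measurable (lebesgue_A l)"
    and fin: "(\<integral>\<^sup>+y. ennreal (2 ^ Suc l * exp (\<Sum>i = 1..Suc l. (Re (\<i> * lam) + rho l i) * (x i - y i)) *
        exp (- pi * (\<Sum>i = 1..Suc l. exp (2 * (x i - y i))))) * ennreal (norm (f (A_elt l y))) \<partial>lebesgue_A l) < \<infinity>"
  shows "conv_exists l \<mu> (phi_Q0 l lam) f (k0 * A_elt l x * N_elt l n0)"
proof -
  let ?g = "k0 * A_elt l x * N_elt l n0" and ?M = "lebesgue_A l \<Otimes>\<^sub>M lebesgue_N l"
  let ?c = "conv_integrand l (phi_Q0 l lam) f (k0 * A_elt l x * N_elt l n0)"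
  define d where "d = (\<lambda>p. case p of (k :: real mat, y, n :: nat \<times> nat \<Rightarrow> real) \<Rightarrow> delta_B l y)"
  define U where "U = haar_pullback l lam f x n0"
  interpret K: prob_space \<mu> by (rule prob_space_haar_K)
  interpret A: sigma_finite_measure "lebesgue_A l" by (rule sigma_finite_lebesgue_A)
  interpret N: sigma_finite_measure "lebesgue_N l" by (rule sigma_finite_lebesgue_N)
  interpret AN: pair_sigma_finite "lebesgue_A l" "lebesgue_N l" ..
  interpret M: sigma_finite_measure ?M ..
  interpret KM: pair_sigma_finite \<mu> ?M ..
  have G: "haar_G l \<mu> = density (\<mu> \<Otimes>\<^sub>M ?M) (\<lambda>p. ennreal (d p))"
    unfolding d_def by (rule haar_G_eq_density)
  have dm: "d \<in> borel_measurable (\<mu> \<Otimes>\<^sub>M ?M)" unfolding d_def by (rule delta_density_measurable)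
  have d0: "AE p in \<mu> \<Otimes>\<^sub>M ?M. 0 \<le> d p"
    by (auto simp: d_def less_imp_le[OF delta_B_pos])
  have dpos: "d p > 0" for p by (simp add: d_def delta_B_pos case_prod_beta')
  have dc: "d p *\<^sub>R ?c p = U (snd p)" if "p \<in> space (\<mu> \<Otimes>\<^sub>M ?M)" for p
    unfolding d_def U_def by (rule conv_integrand_density[OF f k0 that])
  have pm: "(\<lambda>q. phase_kernel l lam x (fst q) (unipotent_quotient l n0 (snd q))) \<in> borel_measurable ?M"
    unfolding lebesgue_A_eq
    by (intro phase_kernel_measurable measurable_compose[OF measurable_fst measurable_Leb_component]
         measurable_compose[OF measurable_snd measurable_compose[OF unipotent_quotient_measurable measurable_N_component]])
  note [measurable] = fm delta_B_measurable pm
  have Um: "U \<in> borel_measurable ?M"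
    unfolding U_def haar_pullback_def case_prod_beta' by measurable
  have Usnd: "(\<lambda>p. U (snd p)) \<in> borel_measurable (\<mu> \<Otimes>\<^sub>M ?M)"
    by (rule measurable_compose[OF measurable_snd Um])
  have "(\<lambda>p. (1 / d p) *\<^sub>R U (snd p)) \<in> borel_measurable (\<mu> \<Otimes>\<^sub>M ?M)"
    using Usnd dm by measurable
  moreover have "?c p = (1 / d p) *\<^sub>R U (snd p)" if "p \<in> space (\<mu> \<Otimes>\<^sub>M ?M)" for p
    unfolding dc[OF that, symmetric] using dpos[of p] by simp
  ultimately have cm: "?c \<in> borel_measurable (\<mu> \<Otimes>\<^sub>M ?M)"
    by (subst measurable_cong) auto
  have "(\<integral>\<^sup>+p. ennreal (norm (U (snd p))) \<partial>(\<mu> \<Otimes>\<^sub>M ?M)) = (\<integral>\<^sup>+q. \<integral>\<^sup>+k. ennreal (norm (U q)) \<partial>\<mu> \<partial>?M)"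
    using Usnd by (subst KM.nn_integral_snd[symmetric]) auto
  also have "\<dots> = (\<integral>\<^sup>+q. ennreal (norm (U q)) \<partial>?M)" by (simp add: K.emeasure_space_1)
  also have "\<dots> = (\<integral>\<^sup>+y. \<integral>\<^sup>+n. ennreal (norm (U (y, n))) \<partial>lebesgue_N l \<partial>lebesgue_A l)"
    using Um by (subst N.nn_integral_fst[symmetric]) auto
  also have "\<dots> = (\<integral>\<^sup>+y. ennreal (2 ^ Suc l * exp (\<Sum>i = 1..Suc l. (Re (\<i> * lam) + rho l i) * (x i - y i)) *
        exp (- pi * (\<Sum>i = 1..Suc l. exp (2 * (x i - y i))))) * ennreal (norm (f (A_elt l y))) \<partial>lebesgue_A l)"
  proof (intro nn_integral_cong)
    fix y
    have ym: "(\<lambda>m. phase_kernel l lam x y m) \<in> borel_measurable (lebesgue_N l)"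
      by (intro phase_kernel_measurable measurable_N_component) auto
    have "(\<integral>\<^sup>+n. ennreal (norm (U (y, n))) \<partial>lebesgue_N l) =
       (\<integral>\<^sup>+n. ennreal (delta_B l y * norm (phase_kernel l lam x y (unipotent_quotient l n0 n))) * ennreal (norm (f (A_elt l y))) \<partial>lebesgue_N l)"
      by (intro nn_integral_cong)
         (simp add: U_def haar_pullback_def norm_mult norm_chi_N less_imp_le[OF delta_B_pos] ennreal_mult[symmetric])
    also have "\<dots> = (\<integral>\<^sup>+n. ennreal (delta_B l y * norm (phase_kernel l lam x y (unipotent_quotient l n0 n))) \<partial>lebesgue_N l) * ennreal (norm (f (A_elt l y)))"
      using measurable_compose[OF unipotent_quotient_measurable ym] by (intro nn_integral_multc) simp
    also have "(\<integral>\<^sup>+n. ennreal (delta_B l y * norm (phase_kernel l lam x y (unipotent_quotient l n0 n))) \<partial>lebesgue_N l) =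
        (\<integral>\<^sup>+m. ennreal (delta_B l y * norm (phase_kernel l lam x y m)) \<partial>distr (lebesgue_N l) (lebesgue_N l) (unipotent_quotient l n0))"
      using ym by (intro nn_integral_distr[symmetric] unipotent_quotient_measurable) simp
    also have "\<dots> = ennreal (2 ^ Suc l * exp (\<Sum>i = 1..Suc l. (Re (\<i> * lam) + rho l i) * (x i - y i)) *
        exp (- pi * (\<Sum>i = 1..Suc l. exp (2 * (x i - y i)))))"
      unfolding distr_unipotent_quotient by (rule phase_kernel_abs_integral)
    finally show "(\<integral>\<^sup>+n. ennreal (norm (U (y, n))) \<partial>lebesgue_N l) = ennreal (2 ^ Suc l * exp (\<Sum>i = 1..Suc l. (Re (\<i> * lam) + rho l i) * (x i - y i)) *
        exp (- pi * (\<Sum>i = 1..Suc l. exp (2 * (x i - y i))))) * ennreal (norm (f (A_elt l y)))" .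
  qed
  also note fin
  finally have "integrable (\<mu> \<Otimes>\<^sub>M ?M) (\<lambda>p. U (snd p))"
    using Usnd by (intro integrableI_bounded)
  hence "integrable (\<mu> \<Otimes>\<^sub>M ?M) (\<lambda>p. d p *\<^sub>R ?c p)"
    by (rule Bochner_Integration.integrable_cong[THEN iffD1, rotated 2]) (auto simp: dc)
  thus ?thesis unfolding conv_exists_def G using integrable_density[OF cm dm d0] by simp
qed

end

text \<open>The \<open>\<rho>\<close>-shift of \<open>Q0\<close> is a multiplier and does not affect the integral operator otherwise.\<close>
lemma Q0_eq_baxter_kernel:
  "Q0 l x y lam = of_real (exp (\<Sum>j = 1..Suc l. rho l j * (x j - y j))) * baxter_kernel (Suc l) lam x y"
proof -
  have E: "(\<Sum>j = 1..Suc l. (\<i> * lam + of_real (rho l j)) * of_real (x j - y j)) =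
      of_real (\<Sum>j = 1..Suc l. rho l j * (x j - y j)) + \<i> * lam * of_real ((\<Sum>j = 1..Suc l. x j) - (\<Sum>j = 1..Suc l. y j))"
    unfolding sum_subtractf[symmetric] of_real_sum sum_distrib_left sum.distrib[symmetric]
    by (intro sum.cong) (auto simp: algebra_simps)
  have V: "pi * ((\<Sum>k = 1..Suc l. exp (2 * (x k - y k))) + (\<Sum>k\<in>{1..<Suc l}. exp (2 * (y k - x (Suc k))))) =
      pi * (\<Sum>k = 1..l. exp (2 * (x k - y k)) + exp (2 * (y k - x (Suc k)))) + pi * exp (2 * (x (Suc l) - y (Suc l)))"
    by (simp add: atLeastLessThanSuc_atLeastAtMost sum.distrib algebra_simps)
  show ?thesis
    unfolding Q0_def baxter_kernel_def Suc_eq_plus1[symmetric] E V exp_of_real[symmetric]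
      mult.left_commute[of _ "2 ^ Suc l"] mult_exp_exp
    by (simp only: of_real_add diff_diff_eq add_diff_eq)
qed

text \<open>
  The factor \<open>exp (\<Sum> \<rho>\<^sub>j y\<^sub>j)\<close> of the modified Whittaker function cancels the shift by \<open>\<rho>\<close> in \<open>Q0\<close>, and likewise in
  the bound for existence, where it leaves the weighted integral of the majorant.
\<close>
theorem whittaker_convolution:
  assumes haar: "normalized_haar_K l \<mu>" and \<Phi>: "modified_whittaker l \<gamma> \<Phi>"
    and cond: "\<forall>j \<in> {1..l + 1}. Re (\<i> * lam - \<i> * \<gamma> j) > 0" and g: "g \<in> GL l"
  shows "conv_exists l \<mu> (phi_Q0 l lam) \<Phi> g"
    and "conv l \<mu> (phi_Q0 l lam) \<Phi> g = L_inf l (\<lambda>j. \<gamma> j - \<i> * of_real (rho l j)) lam * \<Phi> g"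
proof -
  define \<sigma> where "\<sigma> = Re (\<i> * lam)"
  define R where "R z = (\<Sum>j = 1..Suc l. rho l j * z j)" for z :: "nat \<Rightarrow> real"
  obtain k0 x n0 where k0: "k0 \<in> K_grp l" and g_eq: "g = k0 * A_elt l x * N_elt l n0"
    by (rule iwasawa_decomposition[OF g])
  from \<Phi> obtain c where eq: "equivariant l \<Phi>" and \<Phi>A: "\<And>x. \<Phi> (A_elt l x) = c * of_real (exp (R x)) * whittaker l \<gamma> x"
    by (auto simp: modified_whittaker_def R_def)
  have cond': "\<forall>j \<in> {1..Suc l}. Re (\<i> * lam - \<i> * \<gamma> j) > 0" using cond by simp
  have maj: "givental_majorant m \<gamma> x < \<infinity>" if "m \<le> Suc l" for m x
    using that cond' by (intro givental_majorant_finite[of m lam]) auto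
  have whit: "whittaker l \<gamma> x = givental_integral (Suc l) \<gamma> x" for x
    by (rule whittaker_eq_givental_integral[OF maj])
  note \<Phi>A = \<Phi>A[unfolded whit]
  have Rm: "R \<in> borel_measurable (Leb (Suc l))"
    unfolding R_def[abs_def] by (intro borel_measurable_sum borel_measurable_times borel_measurable_const measurable_Leb_component)
  have \<Phi>m: "(\<lambda>y. \<Phi> (A_elt l y)) \<in> borel_measurable (lebesgue_A l)"
  proof -
    note [measurable] = Rm givental_integral_measurable
    show ?thesis unfolding \<Phi>A lebesgue_A_eq by measurable
  qed
  define w where "w y = ennreal (exp (- \<sigma> * (\<Sum>i = 1..Suc l. y i))) * ennreal (exp (- pi * exp (2 * (x 1 - y 1)))) *
     givental_majorant (Suc l) \<gamma> y" for y
  define C where "C = 2 ^ Suc l * exp (\<sigma> * (\<Sum>i = 1..Suc l. x i)) * exp (R x) * norm c"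
  have wm: "w \<in> borel_measurable (Leb (Suc l))"
    unfolding w_def
  proof (intro borel_measurable_times_ennreal givental_majorant_measurable)
    have [measurable]: "(\<lambda>y. \<Sum>i = 1..Suc l. y i) \<in> borel_measurable (Leb (Suc l))"
      by (intro borel_measurable_sum measurable_Leb_component)
    show "(\<lambda>y. ennreal (exp (- \<sigma> * (\<Sum>i = 1..Suc l. y i)))) \<in> borel_measurable (Leb (Suc l))"
      by measurable
    have [measurable]: "(\<lambda>y. y 1) \<in> borel_measurable (Leb (Suc l))" by (rule measurable_Leb_component) simp
    show "(\<lambda>y. ennreal (exp (- pi * exp (2 * (x 1 - y 1))))) \<in> borel_measurable (Leb (Suc l))" by measurable
  qed
  have bound: "ennreal (2 ^ Suc l * exp (\<Sum>i = 1..Suc l. (Re (\<i> * lam) + rho l i) * (x i - y i)) *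
        exp (- pi * (\<Sum>i = 1..Suc l. exp (2 * (x i - y i))))) * ennreal (norm (\<Phi> (A_elt l y))) \<le> ennreal C * w y" for y
  proof -
    define X where "X = (\<Sum>i = 1..Suc l. x i)"
    define Y where "Y = (\<Sum>i = 1..Suc l. y i)"
    define V where "V = (\<Sum>i = 1..Suc l. exp (2 * (x i - y i)))"
    have V: "exp (2 * (x 1 - y 1)) \<le> V" unfolding V_def by (rule member_le_sum[of 1]) auto
    have "(\<Sum>i = 1..Suc l. (Re (\<i> * lam) + rho l i) * (x i - y i)) = \<sigma> * (X - Y) + (R x - R y)"
      unfolding X_def Y_def R_def \<sigma>_def sum_subtractf[symmetric] sum_distrib_left sum.distrib[symmetric]
      by (intro sum.cong) (auto simp: algebra_simps)
    hence E: "exp (\<Sum>i = 1..Suc l. (Re (\<i> * lam) + rho l i) * (x i - y i)) * exp (R y) = exp (\<sigma> * X) * exp (R x) * exp (- \<sigma> * Y)"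
      unfolding mult_exp_exp by (simp only:) (simp add: algebra_simps)
    have "2 ^ Suc l * exp (\<Sum>i = 1..Suc l. (Re (\<i> * lam) + rho l i) * (x i - y i)) * exp (- pi * V) * (norm c * exp (R y)) =
        2 ^ Suc l * (exp (\<Sum>i = 1..Suc l. (Re (\<i> * lam) + rho l i) * (x i - y i)) * exp (R y)) * norm c * exp (- pi * V)"
      by (simp only: mult_ac)
    also have "\<dots> = C * (exp (- \<sigma> * Y) * exp (- pi * V))"
      unfolding E C_def X_def[symmetric] by (simp only: mult_ac)
    also have "\<dots> \<le> C * (exp (- \<sigma> * Y) * exp (- pi * exp (2 * (x 1 - y 1))))"
      using V by (intro mult_left_mono) (auto simp: C_def)
    finally have real_bound: "2 ^ Suc l * exp (\<Sum>i = 1..Suc l. (Re (\<i> * lam) + rho l i) * (x i - y i)) * exp (- pi * V) * (norm c * exp (R y))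
        \<le> C * (exp (- \<sigma> * Y) * exp (- pi * exp (2 * (x 1 - y 1))))" .
    have "ennreal (norm (\<Phi> (A_elt l y))) = ennreal (norm c * exp (R y)) * ennreal (norm (givental_integral (Suc l) \<gamma> y))"
      unfolding \<Phi>A by (simp only: norm_mult norm_of_real abs_exp_cancel ennreal_mult norm_ge_zero mult_nonneg_nonneg exp_ge_zero)
    also have "\<dots> \<le> ennreal (norm c * exp (R y)) * givental_majorant (Suc l) \<gamma> y"
      by (intro mult_left_mono norm_givental_integral_le) simp
    finally have \<Phi>_le: "ennreal (norm (\<Phi> (A_elt l y))) \<le> ennreal (norm c * exp (R y)) * givental_majorant (Suc l) \<gamma> y" .
    define D where "D = 2 ^ Suc l * exp (\<Sum>i = 1..Suc l. (Re (\<i> * lam) + rho l i) * (x i - y i)) * exp (- pi * V)"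
    have nonneg: "D \<ge> 0" "norm c * exp (R y) \<ge> 0" "C \<ge> 0" by (simp_all add: D_def C_def)
    have "ennreal D * ennreal (norm (\<Phi> (A_elt l y))) \<le> ennreal D * (ennreal (norm c * exp (R y)) * givental_majorant (Suc l) \<gamma> y)"
      by (intro mult_left_mono \<Phi>_le) simp
    also have "\<dots> = ennreal (D * (norm c * exp (R y))) * givental_majorant (Suc l) \<gamma> y"
      by (simp only: ennreal_mult[OF nonneg(1,2)] mult.assoc)
    also have "\<dots> \<le> ennreal (C * (exp (- \<sigma> * Y) * exp (- pi * exp (2 * (x 1 - y 1))))) * givental_majorant (Suc l) \<gamma> y"
      by (intro mult_right_mono ennreal_leI real_bound[folded D_def]) simp
    also have "\<dots> = ennreal C * w y"
      unfolding w_def Y_def[symmetric] mult.assoc[symmetric]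
      by (simp only: ennreal_mult nonneg exp_ge_zero mult_nonneg_nonneg mult.assoc)
    finally have "ennreal D * ennreal (norm (\<Phi> (A_elt l y))) \<le> ennreal C * w y" .
    thus ?thesis unfolding V_def D_def .
  qed
  have "(\<integral>\<^sup>+y. ennreal (2 ^ Suc l * exp (\<Sum>i = 1..Suc l. (Re (\<i> * lam) + rho l i) * (x i - y i)) *
        exp (- pi * (\<Sum>i = 1..Suc l. exp (2 * (x i - y i))))) * ennreal (norm (\<Phi> (A_elt l y))) \<partial>lebesgue_A l)
      \<le> (\<integral>\<^sup>+y. ennreal C * w y \<partial>Leb (Suc l))"
    unfolding lebesgue_A_eq by (intro nn_integral_mono bound)
  also have "\<dots> = ennreal C * (\<integral>\<^sup>+y. w y \<partial>Leb (Suc l))" by (rule nn_integral_cmult[OF wm])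
  also have "\<dots> < \<infinity>"
    using givental_majorant_weighted_finite[OF cond', of "x 1"] unfolding w_def \<sigma>_def
    by (simp only: ennreal_mult_less_top infinity_ennreal_def) auto
  finally show ex: "conv_exists l \<mu> (phi_Q0 l lam) \<Phi> g"
    unfolding g_eq by (rule conv_exists_criterion[OF haar eq k0 \<Phi>m])
  have "(LINT y|lebesgue_A l. Q0 l x y lam * \<Phi> (A_elt l y)) =
      (LINT y|Leb (Suc l). c * of_real (exp (R x)) * (baxter_kernel (Suc l) lam x y * givental_integral (Suc l) \<gamma> y))"
    unfolding lebesgue_A_eq
  proof (intro Bochner_Integration.integral_cong refl)
    fix y
    have "exp (\<Sum>j = 1..Suc l. rho l j * (x j - y j)) * exp (R y) = exp (R x)"
      unfolding exp_add[symmetric] R_def by (simp add: right_diff_distrib sum_subtractf)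
    hence E: "of_real (exp (\<Sum>j = 1..Suc l. rho l j * (x j - y j))) * of_real (exp (R y)) = (of_real (exp (R x)) :: complex)"
      by (simp only: of_real_mult[symmetric])
    show "Q0 l x y lam * \<Phi> (A_elt l y) = c * of_real (exp (R x)) * (baxter_kernel (Suc l) lam x y * givental_integral (Suc l) \<gamma> y)"
      unfolding \<Phi>A Q0_eq_baxter_kernel E[symmetric] by (simp only: mult_ac)
  qed
  also have "\<dots> = c * of_real (exp (R x)) * (LINT y|Leb (Suc l). baxter_kernel (Suc l) lam x y * givental_integral (Suc l) \<gamma> y)"
    by (rule integral_mult_right_zero)
  also have "\<dots> = c * of_real (exp (R x)) * ((\<Prod>j = 1..Suc l. gamma_factor (\<i> * lam - \<i> * \<gamma> j)) * givental_integral (Suc l) \<gamma> x)"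
    unfolding baxter_givental_integral[OF cond'] ..
  also have "(\<Prod>j = 1..Suc l. gamma_factor (\<i> * lam - \<i> * \<gamma> j)) = L_inf l (\<lambda>j. \<gamma> j - \<i> * of_real (rho l j)) lam"
    unfolding L_inf_def gamma_factor_def by (intro prod.cong) (auto simp: algebra_simps)
  finally have torus: "(LINT y|lebesgue_A l. Q0 l x y lam * \<Phi> (A_elt l y)) =
      L_inf l (\<lambda>j. \<gamma> j - \<i> * of_real (rho l j)) lam * \<Phi> (A_elt l x)"
    unfolding \<Phi>A by (simp only: mult_ac)
  have "\<Phi> g = chi_N l n0 * \<Phi> (A_elt l x)"
    using eq k0 unfolding g_eq by (auto simp: equivariant_def)
  thus "conv l \<mu> (phi_Q0 l lam) \<Phi> g = L_inf l (\<lambda>j. \<gamma> j - \<i> * of_real (rho l j)) lam * \<Phi> g"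
    using conv_torus_integral(2)[OF haar eq k0 ex[unfolded g_eq]] unfolding g_eq[symmetric] torus by simp
qed

theorem theorem5p1:
  fixes l :: nat and lam :: complex and \<mu> :: "real mat measure"
  assumes haar: "normalized_haar_K l \<mu>"
  shows "K_biinvariant l (phi_Q0 l lam)
    \<and> (\<forall>f x. equivariant l f \<longrightarrow> conv_exists l \<mu> (phi_Q0 l lam) f (A_elt l x) \<longrightarrow>
         integrable (lebesgue_A l) (\<lambda>y. Q0 l x y lam * f (A_elt l y))
       \<and> conv l \<mu> (phi_Q0 l lam) f (A_elt l x)
           = (LINT y | lebesgue_A l. Q0 l x y lam * f (A_elt l y)))
    \<and> (\<forall>\<gamma> \<Phi>. modified_whittaker l \<gamma> \<Phi> \<longrightarrow>
         (\<forall>j \<in> {1..l + 1}. Re (\<i> * lam - \<i> * \<gamma> j) > 0) \<longrightarrow>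
         (\<forall>g \<in> GL l. conv_exists l \<mu> (phi_Q0 l lam) \<Phi> g
            \<and> conv l \<mu> (phi_Q0 l lam) \<Phi> g
                = L_inf l (\<lambda>j. \<gamma> j - \<i> * of_real (rho l j)) lam * \<Phi> g))"
proof (intro conjI)
  show "K_biinvariant l (phi_Q0 l lam)"
    by (auto simp: K_biinvariant_def GL_def intro!: phi_Q0_biinvariant)
  show "\<forall>f x. equivariant l f \<longrightarrow> conv_exists l \<mu> (phi_Q0 l lam) f (A_elt l x) \<longrightarrow>
         integrable (lebesgue_A l) (\<lambda>y. Q0 l x y lam * f (A_elt l y))
       \<and> conv l \<mu> (phi_Q0 l lam) f (A_elt l x)
           = (LINT y | lebesgue_A l. Q0 l x y lam * f (A_elt l y))"
  proof (intro allI impI)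
    fix f x assume f: "equivariant l f" and ex: "conv_exists l \<mu> (phi_Q0 l lam) f (A_elt l x)"
    have one: "1\<^sub>m (Suc l) \<in> K_grp l" by (simp add: K_grp_def)
    have g: "1\<^sub>m (Suc l) * A_elt l x * N_elt l (\<lambda>_. 0) = A_elt l x"
      using left_mult_one_mat[OF A_elt_carrier] right_mult_one_mat[OF A_elt_carrier] by (simp add: N_elt_zero)
    have chi: "chi_N l (\<lambda>_. 0) = 1" by (simp add: chi_N_def)
    from conv_torus_integral[OF haar f one, of lam x "\<lambda>_. 0", unfolded g chi, OF ex]
    show "integrable (lebesgue_A l) (\<lambda>y. Q0 l x y lam * f (A_elt l y))
       \<and> conv l \<mu> (phi_Q0 l lam) f (A_elt l x) = (LINT y | lebesgue_A l. Q0 l x y lam * f (A_elt l y))"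
      by simp
  qed
  show "\<forall>\<gamma> \<Phi>. modified_whittaker l \<gamma> \<Phi> \<longrightarrow>
         (\<forall>j \<in> {1..l + 1}. Re (\<i> * lam - \<i> * \<gamma> j) > 0) \<longrightarrow>
         (\<forall>g \<in> GL l. conv_exists l \<mu> (phi_Q0 l lam) \<Phi> g
            \<and> conv l \<mu> (phi_Q0 l lam) \<Phi> g
                = L_inf l (\<lambda>j. \<gamma> j - \<i> * of_real (rho l j)) lam * \<Phi> g)"
    using whittaker_convolution[OF haar] by blast
qed

end
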